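(* Let $k \geq 1$ and let $N_1, \ldots, N_k$ be finitely generated torsion-free non-abelian nilpotent groups such that $N_i$ is rationally indecomposable for each $i \in \{1, \ldots, k\}$. Put $N = N_1 \times \cdots \times N_k$. Let $\varphi = (\varphi_{ij})_{ij} \in \operatorname{Aut}(N)$, where $\varphi_{ij} \colon N_j \to N_i$ are the matrix entries of $\varphi$. Then the following hold: 1) For each $i \in \{1, \ldots, k\}$, there is a unique $\sigma(i) \in \{1, \ldots, k\}$ such that $\varphi_{i\sigma(i)}$ is an isomorphism. 2) For each $j \in \{1, \ldots, k\}$, there is a unique $i \in \{1, \ldots, k\}$ such that $\varphi_{ij}$ is an isomorphism. 3) For each $i \in \{1, \ldots, k\}$ and for each $j \in \{1, \ldots, k\}$ different from $\sigma(i)$, we have $\operatorname{Im} \varphi_{ij} \leq Z(N_i)$.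
   Context: The rational Malcev completion $N^{\mathbb{Q}}$ of a finitely generated torsion-free nilpotent group $N$ is the unique (up to isomorphism) torsion-free nilpotent group such that: (1) $N$ embeds into $N^{\mathbb{Q}}$; (2) for all $n \in N$ and all integers $m \geq 1$ there is a unique $x \in N^{\mathbb{Q}}$ with $x^m = n$; (3) for all $x \in N^{\mathbb{Q}}$ there is an integer $m \geq 1$ with $x^m \in N$. A group $G$ is directly indecomposable if $G \cong H \times K$ implies $H = 1$ or $K = 1$. A finitely generated torsion-free nilpotent group $N$ is rationally indecomposable if $N^{\mathbb{Q}}$ is directly indecomposable. For groups $G_1, \ldots, G_n$ and an endomorphism $\varphi$ of $G = G_1 \times \cdots \times G_n$, the matrix entries of $\varphi$ are the homomorphisms $\varphi_{ij} = \pi_i \circ \varphi \circ e_j \colon G_j \to G_i$, where $\pi_i \colon G \to G_i$ is the canonical projection and $e_j \colon G_j \to G$ the canonical inclusion; one writes $\varphi = (\varphi_{ij})_{ij}$. $Z(G)$ denotes the centre of $G$. *)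

theory Defs
  imports "HOL-Algebra.Algebra"
begin

fun lower_central :: "('a, 'm) monoid_scheme \<Rightarrow> nat \<Rightarrow> 'a set" where
  "lower_central G 0 = carrier G"
| "lower_central G (Suc n) = generate G
     {x \<otimes>\<^bsub>G\<^esub> y \<otimes>\<^bsub>G\<^esub> inv\<^bsub>G\<^esub> x \<otimes>\<^bsub>G\<^esub> inv\<^bsub>G\<^esub> y | x y. x \<in> lower_central G n \<and> y \<in> carrier G}"

definition nilpotent_group :: "('a, 'm) monoid_scheme \<Rightarrow> bool" where
  "nilpotent_group G \<longleftrightarrow> group G \<and> (\<exists>c. lower_central G c = {\<one>\<^bsub>G\<^esub>})"

definition torsion_free :: "('a, 'm) monoid_scheme \<Rightarrow> bool" where
  "torsion_free G \<longleftrightarrow>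
     (\<forall>x \<in> carrier G. \<forall>m::nat. m \<ge> 1 \<and> x [^]\<^bsub>G\<^esub> m = \<one>\<^bsub>G\<^esub> \<longrightarrow> x = \<one>\<^bsub>G\<^esub>)"

definition finitely_generated :: "('a, 'm) monoid_scheme \<Rightarrow> bool" where
  "finitely_generated G \<longleftrightarrow> (\<exists>S. finite S \<and> S \<subseteq> carrier G \<and> generate G S = carrier G)"

definition centre :: "('a, 'm) monoid_scheme \<Rightarrow> 'a set" where
  "centre G = {z \<in> carrier G. \<forall>x \<in> carrier G. z \<otimes>\<^bsub>G\<^esub> x = x \<otimes>\<^bsub>G\<^esub> z}"

(* The factors may be taken over the carrier type of G, since direct factors of G are isomorphic
   to subgroups of G; directly_indecomposable_factors below removes this restriction. Note that
   the trivial group counts as directly indecomposable. *)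
definition directly_indecomposable :: "('a, 'm) monoid_scheme \<Rightarrow> bool" where
  "directly_indecomposable G \<longleftrightarrow>
     (\<forall>(H :: 'a monoid) (K :: 'a monoid). group H \<and> group K \<and> G \<cong> H \<times>\<times> K \<longrightarrow>
        trivial_group H \<or> trivial_group K)"

definition malcev_completion ::
  "('a, 'm) monoid_scheme \<Rightarrow> ('b, 'n) monoid_scheme \<Rightarrow> ('a \<Rightarrow> 'b) \<Rightarrow> bool" where
  "malcev_completion N M \<iota> \<longleftrightarrow>
     nilpotent_group M \<and> torsion_free M \<and>
     \<iota> \<in> mon N M \<and>
     (\<forall>n \<in> carrier N. \<forall>m::nat. m \<ge> 1 \<longrightarrow> (\<exists>!x. x \<in> carrier M \<and> x [^]\<^bsub>M\<^esub> m = \<iota> n)) \<and>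
     (\<forall>x \<in> carrier M. \<exists>m::nat. m \<ge> 1 \<and> x [^]\<^bsub>M\<^esub> m \<in> \<iota> ` carrier N)"

(* The completion of a finitely generated group is countable, so it has a copy whose elements are
   natural numbers; rationally_indecomposableI below allows an arbitrary carrier type. *)
definition rationally_indecomposable :: "('a, 'm) monoid_scheme \<Rightarrow> bool" where
  "rationally_indecomposable N \<longleftrightarrow>
     (\<exists>(M :: nat monoid) \<iota>. malcev_completion N M \<iota> \<and> directly_indecomposable M)"

definition canonical_inclusion ::
  "'i set \<Rightarrow> ('i \<Rightarrow> ('a, 'm) monoid_scheme) \<Rightarrow> 'i \<Rightarrow> 'a \<Rightarrow> 'i \<Rightarrow> 'a" where
  "canonical_inclusion I G j x = (\<lambda>l\<in>I. if l = j then x else \<one>\<^bsub>G l\<^esub>)"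

definition canonical_projection :: "'i \<Rightarrow> ('i \<Rightarrow> 'a) \<Rightarrow> 'a" where
  "canonical_projection i f = f i"

definition matrix_entry ::
  "'i set \<Rightarrow> ('i \<Rightarrow> ('a, 'm) monoid_scheme) \<Rightarrow> (('i \<Rightarrow> 'a) \<Rightarrow> ('i \<Rightarrow> 'a)) \<Rightarrow> 'i \<Rightarrow> 'i \<Rightarrow> 'a \<Rightarrow> 'a" where
  "matrix_entry I G \<phi> i j = canonical_projection i \<circ> \<phi> \<circ> canonical_inclusion I G j"


lemma transport_group:
  fixes H :: "('a, 'm) monoid_scheme" and p :: "'a \<Rightarrow> 'b"
  assumes "group H" and inj: "inj_on p (carrier H)"
  shows "\<exists>H' :: 'b monoid. group H' \<and> p \<in> iso H H'"
proof -
  interpret group H by fact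
  let ?q = "inv_into (carrier H) p"
  define H' :: "'b monoid" where "H' = \<lparr>carrier = p ` carrier H,
    monoid.mult = (\<lambda>a b. p (?q a \<otimes>\<^bsub>H\<^esub> ?q b)), one = p \<one>\<^bsub>H\<^esub>\<rparr>"
  have q: "?q (p x) = x" if "x \<in> carrier H" for x
    using inj that by simp
  have p: "p \<in> iso H H'"
    using inj by (auto simp: iso_def hom_def bij_betw_def H'_def q)
  have "group (H'\<lparr>one := p \<one>\<^bsub>H\<^esub>\<rparr>)"
    by (rule iso_imp_img_group[OF p])
  then show ?thesis using p by (auto simp: H'_def)
qed

lemma directly_indecomposable_factors:
  fixes G :: "('a, 'm) monoid_scheme" and H :: "('b, 'n) monoid_scheme"
    and K :: "('c, 'o) monoid_scheme"
  assumes G: "directly_indecomposable G" "group G"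
    and H: "group H" and K: "group K" and iso: "G \<cong> H \<times>\<times> K"
  shows "trivial_group H \<or> trivial_group K"
proof -
  interpret H: group H by fact
  interpret K: group K by fact
  obtain f where f: "f \<in> iso G (H \<times>\<times> K)" using iso by (auto simp: is_iso_def)
  define g where "g = inv_into (carrier G) f"
  have "g \<in> iso (H \<times>\<times> K) G" unfolding g_def using group.iso_set_sym[OF G(2) f] .
  then have inj: "inj_on g (carrier H \<times> carrier K)" by (auto simp: iso_def bij_betw_def)
  have "inj_on (\<lambda>h. g (h, \<one>\<^bsub>K\<^esub>)) (carrier H)" "inj_on (\<lambda>k. g (\<one>\<^bsub>H\<^esub>, k)) (carrier K)"
    by (auto intro!: inj_onI dest: inj_onD[OF inj])
  then obtain H' K' :: "'a monoid" where
    H': "group H'" "(\<lambda>h. g (h, \<one>\<^bsub>K\<^esub>)) \<in> iso H H'" and K': "group K'" "(\<lambda>k. g (\<one>\<^bsub>H\<^esub>, k)) \<in> iso K K'"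
    using transport_group[OF H] transport_group[OF K] by blast
  from H' K' have i: "H \<cong> H'" "K \<cong> K'" by (auto simp: is_iso_def)
  have "H \<times>\<times> K \<cong> H' \<times>\<times> K'"
    using H.DirProd_iso_trans[OF i] .
  then have "G \<cong> H' \<times>\<times> K'" using iso iso_trans by blast
  then have "trivial_group H' \<or> trivial_group K'"
    using G(1) H'(1) K'(1) by (auto simp: directly_indecomposable_def)
  then show ?thesis
    using H'(1) K'(1) H K i by (meson isomorphic_group_triviality)
qed

lemma countable_generate:
  assumes "group G" "countable S" "S \<subseteq> carrier G"
  shows "countable (generate G S)"
proof -
  interpret group G by fact
  define W where "W = S \<union> (\<lambda>x. inv\<^bsub>G\<^esub> x) ` S"
  have "\<exists>xs. set xs \<subseteq> W \<and> x = foldr (\<otimes>\<^bsub>G\<^esub>) xs \<one>\<^bsub>G\<^esub>" if "x \<in> generate G S" for x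
    using that
  proof induction
    case one then show ?case by (intro exI[of _ "[]"]) auto
  next
    case (incl h) then show ?case using assms(3) by (intro exI[of _ "[h]"]) (auto simp: W_def)
  next
    case (inv h) then show ?case using assms(3) by (intro exI[of _ "[inv\<^bsub>G\<^esub> h]"]) (auto simp: W_def)
  next
    case (eng a b)
    then obtain xs ys where xs: "set xs \<subseteq> W" "a = foldr (\<otimes>\<^bsub>G\<^esub>) xs \<one>\<^bsub>G\<^esub>"
      and ys: "set ys \<subseteq> W" "b = foldr (\<otimes>\<^bsub>G\<^esub>) ys \<one>\<^bsub>G\<^esub>" by blast
    have W: "W \<subseteq> carrier G" using assms(3) by (auto simp: W_def)
    have b: "b \<in> carrier G" using eng(2) generate_in_carrier[OF assms(3)] by blast
    have cl: "set xs \<subseteq> W \<Longrightarrow> foldr (\<otimes>\<^bsub>G\<^esub>) xs \<one>\<^bsub>G\<^esub> \<in> carrier G" for xs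
      using W by (induction xs) auto
    have "foldr (\<otimes>\<^bsub>G\<^esub>) xs \<one>\<^bsub>G\<^esub> \<otimes>\<^bsub>G\<^esub> b = foldr (\<otimes>\<^bsub>G\<^esub>) xs b" using xs(1)
    proof (induction xs)
      case (Cons x xs)
      then show ?case using W b cl[of xs] by (auto simp: m_assoc)
    qed (use b in simp)
    then show ?case using xs ys by (intro exI[of _ "xs @ ys"]) auto
  qed
  then have "generate G S \<subseteq> (\<lambda>xs. foldr (\<otimes>\<^bsub>G\<^esub>) xs \<one>\<^bsub>G\<^esub>) ` lists W" by (auto simp: image_iff in_lists_conv_set subset_iff)
  moreover have "countable (lists W)" using assms(2) by (simp add: W_def)
  ultimately show ?thesis by (meson countable_image countable_subset)
qed

lemma rationally_indecomposableI:
  fixes N :: "('a, 'm) monoid_scheme" and M :: "('b, 'n) monoid_scheme"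
  assumes N: "group N" "finitely_generated N"
    and M: "malcev_completion N M \<iota>" "directly_indecomposable M"
  shows "rationally_indecomposable N"
proof -
  have nil: "nilpotent_group M" and tf: "torsion_free M" and \<iota>: "\<iota> \<in> mon N M"
    and roots: "\<And>n m. n \<in> carrier N \<Longrightarrow> (m::nat) \<ge> 1 \<Longrightarrow> \<exists>!x. x \<in> carrier M \<and> x [^]\<^bsub>M\<^esub> m = \<iota> n"
    and pow: "\<And>x. x \<in> carrier M \<Longrightarrow> \<exists>m::nat. m \<ge> 1 \<and> x [^]\<^bsub>M\<^esub> m \<in> \<iota> ` carrier N"
    using M(1) by (auto simp: malcev_completion_def)
  interpret M: group M using nil by (simp add: nilpotent_group_def)
  have cN: "countable (carrier N)"
    using N countable_generate[OF N(1)] by (metis countable_finite finitely_generated_def)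
  define r where "r = (\<lambda>(n, m::nat). THE x. x \<in> carrier M \<and> x [^]\<^bsub>M\<^esub> m = \<iota> n)"
  have "x \<in> r ` (carrier N \<times> UNIV)" if x: "x \<in> carrier M" for x
  proof -
    obtain m n where m: "m \<ge> 1" "n \<in> carrier N" "x [^]\<^bsub>M\<^esub> (m::nat) = \<iota> n" using pow[OF x] by auto
    have "r (n, m) = x" using roots[OF m(2,1)] m(3) x by (auto simp: r_def intro!: the1_equality)
    then show ?thesis using m(2) by force
  qed
  then have "countable (carrier M)"
    using cN by (meson countable_SIGMA countable_image countable_subset countableI_type subsetI)
  then obtain p :: "'b \<Rightarrow> nat" where "inj_on p (carrier M)" by (auto simp: countable_def)
  then obtain M' :: "nat monoid" where M': "group M'" and p: "p \<in> iso M M'"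
    using transport_group[OF M.group_axioms] by blast
  interpret M': group M' by fact
  interpret p: group_hom M M' p
    using p by unfold_locales (simp add: iso_def)
  have inj: "inj_on p (carrier M)" and surj: "p ` carrier M = carrier M'"
    using p by (auto simp: iso_def bij_betw_def)
  have lc: "lower_central M' n = p ` lower_central M n \<and> lower_central M n \<subseteq> carrier M" for n
  proof (induction n)
    case (Suc n)
    let ?A = "{x \<otimes>\<^bsub>M\<^esub> y \<otimes>\<^bsub>M\<^esub> inv\<^bsub>M\<^esub> x \<otimes>\<^bsub>M\<^esub> inv\<^bsub>M\<^esub> y | x y. x \<in> lower_central M n \<and> y \<in> carrier M}"
    have A: "?A \<subseteq> carrier M" using Suc by auto
    have "{x \<otimes>\<^bsub>M'\<^esub> y \<otimes>\<^bsub>M'\<^esub> inv\<^bsub>M'\<^esub> x \<otimes>\<^bsub>M'\<^esub> inv\<^bsub>M'\<^esub> y | x y. x \<in> p ` lower_central M n \<and> y \<in> carrier M'} = p ` ?A"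
    proof (intro subset_antisym subsetI)
      fix z assume "z \<in> {x \<otimes>\<^bsub>M'\<^esub> y \<otimes>\<^bsub>M'\<^esub> inv\<^bsub>M'\<^esub> x \<otimes>\<^bsub>M'\<^esub> inv\<^bsub>M'\<^esub> y | x y. x \<in> p ` lower_central M n \<and> y \<in> carrier M'}"
      then obtain x y where xy: "x \<in> lower_central M n" "y \<in> carrier M"
        "z = p x \<otimes>\<^bsub>M'\<^esub> p y \<otimes>\<^bsub>M'\<^esub> inv\<^bsub>M'\<^esub> p x \<otimes>\<^bsub>M'\<^esub> inv\<^bsub>M'\<^esub> p y" unfolding surj[symmetric] by blast
      have "x \<in> carrier M" using xy Suc by auto
      then have "z = p (x \<otimes>\<^bsub>M\<^esub> y \<otimes>\<^bsub>M\<^esub> inv\<^bsub>M\<^esub> x \<otimes>\<^bsub>M\<^esub> inv\<^bsub>M\<^esub> y)" using xy by simp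
      then show "z \<in> p ` ?A" using xy by blast
    next
      fix z assume "z \<in> p ` ?A"
      then obtain x y where xy: "x \<in> lower_central M n" "y \<in> carrier M"
        "z = p (x \<otimes>\<^bsub>M\<^esub> y \<otimes>\<^bsub>M\<^esub> inv\<^bsub>M\<^esub> x \<otimes>\<^bsub>M\<^esub> inv\<^bsub>M\<^esub> y)" by blast
      have "x \<in> carrier M" using xy Suc by auto
      then have "z = p x \<otimes>\<^bsub>M'\<^esub> p y \<otimes>\<^bsub>M'\<^esub> inv\<^bsub>M'\<^esub> p x \<otimes>\<^bsub>M'\<^esub> inv\<^bsub>M'\<^esub> p y" using xy by simp
      then show "z \<in> {x \<otimes>\<^bsub>M'\<^esub> y \<otimes>\<^bsub>M'\<^esub> inv\<^bsub>M'\<^esub> x \<otimes>\<^bsub>M'\<^esub> inv\<^bsub>M'\<^esub> y | x y. x \<in> p ` lower_central M n \<and> y \<in> carrier M'}"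
        using xy unfolding surj[symmetric] by blast
    qed
    then show ?case
      using Suc p.generate_img[OF A] M.generate_in_carrier[OF A] by auto
  qed (simp add: surj)
  have "malcev_completion N M' (p \<circ> \<iota>)"
    unfolding malcev_completion_def
  proof (intro conjI ballI allI impI)
    show "nilpotent_group M'"
      using nil lc M' by (fastforce simp: nilpotent_group_def)
    show "torsion_free M'"
      unfolding torsion_free_def surj[symmetric]
    proof (clarify)
      fix x and m :: nat assume x: "x \<in> carrier M" "1 \<le> m" "p x [^]\<^bsub>M'\<^esub> m = \<one>\<^bsub>M'\<^esub>"
      then have "p (x [^]\<^bsub>M\<^esub> m) = p \<one>\<^bsub>M\<^esub>" by (simp add: p.hom_nat_pow)
      then have "x [^]\<^bsub>M\<^esub> m = \<one>\<^bsub>M\<^esub>" using inj x by (meson M.nat_pow_closed M.one_closed inj_onD)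
      then have "x = \<one>\<^bsub>M\<^esub>" using tf x by (auto simp: torsion_free_def)
      then show "p x = \<one>\<^bsub>M'\<^esub>" by simp
    qed
    show "p \<circ> \<iota> \<in> mon N M'"
      using \<iota> p by (auto simp: mon_def iso_def hom_def bij_betw_def inj_on_def Pi_iff)
  next
    fix n and m :: nat assume nm: "n \<in> carrier N" "1 \<le> m"
    have \<iota>n: "\<iota> n \<in> carrier M" using \<iota> nm by (auto simp: mon_def hom_def)
    obtain x where x: "x \<in> carrier M" "x [^]\<^bsub>M\<^esub> m = \<iota> n"
      and u: "\<And>y. y \<in> carrier M \<Longrightarrow> y [^]\<^bsub>M\<^esub> m = \<iota> n \<Longrightarrow> y = x" using roots[OF nm] by blast
    show "\<exists>!x. x \<in> carrier M' \<and> x [^]\<^bsub>M'\<^esub> m = (p \<circ> \<iota>) n"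
    proof (rule ex1I[of _ "p x"])
      show "p x \<in> carrier M' \<and> p x [^]\<^bsub>M'\<^esub> m = (p \<circ> \<iota>) n"
        using x by (simp flip: p.hom_nat_pow)
    next
      fix y assume y: "y \<in> carrier M' \<and> y [^]\<^bsub>M'\<^esub> m = (p \<circ> \<iota>) n"
      then obtain z where z: "z \<in> carrier M" "y = p z" using surj by blast
      then have "p (z [^]\<^bsub>M\<^esub> m) = p (\<iota> n)" using y by (simp add: p.hom_nat_pow)
      then have "z [^]\<^bsub>M\<^esub> m = \<iota> n" using inj z \<iota>n by (meson M.nat_pow_closed inj_onD)
      then show "y = p x" using u z by simp
    qed
  next
    fix x assume "x \<in> carrier M'"
    then obtain z where z: "z \<in> carrier M" "x = p z" using surj by blast
    then obtain m :: nat where m: "m \<ge> 1" "z [^]\<^bsub>M\<^esub> m \<in> \<iota> ` carrier N" using pow by blast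
    have "x [^]\<^bsub>M'\<^esub> m = p (z [^]\<^bsub>M\<^esub> m)" using z by (simp add: p.hom_nat_pow)
    then show "\<exists>m::nat. m \<ge> 1 \<and> x [^]\<^bsub>M'\<^esub> m \<in> (p \<circ> \<iota>) ` carrier N" using m by fastforce
  qed
  moreover have "directly_indecomposable M'"
    unfolding directly_indecomposable_def
  proof (intro allI impI)
    fix H K :: "nat monoid" assume A: "group H \<and> group K \<and> M' \<cong> H \<times>\<times> K"
    have "M \<cong> M'" using p by (auto simp: is_iso_def)
    then have "M \<cong> H \<times>\<times> K" using A iso_trans by blast
    then show "trivial_group H \<or> trivial_group K"
      using directly_indecomposable_factors[OF M(2) M.group_axioms] A by blast
  qed
  ultimately show ?thesis by (auto simp: rationally_indecomposable_def)
qed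

end

theory Submission
  imports Defs
begin

text \<open>
  An automorphism \<open>\<phi>\<close> of \<open>N\<close> extends to \<open>\<Phi>\<close> on the product of the completions \<open>M\<^sub>i\<close>. Isolated subgroups
  of \<open>M\<^sub>i\<close> satisfy both chain conditions, so Fitting's lemma holds for normal endomorphisms of \<open>M\<^sub>i\<close>, and
  by indecomposability such an endomorphism is bijective or nilpotent. Writing the identity of \<open>M\<^sub>i\<close> as the sum of the
  endomorphisms \<open>\<Phi>\<^sub>i\<^sub>j \<circ> (\<Phi>\<inverse>)\<^sub>j\<^sub>i\<close>, whose images commute, some summand is bijective, so some
  \<open>\<Phi>\<^sub>i\<^sub>j\<close> with \<open>j = \<sigma> i\<close> is surjective; as the images of the entries in a row commute, all other entries in row \<open>i\<close> are central.
  If \<open>\<sigma>\<close> missed \<open>j\<close>, column \<open>j\<close> would be central and \<open>N\<^sub>j\<close> abelian; hence \<open>\<sigma>\<close> is a permutation.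

  Since \<open>M\<^sub>j\<close> has no abelian direct factor, a homomorphism from \<open>M\<^sub>j\<close> with abelian image kills the centre.
  So \<open>\<phi>\<close> restricted to the centre of \<open>N\<close> is a monomial matrix. This makes \<open>\<phi>\<^sub>i\<^sub>\<sigma>\<^sub>i\<close> bijective between
  centres, hence injective (a nontrivial normal subgroup of a nilpotent group meets the centre), and also surjective,
  since \<open>N\<^sub>i\<close> is the product of its image and the centre.
\<close>

section \<open>Commutators and the lower central series\<close>

text \<open>Indecomposability is assumed of the completions only, so the exchange argument has to
  run there. What it yields, surjectivity of one entry of \<Phi> in each row, does not descend by
  itself: doubling is bijective on the rationals and not on the integers. The centre of
  \<open>N\<close> supplies the missing integrality. On it the entries off \<sigma> vanish rather
  than merely being central, so bijectivity of \<phi> itself passes to the remaining entries.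
  Non-abelian factors are essential: for two infinite cyclic factors every integral matrix of
  determinant 1 is an automorphism, and all its entries have central image.

  A completion has no chain condition on arbitrary subgroups (the additive rationals already fail).
  Kernels and images of homomorphisms between uniquely divisible groups are isolated, however, and a
  bounded function that is strictly monotone on isolated subgroups controls their chains in both
  directions. It replaces the Hirsch length: one climbs from the trivial group to \<open>G\<close>
  in cyclic steps along the lower central series and counts the steps in which a subgroup
  contributes an element of infinite order.\<close>

definition (in group) comtr :: "'a \<Rightarrow> 'a \<Rightarrow> 'a" where
  "comtr x y = x \<otimes> y \<otimes> inv x \<otimes> inv y"

declare lower_central.simps(2) [simp del]

context group
begin

lemma inv_cancel_left:
  "x \<in> carrier G \<Longrightarrow> y \<in> carrier G \<Longrightarrow> inv x \<otimes> (x \<otimes> y) = y"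
  "x \<in> carrier G \<Longrightarrow> y \<in> carrier G \<Longrightarrow> x \<otimes> (inv x \<otimes> y) = y"
  by (simp_all flip: m_assoc)

text \<open>With these as rewrite rules \<open>simp\<close> brings words into right-nested, freely
  reduced form, which settles identities valid in every group.\<close>

lemmas free_reduce = m_assoc inv_mult_group inv_cancel_left

lemma comtr_closed [simp, intro]:
  "x \<in> carrier G \<Longrightarrow> y \<in> carrier G \<Longrightarrow> comtr x y \<in> carrier G"
  by (simp add: comtr_def)

lemma comtr_mult: "x \<in> carrier G \<Longrightarrow> y \<in> carrier G \<Longrightarrow> comtr x y \<otimes> (y \<otimes> x) = x \<otimes> y"
  by (simp add: comtr_def free_reduce)

lemma comtr_eq_one_iff:
  assumes "x \<in> carrier G" "y \<in> carrier G"
  shows "comtr x y = \<one> \<longleftrightarrow> x \<otimes> y = y \<otimes> x"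
  using assms comtr_mult[of x y] by (metis comtr_closed l_cancel_one' m_closed r_cancel_one)

lemma comtr_mult_right:
  assumes "x \<in> carrier G" "y \<in> carrier G" "z \<in> carrier G"
  shows "comtr x (y \<otimes> z) = comtr x y \<otimes> (y \<otimes> comtr x z \<otimes> inv y)"
  using assms by (simp add: comtr_def free_reduce)

lemma comtr_mult_left:
  assumes "x \<in> carrier G" "y \<in> carrier G" "z \<in> carrier G"
  shows "comtr (x \<otimes> y) z = (x \<otimes> comtr y z \<otimes> inv x) \<otimes> comtr x z"
  using assms by (simp add: comtr_def free_reduce)

lemma comtr_inv_right:
  assumes "x \<in> carrier G" "y \<in> carrier G"
  shows "comtr x (inv y) = inv y \<otimes> inv (comtr x y) \<otimes> inv (inv y)"
  using assms by (simp add: comtr_def free_reduce)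

lemma comtr_inv_left:
  assumes "x \<in> carrier G" "y \<in> carrier G"
  shows "comtr (inv x) y = inv x \<otimes> inv (comtr x y) \<otimes> inv (inv x)"
  using assms by (simp add: comtr_def free_reduce)

text \<open>Commutators are bilinear where they are central. Claim \<open>1\<close> moves one
  \<open>a\<close> past a power of \<open>b\<close>, picking up one commutator for each
  \<open>b\<close>; claim \<open>2\<close> repeats this for each \<open>a\<close>.\<close>

lemma comtr_pow:
  assumes [simp]: "a \<in> carrier G" "b \<in> carrier G"
    and ca: "comtr a b \<otimes> a = a \<otimes> comtr a b" and cb: "comtr a b \<otimes> b = b \<otimes> comtr a b"
  shows "comtr (a [^] (m::nat)) (b [^] (l::nat)) = comtr a b [^] (m * l)"
proof -
  let ?c = "comtr a b"
  have 1: "a \<otimes> b [^] l = ?c [^] l \<otimes> (b [^] l \<otimes> a)" for l :: nat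
  proof (induction l)
    case (Suc l)
    have "a \<otimes> b [^] Suc l = (a \<otimes> b [^] l) \<otimes> b" by (simp add: m_assoc)
    also have "\<dots> = ?c [^] l \<otimes> b [^] l \<otimes> (a \<otimes> b)" by (simp add: Suc m_assoc)
    also have "\<dots> = ?c [^] l \<otimes> (b [^] l \<otimes> ?c) \<otimes> (b \<otimes> a)"
      using comtr_mult[of a b] by (simp add: m_assoc)
    also have "b [^] l \<otimes> ?c = ?c \<otimes> b [^] l"
      using group_commutes_pow[of b ?c l] cb by simp
    finally show ?case by (simp add: m_assoc)
  qed simp
  have 2: "a [^] m \<otimes> b [^] l = ?c [^] (m * l) \<otimes> (b [^] l \<otimes> a [^] m)" for m :: nat
  proof (induction m)
    case (Suc m)
    have cm: "a [^] m \<otimes> ?c [^] l = ?c [^] l \<otimes> a [^] m"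
    proof -
      have "a [^] m \<otimes> ?c = ?c \<otimes> a [^] m" using group_commutes_pow[of a ?c m] ca by simp
      then show ?thesis using group_commutes_pow[of ?c "a [^] m" l] by simp
    qed
    have "a [^] Suc m \<otimes> b [^] l = a [^] m \<otimes> (a \<otimes> b [^] l)" by (simp add: m_assoc)
    also have "\<dots> = (a [^] m \<otimes> ?c [^] l) \<otimes> (b [^] l \<otimes> a)" by (simp only: 1) (simp add: m_assoc)
    also have "\<dots> = ?c [^] l \<otimes> (a [^] m \<otimes> b [^] l) \<otimes> a" by (simp add: m_assoc cm)
    also have "\<dots> = (?c [^] l \<otimes> ?c [^] (m * l)) \<otimes> (b [^] l \<otimes> a [^] Suc m)" by (simp add: m_assoc Suc)
    finally show ?case by (simp add: nat_pow_mult)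
  qed simp
  have "comtr (a [^] m) (b [^] l) = (a [^] m \<otimes> b [^] l) \<otimes> inv (b [^] l \<otimes> a [^] m)"
    by (simp add: comtr_def[of "a [^] m"] free_reduce)
  also have "\<dots> = ?c [^] (m * l)" unfolding 2 by (simp add: m_assoc)
  finally show ?thesis .
qed

section \<open>Terms of the lower central series\<close>

lemma lower_central_Suc_comtr:
  "lower_central G (Suc n) = generate G {comtr x y | x y. x \<in> lower_central G n \<and> y \<in> carrier G}"
  by (simp add: comtr_def lower_central.simps)

text \<open>Conjugating a commutator conjugates both of its entries, so by induction the generating
  set of the next term is closed under conjugation.\<close>

lemma lower_central_normal: "lower_central G n \<lhd> G"
proof (induction n)
  case 0 then show ?case by (simp add: normal_self)
next
  case (Suc n)
  interpret L: normal "lower_central G n" G by fact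
  show ?case unfolding lower_central_Suc_comtr
  proof (rule normal_generateI)
    fix h g assume "h \<in> {comtr x y | x y. x \<in> lower_central G n \<and> y \<in> carrier G}" and g: "g \<in> carrier G"
    then obtain x y where xy: "h = comtr x y" "x \<in> lower_central G n" "y \<in> carrier G" by blast
    have "g \<otimes> h \<otimes> inv g = comtr (g \<otimes> x \<otimes> inv g) (g \<otimes> y \<otimes> inv g)"
      using xy g by (simp add: comtr_def free_reduce)
    moreover have "g \<otimes> x \<otimes> inv g \<in> lower_central G n" using xy g L.inv_op_closed2 by blast
    ultimately show "g \<otimes> h \<otimes> inv g \<in> {comtr x y | x y. x \<in> lower_central G n \<and> y \<in> carrier G}"
      using xy g by blast
  qed auto
qed

lemma lower_central_subset: "lower_central G n \<subseteq> carrier G"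
  using lower_central_normal normal_imp_subgroup subgroup.subset by blast

lemma comtr_lower_central:
  "x \<in> lower_central G n \<Longrightarrow> y \<in> carrier G \<Longrightarrow> comtr x y \<in> lower_central G (Suc n)"
  unfolding lower_central_Suc_comtr by (rule generate.incl) blast

lemma lower_central_Suc_subset: "lower_central G (Suc n) \<subseteq> lower_central G n"
proof -
  interpret L: normal "lower_central G n" G by (rule lower_central_normal)
  show ?thesis unfolding lower_central_Suc_comtr
  proof (rule generate_subgroup_incl)
    show "{comtr x y | x y. x \<in> lower_central G n \<and> y \<in> carrier G} \<subseteq> lower_central G n"
    proof clarify
      fix x y assume "x \<in> lower_central G n" "y \<in> carrier G"
      moreover from this have "comtr x y = x \<otimes> (y \<otimes> inv x \<otimes> inv y)" by (simp add: comtr_def free_reduce)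
      ultimately show "comtr x y \<in> lower_central G n" by (simp add: L.inv_op_closed2)
    qed
  qed (rule L.is_subgroup)
qed

lemma lower_central_antimono: "m \<le> n \<Longrightarrow> lower_central G n \<subseteq> lower_central G m"
  by (rule lift_Suc_antimono_le[of "lower_central G"]) (rule lower_central_Suc_subset)

end

text \<open>Serves to bound nilpotency classes: applied to an inclusion it handles subgroups,
  applied to projections it handles products.\<close>

lemma (in group_hom) lower_central_hom:
  "x \<in> lower_central G n \<Longrightarrow> h x \<in> lower_central H n"
proof (induction n arbitrary: x)
  case (Suc n)
  let ?A = "{G.comtr x y | x y. x \<in> lower_central G n \<and> y \<in> carrier G}"
  note Lc = G.lower_central_subset[THEN subsetD]
  have A: "?A \<subseteq> carrier G" using Lc by auto
  have "h ` ?A \<subseteq> {H.comtr x y | x y. x \<in> lower_central H n \<and> y \<in> carrier H}"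
  proof clarify
    fix x y assume xy: "x \<in> lower_central G n" "y \<in> carrier G"
    then have "h (G.comtr x y) = H.comtr (h x) (h y)"
      using Lc[OF xy(1)] by (simp add: G.comtr_def H.comtr_def)
    then show "\<exists>x' y'. h (G.comtr x y) = H.comtr x' y' \<and> x' \<in> lower_central H n \<and> y' \<in> carrier H"
      using Suc.IH[OF xy(1)] hom_closed[OF xy(2)] by blast
  qed
  then have "generate H (h ` ?A) \<subseteq> lower_central H (Suc n)"
    unfolding H.lower_central_Suc_comtr by (rule H.mono_generate)
  moreover have "h x \<in> generate H (h ` ?A)"
    using Suc.prems unfolding G.lower_central_Suc_comtr generate_img[OF A] by simp
  ultimately show ?case by blast
qed simp

context group
begin

lemma nilpotent_subgroup:
  assumes "nilpotent_group G" "subgroup J G"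
  shows "nilpotent_group (G\<lparr>carrier := J\<rparr>)"
proof -
  interpret J: group "G\<lparr>carrier := J\<rparr>" using assms(2) by (rule subgroup_imp_group)
  obtain c where "lower_central G c = {\<one>}" using assms by (auto simp: nilpotent_group_def)
  then have "lower_central (G\<lparr>carrier := J\<rparr>) c \<subseteq> {\<one>}"
    using group_hom.lower_central_hom[OF canonical_inj_is_hom[OF assms(2)], of _ c] by auto
  moreover have "\<one> \<in> lower_central (G\<lparr>carrier := J\<rparr>) c"
    using subgroup.one_closed[OF normal_imp_subgroup[OF J.lower_central_normal]] by simp
  ultimately show ?thesis using J.group_axioms by (auto simp: nilpotent_group_def)
qed

text \<open>Modulo \<open>\<gamma>\<^sub>n\<^sub>+\<^sub>2\<close> commutators with an entry in \<open>\<gamma>\<^sub>n\<close> are bilinear, so \<open>\<gamma>\<^sub>n\<^sub>+\<^sub>1\<close> is spanned by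
  commutators of generators.\<close>

lemma lower_central_Suc_generated:
  assumes P: "subgroup P G" and LP: "lower_central G (Suc (Suc n)) \<subseteq> P"
    and B: "B \<subseteq> carrier G" "generate G B = carrier G"
    and A: "A \<subseteq> lower_central G n" "lower_central G n \<subseteq> generate G (A \<union> lower_central G (Suc n))"
    and AB: "\<And>a b. a \<in> A \<Longrightarrow> b \<in> B \<Longrightarrow> comtr a b \<in> P"
  shows "lower_central G (Suc n) \<subseteq> P"
proof -
  interpret P: subgroup P G by fact
  interpret L: normal "lower_central G n" G by (rule lower_central_normal)
  note Lc = lower_central_subset[THEN subsetD]
  \<comment> \<open>\<open>P\<close> need not be normal. Conjugation changes an element of term
    \<open>Suc n\<close> only by an element of the term after it, and that term lies in
    \<open>P\<close>.\<close>
  have conj: "g \<otimes> u \<otimes> inv g \<in> P" if "g \<in> carrier G" "u \<in> P" "u \<in> lower_central G (Suc n)" for g u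
  proof -
    have "comtr u g \<in> P" using comtr_lower_central[OF that(3,1)] LP by blast
    then have "inv (comtr u g) \<otimes> u \<in> P" using that(2) by simp
    moreover have "u \<in> carrier G" using that P.mem_carrier by blast
    ultimately show ?thesis using that(1) by (simp add: comtr_def free_reduce)
  qed
  note L1 = normal_imp_subgroup[OF lower_central_normal[of "Suc n"]]
  have AL: "h \<in> lower_central G n" if "h \<in> A \<union> lower_central G (Suc n)" for h
    using that A lower_central_Suc_subset[of n] by blast
  have conj_inv: "inv g \<otimes> inv u \<otimes> inv (inv g) \<in> P"
    if "g \<in> carrier G" "u \<in> P" "u \<in> lower_central G (Suc n)" for g u
    by (rule conj) (use that in \<open>simp_all add: subgroup.m_inv_closed[OF L1]\<close>)
  \<comment> \<open>With \<open>a\<close> fixed, the second entry is extended from the generators to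
    the whole group; the claim \<open>G\<close> below does the same for the first entry.\<close>
  have R: "comtr a b \<in> P" if a: "a \<in> lower_central G n" and aB: "\<And>b. b \<in> B \<Longrightarrow> comtr a b \<in> P"
    and b: "b \<in> carrier G" for a b
  proof -
    note ac = Lc[OF a]
    have "b \<in> generate G B" using B b by simp
    then show ?thesis
    proof induction
      case one
      then show ?case using ac by (simp add: comtr_def)
    next
      case (incl h) then show ?case by (rule aB)
    next
      case (inv h)
      then have h: "h \<in> carrier G" using B by blast
      show ?case unfolding comtr_inv_right[OF ac h]
        by (rule conj_inv)
          (rule h aB inv comtr_lower_central a)+
    next
      case (eng x y)
      have xy: "x \<in> carrier G" "y \<in> carrier G"
        using eng(1,2) generate_in_carrier[OF B(1)] by blast+
      show ?case unfolding comtr_mult_right[OF ac xy]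
        using eng(3) conj[OF xy(1) eng(4) comtr_lower_central[OF a xy(2)]] by (rule P.m_closed)
    qed
  qed
  have G: "comtr a b \<in> P" if a: "a \<in> lower_central G n" and b: "b \<in> carrier G" for a b
  proof -
    have AP: "comtr h b \<in> P" if "h \<in> A \<union> lower_central G (Suc n)" for h
    proof (cases "h \<in> A")
      case True
      then show ?thesis using R[OF AL[OF that] AB b] by blast
    next
      case False
      then have "h \<in> lower_central G (Suc n)" using that by blast
      from comtr_lower_central[OF this b] show ?thesis using LP by blast
    qed
    have "a \<in> generate G (A \<union> lower_central G (Suc n))" using a A by blast
    \<comment> \<open>Membership of \<open>a\<close> in the term is carried through the induction
      because \<open>conj\<close> applies only to commutators that lie in term
      \<open>Suc n\<close>.\<close>
    then have "a \<in> lower_central G n \<and> comtr a b \<in> P"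
    proof induction
      case one
      then show ?case using b by (simp add: comtr_def)
    next
      case (incl h)
      then show ?case using AL AP by blast
    next
      case (inv h)
      note hL = AL[OF inv]
      have "comtr (inv h) b \<in> P" unfolding comtr_inv_left[OF Lc[OF hL] b]
        by (rule conj_inv)
          (rule Lc hL AP inv comtr_lower_central b)+
      then show ?case using hL by simp
    next
      case (eng x y)
      then have xy: "x \<in> lower_central G n" "y \<in> lower_central G n" "comtr x b \<in> P" "comtr y b \<in> P" by auto
      have "x \<otimes> comtr y b \<otimes> inv x \<in> P"
        by (rule conj[OF Lc[OF xy(1)] xy(4) comtr_lower_central[OF xy(2) b]])
      then show ?case using comtr_mult_left[OF Lc[OF xy(1)] Lc[OF xy(2)] b] xy by simp
    qed
    then show ?thesis by blast
  qed
  show ?thesis unfolding lower_central_Suc_comtr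
    by (rule generate_subgroup_incl[OF _ P]) (use G in blast)
qed

section \<open>Computing modulo a normal subgroup\<close>

lemma rcoset_eq_iff:
  assumes "K \<lhd> G" "x \<in> carrier G" "y \<in> carrier G"
  shows "K #> x = K #> y \<longleftrightarrow> x \<otimes> inv y \<in> K"
proof -
  interpret K: normal K G by fact
  show ?thesis using assms(2,3) K.rcos_module[OF group_axioms assms(3,2)]
    by (metis K.subgroup_axioms rcos_self repr_independence)
qed

lemma commutes_mod:
  assumes K: "K \<lhd> G" and xy: "x \<in> carrier G" "y \<in> carrier G" and c: "comtr x y \<in> K"
  shows "(K #> x) \<otimes>\<^bsub>G Mod K\<^esub> (K #> y) = (K #> y) \<otimes>\<^bsub>G Mod K\<^esub> (K #> x)"
proof -
  interpret K: normal K G by fact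
  have "x \<otimes> y \<otimes> inv (y \<otimes> x) = comtr x y" using xy by (simp add: comtr_def free_reduce)
  then have "K #> (x \<otimes> y) = K #> (y \<otimes> x)" using xy c by (simp add: rcoset_eq_iff[OF K])
  then show ?thesis using xy by (simp add: K.rcos_sum)
qed

text \<open>In \<open>G Mod K\<close> the two cosets commute, so powers distribute there. Phrased as
  a quotient lying in \<open>K\<close>, the result can be multiplied into any subgroup of
  \<open>G\<close> that contains \<open>K\<close>.\<close>

lemma pow_mult_mod:
  assumes K: "K \<lhd> G" and xy: "x \<in> carrier G" "y \<in> carrier G" and c: "comtr x y \<in> K"
  shows "(x \<otimes> y) [^] (m::nat) \<otimes> inv (x [^] m \<otimes> y [^] m) \<in> K"
proof -
  interpret K: normal K G by fact
  interpret Q: group "G Mod K" by (rule K.factorgroup_is_group)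
  interpret p: group_hom G "G Mod K" "\<lambda>a. K #> a"
    using K.r_coset_hom_Mod by unfold_locales
  have "((K #> x) \<otimes>\<^bsub>G Mod K\<^esub> (K #> y)) [^]\<^bsub>G Mod K\<^esub> m = (K #> x) [^]\<^bsub>G Mod K\<^esub> m \<otimes>\<^bsub>G Mod K\<^esub> (K #> y) [^]\<^bsub>G Mod K\<^esub> m"
    by (rule Q.pow_mult_distrib[OF commutes_mod[OF K xy c]]) (use xy p.hom_closed in auto)
  then have *: "K #> ((x \<otimes> y) [^] m) = K #> (x [^] m \<otimes> y [^] m)"
    using xy by (simp only: p.hom_mult[symmetric] p.hom_nat_pow[symmetric] nat_pow_closed m_closed)
  show ?thesis by (rule iffD1[OF rcoset_eq_iff[OF K] *]) (use xy in auto)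
qed

text \<open>Modulo \<open>K\<close> the commutator of \<open>a\<close> and \<open>b\<close> is
  central, which is the situation of \<open>comtr_pow\<close>.\<close>

lemma comtr_pow_mod:
  assumes K: "K \<lhd> G" and ab: "a \<in> carrier G" "b \<in> carrier G" 
    and c: "\<And>g. g \<in> carrier G \<Longrightarrow> comtr (comtr a b) g \<in> K"
  shows "comtr (a [^] (m::nat)) (b [^] (l::nat)) \<otimes> inv (comtr a b [^] (m * l)) \<in> K"
proof -
  interpret K: normal K G by fact
  interpret Q: group "G Mod K" by (rule K.factorgroup_is_group)
  interpret p: group_hom G "G Mod K" "\<lambda>a. K #> a"
    using K.r_coset_hom_Mod by unfold_locales
  have h: "Q.comtr (K #> x) (K #> y) = K #> comtr x y" if "x \<in> carrier G" "y \<in> carrier G" for x y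
    unfolding Q.comtr_def comtr_def using that
    by (simp only: p.hom_mult[symmetric] p.hom_inv[symmetric] inv_closed m_closed)
  have "Q.comtr ((K #> a) [^]\<^bsub>G Mod K\<^esub> m) ((K #> b) [^]\<^bsub>G Mod K\<^esub> l) = Q.comtr (K #> a) (K #> b) [^]\<^bsub>G Mod K\<^esub> (m * l)"
  proof (rule Q.comtr_pow)
    show "K #> a \<in> carrier (G Mod K)" "K #> b \<in> carrier (G Mod K)" using ab p.hom_closed by blast+
    show "Q.comtr (K #> a) (K #> b) \<otimes>\<^bsub>G Mod K\<^esub> (K #> a) = (K #> a) \<otimes>\<^bsub>G Mod K\<^esub> Q.comtr (K #> a) (K #> b)"
      unfolding h[OF ab] by (rule commutes_mod[OF K _ ab(1) c]) (use ab in auto)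
    show "Q.comtr (K #> a) (K #> b) \<otimes>\<^bsub>G Mod K\<^esub> (K #> b) = (K #> b) \<otimes>\<^bsub>G Mod K\<^esub> Q.comtr (K #> a) (K #> b)"
      unfolding h[OF ab] by (rule commutes_mod[OF K _ ab(2) c]) (use ab in auto)
  qed
  then have *: "K #> comtr (a [^] m) (b [^] l) = K #> (comtr a b [^] (m * l))"
    using ab by (simp only: p.hom_nat_pow[symmetric] h nat_pow_closed comtr_closed)
  show ?thesis by (rule iffD1[OF rcoset_eq_iff[OF K] *]) (use ab in auto)
qed

end

section \<open>Isolated subgroups and finite rank\<close>

text \<open>In a general group the roots of a subgroup need not form a subgroup; in a nilpotent one
  they do, by \<open>isolator_isolated\<close>.\<close>

definition (in group) isolator :: "'a set \<Rightarrow> 'a set" where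
  "isolator H = {x \<in> carrier G. \<exists>m::nat. m \<ge> 1 \<and> x [^] m \<in> H}"

definition isolated :: "('a, 'm) monoid_scheme \<Rightarrow> 'a set \<Rightarrow> bool" where
  "isolated G H \<longleftrightarrow> subgroup H G \<and> (\<forall>x \<in> carrier G. \<forall>m::nat. m \<ge> 1 \<and> x [^]\<^bsub>G\<^esub> m \<in> H \<longrightarrow> x \<in> H)"

lemma isolated_imp_subgroup: "isolated G H \<Longrightarrow> subgroup H G"
  unfolding isolated_def by (rule conjunct1)

lemma isolatedD:
  "isolated G H \<Longrightarrow> x [^]\<^bsub>G\<^esub> (m::nat) \<in> H \<Longrightarrow> x \<in> carrier G \<Longrightarrow> m \<ge> 1 \<Longrightarrow> x \<in> H"
  unfolding isolated_def by blast

lemma isolatedI: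
  "subgroup H G \<Longrightarrow> (\<And>x m. x \<in> carrier G \<Longrightarrow> (m::nat) \<ge> 1 \<Longrightarrow> x [^]\<^bsub>G\<^esub> m \<in> H \<Longrightarrow> x \<in> H) \<Longrightarrow> isolated G H"
  unfolding isolated_def by blast

text \<open>A substitute for finite Hirsch length that records only what is used: a bounded,
  strictly monotone measure, hence a bound on the length of chains of isolated subgroups.\<close>

definition finite_rank :: "('a, 'm) monoid_scheme \<Rightarrow> bool" where
  "finite_rank G \<longleftrightarrow> (\<exists>(\<rho> :: 'a set \<Rightarrow> nat) B. \<forall>H. isolated G H \<longrightarrow> \<rho> H \<le> B \<and>
     (\<forall>H'. isolated G H' \<and> H \<subset> H' \<longrightarrow> \<rho> H < \<rho> H'))"

context group
begin

lemma isolatorI: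
  "x [^] (m::nat) \<in> H \<Longrightarrow> x \<in> carrier G \<Longrightarrow> m \<ge> 1 \<Longrightarrow> x \<in> isolator H"
  by (auto simp: isolator_def)

lemma subset_isolator: "H \<subseteq> carrier G \<Longrightarrow> H \<subseteq> isolator H"
  by (auto intro!: isolatorI[where m = 1])

section \<open>Isolators in nilpotent groups\<close>

text \<open>Modulo \<open>K\<close> the group \<open>U\<close> is abelian, and in an abelian group
  roots of a subgroup form a subgroup: the product of two exponents serves for the product of two
  elements.\<close>

lemma subgroup_isolator_mod:
  assumes K: "K \<lhd> G" and Q: "subgroup Q G" "K \<subseteq> Q" and U: "subgroup U G"
    and UK: "\<And>x y. x \<in> U \<Longrightarrow> y \<in> U \<Longrightarrow> comtr x y \<in> K"
  shows "subgroup (U \<inter> isolator Q) G"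
proof -
  interpret Q: subgroup Q G by fact
  interpret U: subgroup U G by fact
  show ?thesis
  proof (rule subgroupI)
    show "U \<inter> isolator Q \<subseteq> carrier G" using U.subset by blast
    have "\<one> \<in> U \<inter> isolator Q" by (auto simp: isolator_def intro!: exI[of _ 1])
    then show "U \<inter> isolator Q \<noteq> {}" by blast
  next
    fix a assume "a \<in> U \<inter> isolator Q"
    then obtain m :: nat where a: "a \<in> U" "m \<ge> 1" "a [^] m \<in> Q" by (auto simp: isolator_def)
    then have "inv a [^] m \<in> Q" using nat_pow_inv[of a m] by simp
    then have "inv a \<in> isolator Q" by (rule isolatorI) (use a in auto)
    then show "inv a \<in> U \<inter> isolator Q" using a by blast
  next
    fix a b assume "a \<in> U \<inter> isolator Q" "b \<in> U \<inter> isolator Q"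
    then obtain m l :: nat where a: "a \<in> U" "m \<ge> 1" "a [^] m \<in> Q"
      and b: "b \<in> U" "l \<ge> 1" "b [^] l \<in> Q" by (auto simp: isolator_def)
    have ab[simp]: "a \<in> carrier G" "b \<in> carrier G" using a b by simp_all
    have pow: "x [^] (n::nat) \<in> Q" if "x \<in> Q" for x n by (induction n) (use that in auto)
    have "a [^] (m * l) \<in> Q" using pow[OF a(3), of l] by (simp add: nat_pow_pow)
    moreover have "b [^] (m * l) \<in> Q" using pow[OF b(3), of m] by (simp add: nat_pow_pow mult.commute)
    ultimately have 1: "a [^] (m * l) \<otimes> b [^] (m * l) \<in> Q" by blast
    have "(a \<otimes> b) [^] (m * l) \<otimes> inv (a [^] (m * l) \<otimes> b [^] (m * l)) \<in> Q"
      using pow_mult_mod[OF K ab UK[OF a(1) b(1)]] Q(2) by blast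
    from Q.m_closed[OF this 1] have "(a \<otimes> b) [^] (m * l) \<in> Q"
      by (simp add: m_assoc)
    then have "a \<otimes> b \<in> isolator Q" by (rule isolatorI) (use a b in auto)
    then show "a \<otimes> b \<in> U \<inter> isolator Q" using a b by blast
  qed
qed

text \<open>The correction goes one layer of the lower central series at a time. Let
  \<open>Q n\<close> be the product of term \<open>n\<close> with \<open>H\<close>. By
  \<open>main\<close>, each element of term \<open>n\<close> has a power in
  \<open>Q (Suc n)\<close>. Starting from \<open>Q 0\<close>, the whole group, one then finds for
  every element a power in \<open>Q c\<close>, which is \<open>H\<close>.\<close>

lemma isolator_generate:
  assumes c: "lower_central G c = {\<one>}" and H: "subgroup H G"
    and S: "S \<subseteq> carrier G" "generate G S = carrier G" "S \<subseteq> isolator H"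
  shows "carrier G = isolator H"
proof -
  interpret H: subgroup H G by fact
  define Q where "Q = (\<lambda>n. lower_central G n <#> H)"
  have Q: "subgroup (Q n) G" for n unfolding Q_def
    by (rule mult_norm_subgroup[OF lower_central_normal H])
  have LQ: "lower_central G n \<subseteq> Q n" for n
  proof
    fix x assume x: "x \<in> lower_central G n"
    then have "x \<in> carrier G" using lower_central_subset by blast
    then have "x = x \<otimes> \<one>" by simp
    then show "x \<in> Q n" unfolding Q_def set_mult_def using x H.one_closed by blast
  qed
  have HQ: "H \<subseteq> Q n" for n
  proof
    fix x assume x: "x \<in> H"
    have "\<one> \<in> lower_central G n"
      using subgroup.one_closed[OF normal_imp_subgroup[OF lower_central_normal]] .
    moreover have "x = \<one> \<otimes> x" using x by simp
    ultimately show "x \<in> Q n" unfolding Q_def set_mult_def using x by blast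
  qed
  have QE: "\<exists>u h. u \<in> lower_central G n \<and> h \<in> H \<and> x = u \<otimes> h" if "x \<in> Q n" for x n
    using that unfolding Q_def set_mult_def by blast
  note Lc = lower_central_subset[THEN subsetD]
  \<comment> \<open>Term \<open>n\<close> is abelian modulo term \<open>Suc n\<close>, so its roots
    of \<open>Q (Suc n)\<close> form a subgroup and it suffices to treat generators of the
    layer.\<close>
  have sub: "subgroup (lower_central G n \<inter> isolator (Q (Suc n))) G" for n
    by (rule subgroup_isolator_mod[OF lower_central_normal Q LQ normal_imp_subgroup[OF lower_central_normal]])
      (simp add: comtr_lower_central Lc)
  have main: "lower_central G n \<subseteq> isolator (Q (Suc n))" for n
  proof (induction n)
    case 0
    have "S \<subseteq> isolator (Q (Suc 0))" using S(3) HQ[of "Suc 0"] unfolding isolator_def by blast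
    then have "generate G S \<subseteq> lower_central G 0 \<inter> isolator (Q (Suc 0))"
      by (intro generate_subgroup_incl sub) (use S(1) in auto)
    then show ?case using S by auto
  next
    case (Suc n)
    have "lower_central G (Suc n) \<subseteq> lower_central G (Suc n) \<inter> isolator (Q (Suc (Suc n)))"
    proof (rule lower_central_Suc_generated[OF sub _ S(1,2) order_refl])
      show "lower_central G (Suc (Suc n)) \<subseteq> lower_central G (Suc n) \<inter> isolator (Q (Suc (Suc n)))"
        using lower_central_Suc_subset subset_isolator[OF subgroup.subset[OF Q]] LQ by blast
      show "lower_central G n \<subseteq> generate G (lower_central G n \<union> lower_central G (Suc n))"
        by (auto intro: generate.incl)
      fix a b assume a: "a \<in> lower_central G n" and b: "b \<in> S"
      let ?Q = "Q (Suc (Suc n))"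
      interpret Q: subgroup ?Q G by (rule Q)
      obtain m :: nat where m: "m \<ge> 1" "a [^] m \<in> Q (Suc n)" using Suc a by (auto simp: isolator_def)
      obtain l :: nat where l: "l \<ge> 1" "b [^] l \<in> H" using S b by (auto simp: isolator_def)
      obtain u h where uh: "u \<in> lower_central G (Suc n)" "h \<in> H" "a [^] m = u \<otimes> h" using QE[OF m(2)] by blast
      have [simp]: "a \<in> carrier G" "b \<in> carrier G" "u \<in> carrier G" "h \<in> carrier G"
        using a b S uh Lc by auto
      define h' where "h' = b [^] l"
      have [simp]: "h' \<in> carrier G" "h' \<in> H" using l by (auto simp: h'_def)
      have w: "comtr h h' \<in> H" using uh by (simp add: comtr_def)
      \<comment> \<open>Since \<open>u\<close> lies in term \<open>Suc n\<close>, the outer two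
        factors lie in the next term; the middle one lies in \<open>H\<close>.\<close>
      have "comtr (u \<otimes> h) h' = comtr u (comtr h h') \<otimes> comtr h h' \<otimes> comtr u h'"
        by (simp add: comtr_def free_reduce)
      moreover have "comtr u (comtr h h') \<in> ?Q" "comtr u h' \<in> ?Q"
        by (auto intro!: LQ[THEN subsetD] comtr_lower_central[OF uh(1)])
      ultimately have 1: "comtr (a [^] m) (b [^] l) \<in> ?Q"
        using w HQ uh(3) by (auto simp: h'_def[symmetric])
      \<comment> \<open>Modulo the next term, the commutator of the powers is a power of the
        commutator. Hence a power of \<open>comtr a b\<close> falls into \<open>?Q\<close>.\<close>
      have "comtr (a [^] m) (b [^] l) \<otimes> inv (comtr a b [^] (m * l)) \<in> lower_central G (Suc (Suc n))"
        by (rule comtr_pow_mod[OF lower_central_normal]) (use comtr_lower_central[OF comtr_lower_central] a in auto)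
      then have 2: "comtr (a [^] m) (b [^] l) \<otimes> inv (comtr a b [^] (m * l)) \<in> ?Q" using LQ by blast
      have "inv (comtr (a [^] m) (b [^] l) \<otimes> inv (comtr a b [^] (m * l))) \<otimes> comtr (a [^] m) (b [^] l) \<in> ?Q"
        using 1 2 by blast
      then have "comtr a b [^] (m * l) \<in> ?Q" by (simp add: free_reduce)
      then have "comtr a b \<in> isolator ?Q" by (rule isolatorI) (use m l in auto)
      then show "comtr a b \<in> lower_central G (Suc n) \<inter> isolator ?Q"
        using comtr_lower_central[OF a] by simp
    qed
    then show ?case by blast
  qed
  have *: "carrier G \<subseteq> isolator (Q n)" for n
  proof (induction n)
    case 0
    then show ?case using LQ[of 0] subset_isolator[OF subgroup.subset[OF Q]] by auto
  next
    case (Suc n)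
    show ?case
    proof
      fix x assume x: "x \<in> carrier G"
      then obtain m :: nat where m: "m \<ge> 1" "x [^] m \<in> Q n" using Suc by (auto simp: isolator_def)
      obtain u h where uh: "u \<in> lower_central G n" "h \<in> H" "x [^] m = u \<otimes> h" using QE[OF m(2)] by blast
      obtain k :: nat where k: "k \<ge> 1" "u [^] k \<in> Q (Suc n)" using main uh by (auto simp: isolator_def)
      interpret Q: subgroup "Q (Suc n)" G by (rule Q)
      have [simp]: "u \<in> carrier G" "h \<in> carrier G" using uh Lc by auto
      have "h [^] k \<in> Q (Suc n)" by (induction k) (use uh HQ in auto)
      then have 1: "u [^] k \<otimes> h [^] k \<in> Q (Suc n)" using k by blast
      \<comment> \<open>The commutator of \<open>u\<close> and \<open>h\<close> lies in term
        \<open>Suc n\<close>, so powers distribute modulo that term.\<close>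
      have "(u \<otimes> h) [^] k \<otimes> inv (u [^] k \<otimes> h [^] k) \<in> Q (Suc n)"
        by (rule LQ[THEN subsetD], rule pow_mult_mod[OF lower_central_normal _ _ comtr_lower_central[OF uh(1)]])
          simp_all
      from Q.m_closed[OF this 1] have "(u \<otimes> h) [^] k \<in> Q (Suc n)" by (simp add: m_assoc)
      then have "x [^] (m * k) \<in> Q (Suc n)" using x uh(3) by (simp flip: nat_pow_pow)
      then show "x \<in> isolator (Q (Suc n))" by (rule isolatorI) (use x m k in auto)
    qed
  qed
  have QH: "Q c \<subseteq> H"
  proof
    fix x assume "x \<in> Q c"
    then obtain h where "h \<in> H" "x = \<one> \<otimes> h" using QE[of x c] unfolding c by blast
    then show "x \<in> H" by simp
  qed
  show ?thesis
  proof
    show "carrier G \<subseteq> isolator H"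
    proof
      fix x assume "x \<in> carrier G"
      then obtain m :: nat where "m \<ge> 1" "x [^] m \<in> Q c" using *[of c] by (auto simp: isolator_def)
      then show "x \<in> isolator H" using QH \<open>x \<in> carrier G\<close> by (intro isolatorI) auto
    qed
  qed (simp add: isolator_def subset_iff)
qed

text \<open>The subgroup \<open>J\<close> generated by the roots of \<open>H\<close> is nilpotent
  and generated by elements with a power in \<open>H\<close>. By \<open>isolator_generate\<close>,
  applied inside \<open>J\<close>, it consists of such elements, so nothing new was
  generated.\<close>

lemma isolator_isolated:
  assumes nil: "nilpotent_group G" and H: "subgroup H G"
  shows "isolated G (isolator H)"
proof -
  define J where "J = generate G (isolator H)"
  have iso_sub: "isolator H \<subseteq> carrier G" by (auto simp: isolator_def)
  have J: "subgroup J G" unfolding J_def using generate_is_subgroup[OF iso_sub] .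
  have IJ: "isolator H \<subseteq> J" unfolding J_def by (auto intro: generate.incl)
  interpret J: group "G\<lparr>carrier := J\<rparr>" using J by (rule subgroup_imp_group)
  obtain c where c: "lower_central (G\<lparr>carrier := J\<rparr>) c = {\<one>}"
    using nilpotent_subgroup[OF nil J] by (auto simp: nilpotent_group_def)
  have HJ: "subgroup H (G\<lparr>carrier := J\<rparr>)"
    using subgroup_incl[OF H J] subset_isolator[OF subgroup.subset[OF H]] IJ by blast
  have eq: "J.isolator H = J \<inter> isolator H"
    using subgroup.subset[OF J] by (auto simp: J.isolator_def isolator_def nat_pow_consistent[symmetric])
  have "carrier (G\<lparr>carrier := J\<rparr>) = J.isolator H"
  proof (rule J.isolator_generate[OF _ HJ])
    show "lower_central (G\<lparr>carrier := J\<rparr>) c = {\<one>\<^bsub>G\<lparr>carrier := J\<rparr>\<^esub>}" using c by simp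
    show "isolator H \<subseteq> carrier (G\<lparr>carrier := J\<rparr>)" using IJ by simp
    show "generate (G\<lparr>carrier := J\<rparr>) (isolator H) = carrier (G\<lparr>carrier := J\<rparr>)"
      using generate_consistent[OF IJ J] by (simp add: J_def)
    show "isolator H \<subseteq> J.isolator H" using eq IJ by blast
  qed
  then have "J = isolator H" using eq IJ by auto
  then have sub: "subgroup (isolator H) G" using J by simp
  moreover have "x \<in> isolator H" if "x \<in> carrier G" "(m::nat) \<ge> 1" "x [^] m \<in> isolator H" for x m
  proof -
    note pow = that(3)
    obtain l :: nat where "l \<ge> 1" "(x [^] m) [^] l \<in> H" using pow by (auto simp: isolator_def)
    then have "x [^] (m * l) \<in> H" "m * l \<ge> 1" using that by (auto simp: nat_pow_pow)
    then show ?thesis using that(1) by (intro isolatorI)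
  qed
  ultimately show ?thesis by (rule isolatedI)
qed

section \<open>A rank function on isolated subgroups\<close>

text \<open>For nested isolated subgroups, equal rank forces equal intersection with
  \<open>C\<close>. Since \<open>C\<close> is a parameter, the measure can be built by enlarging
  \<open>C\<close> from the trivial group to the whole group.\<close>

definition controls_rank :: "'a set \<Rightarrow> ('a set \<Rightarrow> nat) \<Rightarrow> nat \<Rightarrow> bool" where
  "controls_rank C \<rho> B \<longleftrightarrow> (\<forall>H. isolated G H \<longrightarrow> \<rho> H \<le> B) \<and>
     (\<forall>H H'. isolated G H \<longrightarrow> isolated G H' \<longrightarrow> H \<subseteq> H' \<longrightarrow>
        \<rho> H \<le> \<rho> H' \<and> (\<rho> H = \<rho> H' \<longrightarrow> H' \<inter> C \<subseteq> H))"

definition rank_controls :: "'a set \<Rightarrow> bool" where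
  "rank_controls C \<longleftrightarrow> (\<exists>\<rho> B. controls_rank C \<rho> B)"

lemma controls_rankD:
  assumes "controls_rank C \<rho> B"
  shows "isolated G H \<Longrightarrow> \<rho> H \<le> B"
    and "isolated G H \<Longrightarrow> isolated G H' \<Longrightarrow> H \<subseteq> H' \<Longrightarrow> \<rho> H \<le> \<rho> H'"
    and "isolated G H \<Longrightarrow> isolated G H' \<Longrightarrow> H \<subseteq> H' \<Longrightarrow> \<rho> H = \<rho> H' \<Longrightarrow> H' \<inter> C \<subseteq> H"
  using assms by (simp_all add: controls_rank_def)

lemma rank_controls_mono:
  assumes "rank_controls C" "D \<subseteq> C"
  shows "rank_controls D"
proof -
  from assms(1) obtain \<rho> B where \<rho>: "controls_rank C \<rho> B"
    unfolding rank_controls_def by auto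
  have "controls_rank D \<rho> B" unfolding controls_rank_def
  proof (intro allI impI conjI)
    fix H H' assume H: "isolated G H" "isolated G H'" "H \<subseteq> H'"
    show "\<rho> H \<le> \<rho> H'" by (rule controls_rankD(2)[OF \<rho> H])
    assume "\<rho> H = \<rho> H'"
    from controls_rankD(3)[OF \<rho> H this] show "H' \<inter> D \<subseteq> H" using assms(2) by blast
  qed (rule controls_rankD(1)[OF \<rho>])
  then show ?thesis by (auto simp: rank_controls_def)
qed

lemma rank_controls_one: "rank_controls {\<one>}"
  unfolding rank_controls_def controls_rank_def
proof (intro exI[of _ "\<lambda>_. 0"] exI[of _ 0] allI impI conjI)
  fix H H' assume "isolated G H"
  then show "H' \<inter> {\<one>} \<subseteq> H" using subgroup.one_closed[OF isolated_imp_subgroup] by blast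
qed simp_all

text \<open>\<open>?C'\<close> is the product of \<open>C\<close> with the powers of
  \<open>a\<close>; the new rank adds 1 if \<open>H\<close> contains an element of
  \<open>?C'\<close> of infinite order modulo \<open>C\<close>. Suppose \<open>H\<close> and
  \<open>H'\<close> have equal new rank and let \<open>x\<close> be in \<open>H'\<close> and
  \<open>?C'\<close>. If some power of \<open>x\<close> lies in \<open>C\<close>, it lies in
  \<open>H\<close>, and isolation gives \<open>x\<close> in \<open>H\<close>. Otherwise
  \<open>H\<close> too contains some \<open>h\<close> of infinite order modulo \<open>C\<close>. As
  both are powers of \<open>a\<close> modulo \<open>C\<close>, a nonzero power of \<open>x\<close>
  agrees with a power of \<open>h\<close> up to an element of \<open>C\<close> and
  \<open>H'\<close>, hence of \<open>H\<close>.\<close>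

lemma rank_controls_cyclic_extension:
  assumes C: "C \<lhd> G" and a: "a \<in> carrier G" and rc: "rank_controls C"
  shows "rank_controls {x \<in> carrier G. \<exists>k::int. x \<otimes> a [^] k \<in> C}" (is "rank_controls ?C'")
proof -
  interpret C: normal C G by fact
  interpret Q: group "G Mod C" by (rule C.factorgroup_is_group)
  interpret p: group_hom G "G Mod C" "\<lambda>a. C #> a"
    using C.r_coset_hom_Mod by unfold_locales
  obtain \<rho> B where rB: "controls_rank C \<rho> B" using rc by (auto simp: rank_controls_def)
  note \<rho> = controls_rankD[OF rB]
  define E where "E = (\<lambda>H. \<exists>h \<in> H \<inter> ?C'. \<forall>m::nat. m \<ge> 1 \<longrightarrow> h [^] m \<notin> C)"
  define \<rho>' where "\<rho>' = (\<lambda>H. \<rho> H + (if E H then 1 else 0))"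
  show ?thesis unfolding rank_controls_def controls_rank_def
  proof (intro exI[of _ \<rho>'] exI[of _ "Suc B"] allI impI conjI)
    fix H assume "isolated G H"
    then show "\<rho>' H \<le> Suc B" using \<rho>(1)[of H] by (simp add: \<rho>'_def)
  next
    fix H H' assume H: "isolated G H" and H': "isolated G H'" and sub: "H \<subseteq> H'"
    have E: "E H \<Longrightarrow> E H'" using sub by (auto simp: E_def)
    show "\<rho>' H \<le> \<rho>' H'" using \<rho>(2)[OF H H' sub] E by (simp add: \<rho>'_def)
    assume "\<rho>' H = \<rho>' H'"
    then have eq: "\<rho> H = \<rho> H'" "E H = E H'"
      using \<rho>(2)[OF H H' sub] E by (auto simp: \<rho>'_def split: if_splits)
    have HC: "H' \<inter> C \<subseteq> H" using \<rho>(3)[OF H H' sub eq(1)] .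
    interpret H: subgroup H G by (rule isolated_imp_subgroup[OF H])
    interpret H': subgroup H' G by (rule isolated_imp_subgroup[OF H'])
    have HI: "x \<in> H" if "x \<in> carrier G" "(m::nat) \<ge> 1" "x [^] m \<in> H" for x m
      by (rule isolatedD[OF H that(3,1,2)])
    show "H' \<inter> ?C' \<subseteq> H"
    proof
      fix x assume x: "x \<in> H' \<inter> ?C'"
      then have [simp]: "x \<in> carrier G" by simp
      show "x \<in> H"
      proof (cases "\<exists>m::nat. m \<ge> 1 \<and> x [^] m \<in> C")
        case True
        then obtain m :: nat where m: "m \<ge> 1" "x [^] m \<in> C" by blast
        have "x [^] m \<in> H'" using x H'.subgroup_axioms by (induction m) auto
        then show ?thesis using HI m HC by (meson IntI \<open>x \<in> carrier G\<close> subsetD)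
      next
        case False
        then have "E H" using x eq(2) by (auto simp: E_def)
        then obtain h where h: "h \<in> H" "h \<in> ?C'" "\<And>m::nat. m \<ge> 1 \<Longrightarrow> h [^] m \<notin> C" by (auto simp: E_def)
        then have [simp]: "h \<in> carrier G" by simp
        obtain k l :: int where k: "x \<otimes> a [^] k \<in> C" and l: "h \<otimes> a [^] l \<in> C" using x h by auto
        \<comment> \<open>For \<open>l = 0\<close> the element \<open>h\<close> itself would lie in
          \<open>C\<close>.\<close>
        have l0: "l \<noteq> 0" using h(3)[of 1] l by auto
        have "C #> y = (C #> a) [^]\<^bsub>G Mod C\<^esub> (- i)" if "y \<otimes> a [^] i \<in> C" "y \<in> carrier G" for y and i :: int
        proof -
          have "C #> y = C #> (a [^] (- i))"
            by (rule iffD2[OF rcoset_eq_iff[OF C]]) (use that a in \<open>auto simp: int_pow_neg\<close>)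
          then show ?thesis using a by (simp only: p.hom_int_pow)
        qed
        then have px: "C #> x = (C #> a) [^]\<^bsub>G Mod C\<^esub> (- k)" and ph: "C #> h = (C #> a) [^]\<^bsub>G Mod C\<^esub> (- l)"
          using k l by simp_all
        have "C #> a \<in> carrier (G Mod C)" using a p.hom_closed by blast
        then have "(C #> x) [^]\<^bsub>G Mod C\<^esub> l \<otimes>\<^bsub>G Mod C\<^esub> (C #> h) [^]\<^bsub>G Mod C\<^esub> (- k) = \<one>\<^bsub>G Mod C\<^esub>"
          unfolding px ph by (simp only: Q.int_pow_pow Q.int_pow_mult[symmetric]) (simp add: mult.commute)
        then have "C #> (x [^] l \<otimes> h [^] (- k)) = C"
          by (simp only: p.hom_mult[symmetric] p.hom_int_pow[symmetric] int_pow_closed \<open>x \<in> carrier G\<close> \<open>h \<in> carrier G\<close> one_FactGroup)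
        then have xC: "x [^] l \<otimes> h [^] (- k) \<in> C"
          using coset_join1[OF _ _ C.subgroup_axioms] by (simp add: C.subset)
        have hk: "h [^] (- k) \<in> H" using subgroup_int_pow_closed[OF H.subgroup_axioms h(1)] .
        have "x [^] l \<in> H'" using subgroup_int_pow_closed[OF H'.subgroup_axioms] x by blast
        then have "x [^] l \<otimes> h [^] (- k) \<in> H'" using hk sub by blast
        then have "x [^] l \<otimes> h [^] (- k) \<in> H" using xC HC by blast
        then have "x [^] l \<otimes> h [^] (- k) \<otimes> inv (h [^] (- k)) \<in> H" using hk by blast
        then have xl: "x [^] l \<in> H" by (simp add: m_assoc)
        \<comment> \<open>Isolation speaks of positive natural exponents, while \<open>l\<close> may
          be negative.\<close>
        have "x [^] \<bar>l\<bar> \<in> H"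
        proof (cases "l \<ge> 0")
          case False
          then show ?thesis using H.m_inv_closed[OF xl] by (simp add: int_pow_neg)
        qed (use xl in simp)
        then have "x [^] (nat \<bar>l\<bar>) \<in> H" by (simp flip: int_pow_int)
        then show ?thesis using HI[of x "nat \<bar>l\<bar>"] l0 by simp
      qed
    qed
  qed
qed

lemma subgroup_cyclic_extension:
  assumes C: "C \<lhd> G" and a: "a \<in> carrier G"
  shows "subgroup {x \<in> carrier G. \<exists>k::int. x \<otimes> a [^] k \<in> C} G" (is "subgroup ?C' G")
proof -
  interpret C: normal C G by fact
  show ?thesis
  proof (rule subgroupI)
    have "a \<otimes> a [^] (-1::int) \<in> C" using a by (simp add: int_pow_neg)
    then show "?C' \<noteq> {}" using a by blast
  next
    fix x assume "x \<in> ?C'"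
    then obtain k :: int where x: "x \<in> carrier G" and k: "x \<otimes> a [^] k \<in> C" by blast
    have "inv x \<otimes> inv (x \<otimes> a [^] k) \<otimes> inv (inv x) \<in> C"
      by (rule C.inv_op_closed2) (use x k in auto)
    then have "inv x \<otimes> a [^] (- k) \<in> C" using x a by (simp add: free_reduce int_pow_neg)
    then show "inv x \<in> ?C'" using x by blast
  next
    fix x y assume "x \<in> ?C'" "y \<in> ?C'"
    then obtain k l :: int where x: "x \<in> carrier G" "y \<in> carrier G"
      and k: "x \<otimes> a [^] k \<in> C" "y \<otimes> a [^] l \<in> C" by blast
    have ak: "a [^] k \<in> carrier G" "a [^] l \<in> carrier G" using a by auto
    have "inv (a [^] k) \<otimes> (y \<otimes> a [^] l) \<otimes> inv (inv (a [^] k)) \<in> C"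
      by (rule C.inv_op_closed2) (use ak k in auto)
    then have "(x \<otimes> a [^] k) \<otimes> (inv (a [^] k) \<otimes> (y \<otimes> a [^] l) \<otimes> inv (inv (a [^] k))) \<in> C"
      using k(1) by (rule C.m_closed[rotated])
    then have "(x \<otimes> y) \<otimes> (a [^] l \<otimes> a [^] k) \<in> C" using x ak by (simp add: free_reduce)
    then have "(x \<otimes> y) \<otimes> a [^] (l + k) \<in> C" using a by (simp add: int_pow_mult)
    then show "x \<otimes> y \<in> ?C'" using x by blast
  qed blast
qed

text \<open>Lets an exponent of \<open>a\<close> be read off from membership in a generated
  subgroup.\<close>

lemma generate_cyclic_extension:
  assumes C: "C \<lhd> G" and a: "a \<in> carrier G"
  shows "generate G (insert a C) \<subseteq> {x \<in> carrier G. \<exists>k::int. x \<otimes> a [^] k \<in> C}"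
proof (rule generate_subgroup_incl[OF _ subgroup_cyclic_extension[OF assms]])
  have C': "subgroup C G" using C by (rule normal_imp_subgroup)
  have "a \<otimes> a [^] (-1::int) \<in> C" using a subgroup.one_closed[OF C'] by (simp add: int_pow_neg)
  moreover have "x \<otimes> a [^] (0::int) \<in> C" if "x \<in> C" for x
    using that subgroup.mem_carrier[OF C'] by simp
  ultimately show "insert a C \<subseteq> {x \<in> carrier G. \<exists>k::int. x \<otimes> a [^] k \<in> C}"
    using a subgroup.mem_carrier[OF C'] by blast
qed

text \<open>The elements of \<open>A\<close> are adjoined one at a time. Every intermediate subgroup
  lies between two consecutive terms of the series and is therefore normal, as the cyclic extension
  requires.\<close>

lemma rank_controls_lower_central_step:
  assumes "finite A" "A \<subseteq> lower_central G n" "rank_controls (lower_central G (Suc n))"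
  shows "rank_controls (generate G (A \<union> lower_central G (Suc n)))"
  using assms(1,2)
proof (induction A rule: finite_induct)
  case empty
  have "generate G (lower_central G (Suc n)) = lower_central G (Suc n)"
    by (rule generateI[symmetric, OF normal_imp_subgroup[OF lower_central_normal]]) auto
  then show ?case using assms(3) by simp
next
  case (insert a A)
  let ?D = "generate G (A \<union> lower_central G (Suc n))"
  note Lc = lower_central_subset[THEN subsetD]
  have a: "a \<in> carrier G" and A: "A \<union> lower_central G (Suc n) \<subseteq> carrier G" using insert Lc by auto
  have D: "subgroup ?D G" by (rule generate_is_subgroup[OF A])
  interpret D: subgroup ?D G by fact
  have LD: "lower_central G (Suc n) \<subseteq> ?D" by (auto intro: generate.incl)
  have DL: "?D \<subseteq> lower_central G n"
    by (rule generate_subgroup_incl[OF _ normal_imp_subgroup[OF lower_central_normal]])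
      (use insert lower_central_Suc_subset in auto)
  have nD: "?D \<lhd> G"
    unfolding normal_inv_iff
  proof (intro conjI ballI D)
    fix g d assume g: "g \<in> carrier G" and d: "d \<in> ?D"
    have "comtr d g \<in> ?D" using comtr_lower_central[of d n g] d DL g LD by blast
    then have "inv (comtr d g) \<otimes> d \<in> ?D" using d by simp
    moreover have "inv (comtr d g) \<otimes> d = g \<otimes> d \<otimes> inv g" using g d by (simp add: comtr_def free_reduce)
    ultimately show "g \<otimes> d \<otimes> inv g \<in> ?D" by simp
  qed
  let ?C' = "{x \<in> carrier G. \<exists>k::int. x \<otimes> a [^] k \<in> ?D}"
  have "generate G (insert a A \<union> lower_central G (Suc n)) \<subseteq> generate G (insert a ?D)"
    by (rule mono_generate) (auto intro: generate.incl)
  also have "\<dots> \<subseteq> ?C'" by (rule generate_cyclic_extension[OF nD a])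
  finally have "generate G (insert a A \<union> lower_central G (Suc n)) \<subseteq> ?C'" .
  moreover have "rank_controls ?C'"
    by (rule rank_controls_cyclic_extension[OF nD a]) (use insert in auto)
  ultimately show ?case by (rule rank_controls_mono[rotated])
qed

text \<open>Each layer is spanned by the commutators of generators of the preceding layer with
  generators of the group.\<close>

lemma lower_central_finitely_generated_mod:
  assumes B: "finite B" "B \<subseteq> carrier G" "generate G B = carrier G"
  shows "\<exists>A. finite A \<and> A \<subseteq> lower_central G n \<and>
    lower_central G n \<subseteq> generate G (A \<union> lower_central G (Suc n))"
proof (induction n)
  case 0
  then show ?case using B mono_generate[of B "B \<union> lower_central G (Suc 0)"] by (intro exI[of _ B]) auto
next
  case (Suc n)
  then obtain A where A: "finite A" "A \<subseteq> lower_central G n"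
    "lower_central G n \<subseteq> generate G (A \<union> lower_central G (Suc n))" by blast
  let ?A = "(\<lambda>(a, b). comtr a b) ` (A \<times> B)"
  have sub: "?A \<subseteq> lower_central G (Suc n)"
    using subsetD[OF A(2)] subsetD[OF B(2)] comtr_lower_central by auto
  have "lower_central G (Suc n) \<subseteq> generate G (?A \<union> lower_central G (Suc (Suc n)))"
  proof (rule lower_central_Suc_generated[OF _ _ B(2,3) A(2,3)])
    show "subgroup (generate G (?A \<union> lower_central G (Suc (Suc n)))) G"
      by (rule generate_is_subgroup) (use sub lower_central_subset in blast)
  qed (auto intro: generate.incl)
  then show ?case using A B sub by (intro exI[of _ ?A]) auto
qed

text \<open>The measure is lifted term by term from the trivial last term to the whole group, where
  equal rank forces nested isolated subgroups to coincide.\<close>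

lemma finite_rank_nilpotent:
  assumes "nilpotent_group G" "finitely_generated G"
  shows "finite_rank G"
proof -
  obtain B where B: "finite B" "B \<subseteq> carrier G" "generate G B = carrier G"
    using assms(2) by (auto simp: finitely_generated_def)
  obtain c where c: "lower_central G c = {\<one>}" using assms(1) by (auto simp: nilpotent_group_def)
  have step: "rank_controls (lower_central G n)" if "rank_controls (lower_central G (Suc n))" for n
    using lower_central_finitely_generated_mod[OF B, of n]
      rank_controls_lower_central_step[OF _ _ that] rank_controls_mono by blast
  have "rank_controls (lower_central G m) \<Longrightarrow> rank_controls (lower_central G 0)" for m
    by (induction m) (use step in blast)+
  then have "rank_controls (carrier G)" using c rank_controls_one by (metis lower_central.simps(1))
  then obtain \<rho> B where rB: "controls_rank (carrier G) \<rho> B" by (auto simp: rank_controls_def)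
  note \<rho> = controls_rankD[OF rB]
  show ?thesis unfolding finite_rank_def
  proof (intro exI[of _ \<rho>] exI[of _ B] allI impI conjI; (elim conjE)?)
    fix H H' assume H: "isolated G H" "isolated G H'" "H \<subset> H'"
    have "H' \<subseteq> carrier G" by (rule subgroup.subset[OF isolated_imp_subgroup[OF H(2)]])
    then have "\<rho> H \<noteq> \<rho> H'" using \<rho>(3)[OF H(1,2)] H(3) by auto
    then show "\<rho> H < \<rho> H'" using \<rho>(2)[OF H(1,2)] H(3) by auto
  qed (rule \<rho>(1))
qed

end

section \<open>Endomorphisms of divisible torsion-free nilpotent groups\<close>

text \<open>Captures the unique divisibility of a completion without reference to the group that is
  completed. Nilpotency is assumed separately where isolators have to be subgroups.\<close>

locale rational_group = group +
  assumes root_unique: "\<lbrakk>x \<in> carrier G; y \<in> carrier G; (m::nat) \<ge> 1; x [^] m = y [^] m\<rbrakk> \<Longrightarrow> x = y"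
    and root_exists: "\<lbrakk>x \<in> carrier G; (m::nat) \<ge> 1\<rbrakk> \<Longrightarrow> \<exists>y \<in> carrier G. y [^] m = x"

lemma (in group) conj_nat_pow:
  assumes "g \<in> carrier G" "x \<in> carrier G"
  shows "(g \<otimes> x \<otimes> inv g) [^] (n::nat) = g \<otimes> x [^] n \<otimes> inv g"
  by (induction n) (use assms in \<open>simp_all add: free_reduce\<close>)

context rational_group
begin

lemma pow_eq_one: "x \<in> carrier G \<Longrightarrow> (m::nat) \<ge> 1 \<Longrightarrow> x [^] m = \<one> \<Longrightarrow> x = \<one>"
  by (rule root_unique[of x \<one> m]) auto

text \<open>The conjugate of \<open>x\<close> by \<open>y\<close> has the same \<open>m\<close>-th
  power as \<open>x\<close>, and roots are unique.\<close>

lemma commute_of_pow_commute: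
  assumes xy: "x \<in> carrier G" "y \<in> carrier G" and m: "(m::nat) \<ge> 1" and "x [^] m \<otimes> y = y \<otimes> x [^] m"
  shows "x \<otimes> y = y \<otimes> x"
proof -
  have "(y \<otimes> x \<otimes> inv y) [^] m = y \<otimes> x [^] m \<otimes> inv y" using xy by (simp only: conj_nat_pow)
  also have "\<dots> = x [^] m \<otimes> y \<otimes> inv y" using assms(4) by simp
  also have "\<dots> = x [^] m" using xy by (simp add: m_assoc)
  finally have "y \<otimes> x \<otimes> inv y = x" using xy m by (intro root_unique[of _ x m]) auto
  then have "y \<otimes> x \<otimes> inv y \<otimes> y = x \<otimes> y" by simp
  then show ?thesis using xy by (simp add: m_assoc)
qed

end

section \<open>Completions: unique roots and finite rank\<close>

text \<open>The definition provides unique roots only for elements coming from \<open>N\<close>.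
  Raising to a further power moves an arbitrary element of \<open>M\<close> there.\<close>

lemma malcev_rational_group:
  assumes "malcev_completion N M \<iota>"
  shows "rational_group M"
proof -
  have nil: "nilpotent_group M" and \<iota>: "\<iota> \<in> mon N M"
    and roots: "\<And>n m. n \<in> carrier N \<Longrightarrow> (m::nat) \<ge> 1 \<Longrightarrow> \<exists>!x. x \<in> carrier M \<and> x [^]\<^bsub>M\<^esub> m = \<iota> n"
    and pow: "\<And>x. x \<in> carrier M \<Longrightarrow> \<exists>m::nat. m \<ge> 1 \<and> x [^]\<^bsub>M\<^esub> m \<in> \<iota> ` carrier N"
    using assms by (auto simp: malcev_completion_def)
  interpret M: group M using nil by (simp add: nilpotent_group_def)
  have uniq: "x = y" if xy: "x \<in> carrier M" "y \<in> carrier M" and m: "(m::nat) \<ge> 1"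
    and eq: "x [^]\<^bsub>M\<^esub> m = y [^]\<^bsub>M\<^esub> m" for x y m
  proof -
    obtain l n where l: "(l::nat) \<ge> 1" "n \<in> carrier N" "(x [^]\<^bsub>M\<^esub> m) [^]\<^bsub>M\<^esub> l = \<iota> n"
      using pow[of "x [^]\<^bsub>M\<^esub> m"] xy by auto
    have "(y [^]\<^bsub>M\<^esub> m) [^]\<^bsub>M\<^esub> l = \<iota> n" using l(3) eq by simp
    with l(3) have "x [^]\<^bsub>M\<^esub> (m * l) = \<iota> n" "y [^]\<^bsub>M\<^esub> (m * l) = \<iota> n"
      using xy by (simp_all add: M.nat_pow_pow)
    moreover have "m * l \<ge> 1" using m l by simp
    ultimately show "x = y" using roots[OF l(2)] xy by blast
  qed
  show ?thesis
  proof
    fix x y and m :: nat assume "x \<in> carrier M" "y \<in> carrier M" "m \<ge> 1" "x [^]\<^bsub>M\<^esub> m = y [^]\<^bsub>M\<^esub> m"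
    then show "x = y" by (rule uniq)
  next
    fix x and m :: nat assume x: "x \<in> carrier M" and m: "m \<ge> 1"
    obtain l n where l: "(l::nat) \<ge> 1" "n \<in> carrier N" "x [^]\<^bsub>M\<^esub> l = \<iota> n" using pow[OF x] by auto
    have "m * l \<ge> 1" using m l by simp
    \<comment> \<open>An \<open>m * l\<close>-th root of \<open>x [^] l\<close> is an
      \<open>m\<close>-th root of \<open>x\<close>, because elements are determined by their
      \<open>l\<close>-th powers.\<close>
    then obtain y where y: "y \<in> carrier M" "y [^]\<^bsub>M\<^esub> (m * l) = \<iota> n" using roots[OF l(2)] by blast
    then have "(y [^]\<^bsub>M\<^esub> m) [^]\<^bsub>M\<^esub> l = x [^]\<^bsub>M\<^esub> l" using l by (simp add: M.nat_pow_pow)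
    then have "y [^]\<^bsub>M\<^esub> m = x" using uniq[of "y [^]\<^bsub>M\<^esub> m" x l] x y l by simp
    then show "\<exists>y\<in>carrier M. y [^]\<^bsub>M\<^esub> m = x" using y by blast
  qed
qed

text \<open>\<open>M\<close> need not be finitely generated, so the measure is pulled back from
  \<open>N\<close> along preimages under \<iota>. Strictness survives: an element of
  \<open>H'\<close> outside \<open>H\<close> has a power in the image of \<open>N\<close>, and by
  isolation that power is still outside \<open>H\<close>.\<close>

lemma malcev_finite_rank:
  assumes N: "nilpotent_group N" "finitely_generated N" and M: "malcev_completion N M \<iota>"
  shows "finite_rank M"
proof -
  have \<iota>: "\<iota> \<in> mon N M" and pow: "\<And>x. x \<in> carrier M \<Longrightarrow> \<exists>m::nat. m \<ge> 1 \<and> x [^]\<^bsub>M\<^esub> m \<in> \<iota> ` carrier N"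
    using M by (auto simp: malcev_completion_def)
  interpret N: group N using N by (simp add: nilpotent_group_def)
  interpret M: group M using M by (simp add: malcev_completion_def nilpotent_group_def)
  interpret \<iota>: group_hom N M \<iota> using \<iota> by unfold_locales (auto simp: mon_def)
  obtain \<rho> :: "'a set \<Rightarrow> nat" and B where
    \<rho>: "\<forall>H. isolated N H \<longrightarrow> \<rho> H \<le> B \<and> (\<forall>H'. isolated N H' \<and> H \<subset> H' \<longrightarrow> \<rho> H < \<rho> H')"
    using N.finite_rank_nilpotent[OF N] unfolding finite_rank_def by metis
  define P where "P = (\<lambda>H. {n \<in> carrier N. \<iota> n \<in> H})"
  have P: "isolated N (P H)" if H: "isolated M H" for H
  proof (rule isolatedI)
    interpret H: subgroup H M by (rule isolated_imp_subgroup[OF H])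
    show "subgroup (P H) N"
      by (rule N.subgroupI) (auto simp: P_def intro: exI[of _ "\<one>\<^bsub>N\<^esub>"])
    fix x and m :: nat assume x: "x \<in> carrier N" "m \<ge> 1" "x [^]\<^bsub>N\<^esub> m \<in> P H"
    then have "\<iota> x [^]\<^bsub>M\<^esub> m \<in> H" by (simp add: P_def \<iota>.hom_nat_pow)
    then have "\<iota> x \<in> H" by (rule isolatedD[OF H]) (use x in auto)
    then show "x \<in> P H" using x by (simp add: P_def)
  qed
  have strict: "P H \<subset> P H'" if H: "isolated M H" and H': "isolated M H'" and sub: "H \<subset> H'" for H H'
  proof -
    obtain x where x: "x \<in> H'" "x \<notin> H" using sub by blast
    interpret H': subgroup H' M by (rule isolated_imp_subgroup[OF H'])
    have xM: "x \<in> carrier M" using x by simp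
    obtain m n where m: "(m::nat) \<ge> 1" "n \<in> carrier N" "x [^]\<^bsub>M\<^esub> m = \<iota> n" using pow[OF xM] by auto
    have "x [^]\<^bsub>M\<^esub> m \<in> H'" by (induction m) (use x in auto)
    moreover have "x [^]\<^bsub>M\<^esub> m \<notin> H" using isolatedD[OF H _ xM m(1)] x(2) by blast
    ultimately have "n \<in> P H' - P H" using m by (simp add: P_def)
    moreover have "P H \<subseteq> P H'" using sub by (auto simp: P_def)
    ultimately show ?thesis by blast
  qed
  show ?thesis unfolding finite_rank_def
  proof (intro exI[of _ "\<lambda>H. \<rho> (P H)"] exI[of _ B] allI impI conjI; (elim conjE)?)
    fix H assume "isolated M H" then show "\<rho> (P H) \<le> B" using \<rho> P by blast
  next
    fix H H' assume "isolated M H" "isolated M H'" "H \<subset> H'"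
    then show "\<rho> (P H) < \<rho> (P H')" using \<rho> P[of H] P[of H'] strict[of H H'] by simp
  qed
qed

section \<open>Chain conditions and Fitting's lemma\<close>

lemma finite_rank_maximal:
  assumes "finite_rank G" "\<And>H. P H \<Longrightarrow> isolated G H" "P H0"
  obtains H where "P H" "\<And>H'. P H' \<Longrightarrow> \<not> H \<subset> H'"
proof -
  obtain \<rho> :: "'a set \<Rightarrow> nat" and B where
    \<rho>: "\<And>H. isolated G H \<Longrightarrow> \<rho> H \<le> B" "\<And>H H'. isolated G H \<Longrightarrow> isolated G H' \<Longrightarrow> H \<subset> H' \<Longrightarrow> \<rho> H < \<rho> H'"
    using assms(1) unfolding finite_rank_def by metis
  have "\<forall>H. P H \<longrightarrow> \<rho> H < Suc B" using assms(2) \<rho>(1) by (simp add: less_Suc_eq_le)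
  from ex_has_greatest_nat[of P, OF assms(3) this] obtain H where
    H: "P H" "\<And>H'. P H' \<Longrightarrow> \<rho> H' \<le> \<rho> H" by auto
  show ?thesis
  proof (rule that[OF H(1)])
    fix H' assume "P H'"
    then show "\<not> H \<subset> H'" using \<rho>(2)[of H H'] assms(2)[OF H(1)] assms(2)[of H'] H(2)[of H'] by auto
  qed
qed

lemma finite_rank_minimal:
  assumes "finite_rank G" "\<And>H. P H \<Longrightarrow> isolated G H" "P H0"
  obtains H where "P H" "\<And>H'. P H' \<Longrightarrow> \<not> H' \<subset> H"
proof -
  obtain \<rho> :: "'a set \<Rightarrow> nat" and B where
    \<rho>: "\<And>H H'. isolated G H \<Longrightarrow> isolated G H' \<Longrightarrow> H \<subset> H' \<Longrightarrow> \<rho> H < \<rho> H'"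
    using assms(1) unfolding finite_rank_def by metis
  from ex_has_least_nat[of P, OF assms(3), of \<rho>] obtain H where
    H: "P H" "\<And>H'. P H' \<Longrightarrow> \<rho> H \<le> \<rho> H'" by auto
  show ?thesis
  proof (rule that[OF H(1)])
    fix H' assume "P H'"
    then show "\<not> H' \<subset> H" using \<rho>(1)[of H' H] assms(2)[OF H(1)] assms(2)[of H'] H(2)[of H'] by auto
  qed
qed

text \<open>Indecomposability is defined through external products; multiplication is an isomorphism
  from the external product of \<open>K\<close> and \<open>L\<close> onto \<open>G\<close>.\<close>

lemma (in group) directly_indecomposable_internal:
  assumes ind: "directly_indecomposable G" and K: "subgroup K G" and L: "subgroup L G"
    and KL: "K \<inter> L = {\<one>}" and comm: "\<And>x y. x \<in> K \<Longrightarrow> y \<in> L \<Longrightarrow> x \<otimes> y = y \<otimes> x"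
    and gen: "\<And>x. x \<in> carrier G \<Longrightarrow> \<exists>k \<in> K. \<exists>l \<in> L. x = k \<otimes> l"
  shows "K = {\<one>} \<or> L = {\<one>}"
proof -
  interpret K: subgroup K G by fact
  interpret L: subgroup L G by fact
  let ?K = "G\<lparr>carrier := K\<rparr>" and ?L = "G\<lparr>carrier := L\<rparr>"
  let ?f = "\<lambda>(x, y). x \<otimes> y"
  have gK: "group ?K" and gL: "group ?L" using K L by (auto intro: subgroup_imp_group)
  have "?f \<in> iso (?K \<times>\<times> ?L) G"
  proof (rule isoI)
    show "?f \<in> hom (?K \<times>\<times> ?L) G"
    proof (rule homI)
      fix a b assume a: "a \<in> carrier (?K \<times>\<times> ?L)" and b: "b \<in> carrier (?K \<times>\<times> ?L)"
      obtain x y x' y' where eq: "a = (x, y)" "b = (x', y')" by (cases a, cases b)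
      have in': "x \<in> K" "y \<in> L" "x' \<in> K" "y' \<in> L" using a b eq by auto
      have "x \<otimes> x' \<otimes> (y \<otimes> y') = x \<otimes> (x' \<otimes> y) \<otimes> y'" using in' by (simp add: m_assoc)
      also have "\<dots> = x \<otimes> (y \<otimes> x') \<otimes> y'" using comm in' by simp
      also have "\<dots> = x \<otimes> y \<otimes> (x' \<otimes> y')" using in' by (simp add: m_assoc)
      finally show "?f (a \<otimes>\<^bsub>?K \<times>\<times> ?L\<^esub> b) = ?f a \<otimes> ?f b" by (simp add: eq)
    qed auto
    show "bij_betw ?f (carrier (?K \<times>\<times> ?L)) (carrier G)"
      unfolding bij_betw_def
    proof
      show "inj_on ?f (carrier (?K \<times>\<times> ?L))"
      proof (rule inj_onI)
        fix a b assume a: "a \<in> carrier (?K \<times>\<times> ?L)" and b: "b \<in> carrier (?K \<times>\<times> ?L)" and ab: "?f a = ?f b"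
        obtain x y x' y' where eq: "a = (x, y)" "b = (x', y')" by (cases a, cases b)
        have in': "x \<in> K" "y \<in> L" "x' \<in> K" "y' \<in> L" using a b eq by auto
        have "inv x' \<otimes> (x \<otimes> y) \<otimes> inv y = inv x' \<otimes> (x' \<otimes> y') \<otimes> inv y" using ab eq by simp
        then have *: "inv x' \<otimes> x = y' \<otimes> inv y" using in' by (simp add: free_reduce)
        have "inv x' \<otimes> x \<in> K" "y' \<otimes> inv y \<in> L" using in' by auto
        then have "inv x' \<otimes> x \<in> K \<inter> L" unfolding * by simp
        then have "inv x' \<otimes> x = \<one>" "y' \<otimes> inv y = \<one>" using KL * by auto
        then have "x' \<otimes> (inv x' \<otimes> x) = x'" "y' \<otimes> inv y \<otimes> y = y" using in' by auto
        then show "a = b" using in' by (simp add: eq free_reduce)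
      qed
      show "?f ` carrier (?K \<times>\<times> ?L) = carrier G"
      proof
        show "carrier G \<subseteq> ?f ` carrier (?K \<times>\<times> ?L)"
        proof
          fix x assume "x \<in> carrier G"
          then obtain k l where "k \<in> K" "l \<in> L" "x = k \<otimes> l" using gen by blast
          then show "x \<in> ?f ` carrier (?K \<times>\<times> ?L)" by (intro image_eqI[of _ _ "(k, l)"]) auto
        qed
      qed auto
    qed
  qed
  then have "?K \<times>\<times> ?L \<cong> G" by (auto simp: is_iso_def)
  then have "G \<cong> ?K \<times>\<times> ?L" by (rule group.iso_sym[OF DirProd_group[OF gK gL]])
  from directly_indecomposable_factors[OF ind group_axioms gK gL this]
  show ?thesis by (auto simp: trivial_group_def)
qed

lemma (in group) hom_funpow: "u \<in> hom G G \<Longrightarrow> u ^^ n \<in> hom G G"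
proof (induction n)
  case (Suc n)
  then have "u ^^ n \<in> hom G G" by blast
  then show ?case using Suc.prems by (auto simp: hom_def Pi_iff)
qed (auto simp: hom_def)

context rational_group
begin

lemma isolated_kernel:
  assumes "f \<in> hom G H" "rational_group H"
  shows "isolated G (kernel G H f)"
proof -
  interpret H: rational_group H by fact
  interpret f: group_hom G H f using assms by unfold_locales
  show ?thesis
  proof (rule isolatedI[OF f.subgroup_kernel])
    fix x and m :: nat assume x: "x \<in> carrier G" "m \<ge> 1" "x [^] m \<in> kernel G H f"
    then have "f x [^]\<^bsub>H\<^esub> m = \<one>\<^bsub>H\<^esub>" by (simp add: kernel_def f.hom_nat_pow)
    then have "f x = \<one>\<^bsub>H\<^esub>" using H.pow_eq_one x by simp
    then show "x \<in> kernel G H f" using x by (simp add: kernel_def)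
  qed
qed

text \<open>A root of a preimage maps to a root of the image, and roots in \<open>H\<close> are
  unique.\<close>

lemma isolated_image:
  assumes "f \<in> hom G H" "rational_group H"
  shows "isolated H (f ` carrier G)"
proof -
  interpret H: rational_group H by fact
  interpret f: group_hom G H f using assms by unfold_locales
  show ?thesis
  proof (rule isolatedI[OF f.img_is_subgroup])
    fix x and m :: nat assume x: "x \<in> carrier H" "m \<ge> 1" "x [^]\<^bsub>H\<^esub> m \<in> f ` carrier G"
    then obtain y where y: "y \<in> carrier G" "x [^]\<^bsub>H\<^esub> m = f y" by blast
    obtain z where z: "z \<in> carrier G" "z [^] m = y" using root_exists[OF y(1) x(2)] by blast
    have "f z [^]\<^bsub>H\<^esub> m = x [^]\<^bsub>H\<^esub> m" using z y by (simp flip: f.hom_nat_pow)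
    then have "f z = x" using H.root_unique x z by (meson f.hom_closed)
    then show "x \<in> f ` carrier G" using z by blast
  qed
qed

text \<open>Fitting's lemma. The kernels and the images of the powers of \<open>u\<close> are
  isolated, so both sequences become stationary, and from there on \<open>G\<close> is the product
  of kernel and image. Commuting with conjugation makes the images normal, so commutators between
  kernel and image lie in their trivial intersection and the product is direct.\<close>

lemma normal_endomorphism_iso_or_nilpotent:
  assumes fr: "finite_rank G" and ind: "directly_indecomposable G" and u: "u \<in> hom G G"
    and norm: "\<And>g x. g \<in> carrier G \<Longrightarrow> x \<in> carrier G \<Longrightarrow> u (g \<otimes> x \<otimes> inv g) = g \<otimes> u x \<otimes> inv g"
  shows "u \<in> iso G G \<or> (\<exists>n. \<forall>x \<in> carrier G. (u ^^ n) x = \<one>)"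
proof -
  define K where "K = (\<lambda>n. kernel G G (u ^^ n))"
  define L where "L = (\<lambda>n. (u ^^ n) ` carrier G)"
  have hom: "u ^^ n \<in> hom G G" for n by (rule hom_funpow[OF u])
  have gh: "group_hom G G (u ^^ n)" for n using hom by unfold_locales
  have cl: "(u ^^ n) x \<in> carrier G" if "x \<in> carrier G" for n x
    using group_hom.hom_closed[OF gh that] .
  have iK: "isolated G (K n)" and iL: "isolated G (L n)" for n
    unfolding K_def L_def by (rule isolated_kernel isolated_image, rule hom, rule rational_group_axioms)+
  have Kmono: "K n \<subseteq> K (n + k)" for n k
  proof
    fix x assume "x \<in> K n"
    then have x: "x \<in> carrier G" "(u ^^ n) x = \<one>" by (auto simp: K_def kernel_def)
    have "(u ^^ (k + n)) x = \<one>" using x group_hom.hom_one[OF gh[of k]] by (simp add: funpow_add)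
    then show "x \<in> K (n + k)" using x by (simp add: K_def kernel_def add.commute)
  qed
  have Lmono: "L (n + k) \<subseteq> L n" for n k
  proof
    fix x assume "x \<in> L (n + k)"
    then obtain y where "y \<in> carrier G" "x = (u ^^ n) ((u ^^ k) y)" by (auto simp: L_def funpow_add)
    then show "x \<in> L n" using cl by (auto simp: L_def)
  qed
  obtain H1 where H1: "H1 \<in> range K" "\<And>H'. H' \<in> range K \<Longrightarrow> \<not> H1 \<subset> H'"
    by (rule finite_rank_maximal[OF fr, of "\<lambda>H. H \<in> range K"]) (use iK in blast)+
  obtain H2 where H2: "H2 \<in> range L" "\<And>H'. H' \<in> range L \<Longrightarrow> \<not> H' \<subset> H2"
    by (rule finite_rank_minimal[OF fr, of "\<lambda>H. H \<in> range L"]) (use iL in blast)+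
  obtain a b where a: "H1 = K a" and b: "H2 = L b" using H1(1) H2(1) by blast
  \<comment> \<open>An exponent from which both sequences are constant.\<close>
  define n where "n = a + b"
  have Ka: "K (a + k) = K a" for k using H1(2)[of "K (a + k)"] Kmono[of a k] a by blast
  have Lb: "L (b + k) = L b" for k using H2(2)[of "L (b + k)"] Lmono[of b k] b by blast
  have Kn: "K (n + n) = K n" using Ka[of "b + n"] Ka[of b] by (simp add: n_def add.assoc)
  have Ln: "L (n + n) = L n" using Lb[of "a + n"] Lb[of a] by (simp add: n_def add.assoc add.commute add.left_commute)
  let ?u = "u ^^ n"
  interpret un: group_hom G G ?u by (rule gh)
  have normn: "(u ^^ m) (g \<otimes> x \<otimes> inv g) = g \<otimes> (u ^^ m) x \<otimes> inv g"
    if "g \<in> carrier G" "x \<in> carrier G" for g x m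
    using that by (induction m) (auto simp: norm cl)
  have uu: "(u ^^ (n + n)) x = ?u (?u x)" for x by (simp add: funpow_add)
  have KL: "x = \<one>" if "x \<in> K n" "x \<in> L n" for x
  proof -
    note x = that
    obtain y where y: "y \<in> carrier G" "x = ?u y" using x(2) by (auto simp: L_def)
    then have "y \<in> K (n + n)" using x(1) uu by (simp add: K_def kernel_def)
    then have "y \<in> K n" unfolding Kn .
    then show ?thesis using y by (simp add: K_def kernel_def)
  qed
  have "K n = {\<one>} \<or> L n = {\<one>}"
  proof (rule directly_indecomposable_internal[OF ind])
    show sK: "subgroup (K n) G" and sL: "subgroup (L n) G" using iK iL isolated_imp_subgroup by blast+
    show "K n \<inter> L n = {\<one>}"
      using KL subgroup.one_closed[OF sK] subgroup.one_closed[OF sL] by blast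
  next
    fix x y assume x: "x \<in> K n" and y: "y \<in> L n"
    then obtain y' where y': "y' \<in> carrier G" "y = ?u y'" by (auto simp: L_def)
    have xc: "x \<in> carrier G" "?u x = \<one>" using x by (auto simp: K_def kernel_def)
    have yc: "y \<in> carrier G" using y' by simp
    have "comtr x y \<in> K n"
      using xc yc by (simp add: K_def kernel_def comtr_def)
    moreover have "comtr x y \<in> L n"
    proof -
      have "x \<otimes> y \<otimes> inv x = ?u (x \<otimes> y' \<otimes> inv x)" using normn[OF xc(1) y'(1)] y' by simp
      then have "comtr x y = ?u (x \<otimes> y' \<otimes> inv x \<otimes> inv y')" using xc y' by (simp add: comtr_def)
      then show ?thesis using xc y' unfolding L_def by blast
    qed
    ultimately have "comtr x y = \<one>" by (rule KL)
    then show "x \<otimes> y = y \<otimes> x" using comtr_eq_one_iff[OF xc(1) yc] by simp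
  next
    fix x assume x: "x \<in> carrier G"
    then have "?u x \<in> L (n + n)" using Ln by (auto simp: L_def)
    then obtain y where y: "y \<in> carrier G" "?u x = ?u (?u y)" by (auto simp: L_def uu)
    have "x \<otimes> inv (?u y) \<in> K n" using x y by (simp add: K_def kernel_def)
    moreover have "?u y \<in> L n" using y by (auto simp: L_def)
    moreover have "x = (x \<otimes> inv (?u y)) \<otimes> ?u y" using x y by (simp add: m_assoc)
    ultimately show "\<exists>k\<in>K n. \<exists>l\<in>L n. x = k \<otimes> l" by blast
  qed
  then show ?thesis
  proof
    assume Kt: "K n = {\<one>}"
    interpret u: group_hom G G u using u by unfold_locales
    have "K 1 \<subseteq> {\<one>}"
    proof (cases n)
      \<comment> \<open>The zeroth kernel is trivial for every \<open>u\<close>; here stationarity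
        from the start shows that \<open>K 1\<close> equals \<open>K 0\<close>.\<close>
      case 0
      then have "K n = {\<one>}" "K (n + k) = K n" for k
        using Kt Kn Ka[of "b + k"] Ka[of b] by (simp_all add: n_def add.assoc)
      then show ?thesis using 0 by (metis add_0 order_refl)
    next
      case (Suc m)
      then show ?thesis using Kmono[of 1 m] Kt by simp
    qed
    then have "inj_on u (carrier G)" unfolding u.inj_iff_trivial_ker
      by (auto simp: K_def kernel_def)
    moreover have "x \<in> u ` carrier G" if x: "x \<in> carrier G" for x
    proof -
      \<comment> \<open>The image of the next power is already the stable image; cancelling the
        injective \<open>?u\<close> then yields a preimage of \<open>x\<close> under
        \<open>u\<close>.\<close>
      have "?u x \<in> L (n + 1)" using x Lb[of "a + 1"] Lb[of a]
        by (auto simp: L_def n_def add.assoc add.commute add.left_commute)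
      then obtain y where y: "y \<in> carrier G" "?u x = ?u (u y)"
        unfolding L_def funpow_add by auto
      then have "x \<otimes> inv (u y) \<in> K n" using x by (simp add: K_def kernel_def)
      then have "x \<otimes> inv (u y) \<otimes> u y = u y" using Kt y by simp
      then show ?thesis using x y by (auto simp: m_assoc)
    qed
    ultimately have "bij_betw u (carrier G) (carrier G)" unfolding bij_betw_def by auto
    then show ?thesis using u by (simp add: iso_def)
  next
    assume "L n = {\<one>}"
    then show ?thesis by (auto simp: L_def)
  qed
qed

text \<open>Both summands commute with conjugation: \<open>g\<close> is the product of
  \<open>u g\<close> and \<open>v g\<close>, and \<open>v g\<close> commutes with the image of
  \<open>u\<close>. If \<open>u\<close> is nilpotent, then \<open>v\<close> is injective, since a
  kernel element of \<open>v\<close> is fixed by \<open>u\<close>. An injective \<open>v\<close> is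
  nilpotent only on the trivial group, where it is bijective anyway.\<close>

lemma iso_summand:
  assumes fr: "finite_rank G" and ind: "directly_indecomposable G" and u: "u \<in> hom G G" and v: "v \<in> hom G G"
    and sum: "\<And>x. x \<in> carrier G \<Longrightarrow> u x \<otimes> v x = x"
    and comm: "\<And>x y. x \<in> carrier G \<Longrightarrow> y \<in> carrier G \<Longrightarrow> u x \<otimes> v y = v y \<otimes> u x"
  shows "u \<in> iso G G \<or> v \<in> iso G G"
proof -
  have normal: "u (g \<otimes> x \<otimes> inv g) = g \<otimes> u x \<otimes> inv g"
    if u: "u \<in> hom G G" and v: "v \<in> hom G G"
    and sum: "\<And>x. x \<in> carrier G \<Longrightarrow> u x \<otimes> v x = x"
    and comm: "\<And>x y. x \<in> carrier G \<Longrightarrow> y \<in> carrier G \<Longrightarrow> u x \<otimes> v y = v y \<otimes> u x"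
    and gx: "g \<in> carrier G" "x \<in> carrier G" for u v g x
  proof -
    interpret u: group_hom G G u using u by unfold_locales
    interpret v: group_hom G G v using v by unfold_locales
    have "g \<otimes> u x \<otimes> inv g = (u g \<otimes> v g) \<otimes> u x \<otimes> inv (u g \<otimes> v g)" using sum gx by simp
    also have "\<dots> = u g \<otimes> (v g \<otimes> u x) \<otimes> inv (v g) \<otimes> inv (u g)" using gx by (simp add: free_reduce)
    also have "\<dots> = u g \<otimes> u x \<otimes> inv (u g)" using comm[of x g, symmetric] gx by (simp add: m_assoc)
    finally show ?thesis using gx by simp
  qed
  interpret v: group_hom G G v using v by unfold_locales
  have "u \<in> iso G G \<or> (\<exists>n. \<forall>x \<in> carrier G. (u ^^ n) x = \<one>)"
    by (rule normal_endomorphism_iso_or_nilpotent[OF fr ind u normal[OF u v sum comm]])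
  then show ?thesis
  proof
    assume "\<exists>n. \<forall>x \<in> carrier G. (u ^^ n) x = \<one>"
    then obtain n where n: "\<And>x. x \<in> carrier G \<Longrightarrow> (u ^^ n) x = \<one>" by blast
    have inj: "x = \<one>" if "x \<in> carrier G" "v x = \<one>" for x
    proof -
      have "u x = x" using sum[OF that(1)] that group_hom.hom_closed[OF group_hom.intro[OF group_axioms group_axioms group_hom_axioms.intro[OF u]] that(1)] by simp
      then have "(u ^^ n) x = x" by (induction n) auto
      then show ?thesis using n that by simp
    qed
    have "v \<in> iso G G \<or> (\<exists>n. \<forall>x \<in> carrier G. (v ^^ n) x = \<one>)"
    proof (rule normal_endomorphism_iso_or_nilpotent[OF fr ind v normal[OF v u]])
      fix x y assume "x \<in> carrier G" "y \<in> carrier G"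
      then show "v x \<otimes> u x = x" "v x \<otimes> u y = u y \<otimes> v x" using sum comm by simp_all
    qed
    then show ?thesis
    proof
      assume "\<exists>n. \<forall>x \<in> carrier G. (v ^^ n) x = \<one>"
      then obtain m where m: "\<And>x. x \<in> carrier G \<Longrightarrow> (v ^^ m) x = \<one>" by blast
      have pow_inj: "(v ^^ m) x = \<one> \<Longrightarrow> x = \<one>" if x: "x \<in> carrier G" for x
      proof (induction m)
        case (Suc m)
        have "(v ^^ m) x \<in> carrier G" by (rule hom_in_carrier[OF hom_funpow[OF v] x])
        then have "(v ^^ m) x = \<one>" by (rule inj) (use Suc.prems in simp)
        then show ?case by (rule Suc.IH)
      qed simp
      have "carrier G = {\<one>}"
      proof (intro equalityI subsetI)
        fix x assume "x \<in> carrier G"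
        then show "x \<in> {\<one>}" using pow_inj[OF _ m] by simp
      qed simp
      then have "bij_betw v (carrier G) (carrier G)" by (simp add: bij_betw_def)
      then show ?thesis using v by (simp add: iso_def)
    qed blast
  qed blast
qed

section \<open>Homomorphisms with abelian image\<close>

text \<open>Otherwise a maximal isolated subgroup avoiding a central element outside the kernel
  is a direct factor complementing the central line through that element.\<close>

lemma hom_abelian_image_kills_centre:
  assumes nil: "nilpotent_group G" and fr: "finite_rank G" and ind: "directly_indecomposable G"
    and nonab: "\<not> comm_group G"
    and A: "rational_group A" and f: "f \<in> hom G A"
    and comm: "\<And>x y. x \<in> carrier G \<Longrightarrow> y \<in> carrier G \<Longrightarrow> f x \<otimes>\<^bsub>A\<^esub> f y = f y \<otimes>\<^bsub>A\<^esub> f x"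
    and z: "z \<in> centre G"
  shows "f z = \<one>\<^bsub>A\<^esub>"
proof (rule ccontr)
  assume fz: "f z \<noteq> \<one>\<^bsub>A\<^esub>"
  interpret A: rational_group A by fact
  interpret f: group_hom G A f using f by unfold_locales
  have zc [simp]: "z \<in> carrier G" and zcomm: "\<And>x. x \<in> carrier G \<Longrightarrow> z \<otimes> x = x \<otimes> z"
    using z by (auto simp: centre_def)
  \<comment> \<open>A subgroup that contains the kernel contains all commutators, because the image
    of \<open>f\<close> is abelian; so each candidate \<open>K\<close> is normal.\<close>
  define P where "P = (\<lambda>K. isolated G K \<and> kernel G A f \<subseteq> K \<and> (\<forall>m::nat. m \<ge> 1 \<longrightarrow> z [^] m \<notin> K))"
  have "f z [^]\<^bsub>A\<^esub> m \<noteq> \<one>\<^bsub>A\<^esub>" if "m \<ge> 1" for m :: nat using A.pow_eq_one[OF _ that] fz by auto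
  then have P0: "P (kernel G A f)" using isolated_kernel[OF f A] by (auto simp: P_def kernel_def f.hom_nat_pow)
  obtain K where K: "P K" and max: "\<And>K'. P K' \<Longrightarrow> \<not> K \<subset> K'"
    by (rule finite_rank_maximal[OF fr, of P, OF _ P0]) (auto simp: P_def)
  have iK: "isolated G K" and kerK: "kernel G A f \<subseteq> K" and zK: "\<And>m::nat. m \<ge> 1 \<Longrightarrow> z [^] m \<notin> K"
    using K by (simp_all add: P_def)
  interpret K: subgroup K G by (rule isolated_imp_subgroup[OF iK])
  have comtrK: "comtr x y \<in> K" if xy: "x \<in> carrier G" "y \<in> carrier G" for x y
  proof -
    have "f (comtr x y) = f x \<otimes>\<^bsub>A\<^esub> f y \<otimes>\<^bsub>A\<^esub> inv\<^bsub>A\<^esub> f x \<otimes>\<^bsub>A\<^esub> inv\<^bsub>A\<^esub> f y"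
      using xy by (simp add: comtr_def)
    also have "\<dots> = f y \<otimes>\<^bsub>A\<^esub> f x \<otimes>\<^bsub>A\<^esub> inv\<^bsub>A\<^esub> f x \<otimes>\<^bsub>A\<^esub> inv\<^bsub>A\<^esub> f y" using comm[OF xy] by simp
    also have "\<dots> = \<one>\<^bsub>A\<^esub>" using xy by (simp add: A.m_assoc)
    finally show ?thesis using kerK xy by (auto simp: kernel_def)
  qed
  have nK: "K \<lhd> G" unfolding normal_inv_iff
  proof (intro conjI ballI K.subgroup_axioms)
    fix g k assume g: "g \<in> carrier G" and k: "k \<in> K"
    then have "g \<otimes> k \<otimes> inv g = comtr g k \<otimes> k" by (simp add: comtr_def free_reduce)
    then show "g \<otimes> k \<otimes> inv g \<in> K" using comtrK g k by simp
  qed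
  have zpow: "z [^] (j::int) \<in> carrier G" "\<And>x. x \<in> carrier G \<Longrightarrow> z [^] j \<otimes> x = x \<otimes> z [^] j" for j
  proof -
    show "z [^] j \<in> carrier G" by simp
    fix x assume x: "x \<in> carrier G"
    have nat: "z [^] n \<otimes> x = x \<otimes> z [^] n" for n :: nat
      using group_commutes_pow[OF zcomm[OF x]] x by simp
    show "z [^] j \<otimes> x = x \<otimes> z [^] j"
    proof (cases j)
      case (nonneg n) then show ?thesis using nat by (simp add: int_pow_int)
    next
      case (neg n)
      have "inv (z [^] Suc n) \<otimes> x = inv (z [^] Suc n) \<otimes> (x \<otimes> z [^] Suc n) \<otimes> inv (z [^] Suc n)"
        using x by (simp add: m_assoc del: nat_pow_Suc)
      also have "\<dots> = x \<otimes> inv (z [^] Suc n)"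
        unfolding nat[symmetric] using x by (simp add: inv_cancel_left del: nat_pow_Suc)
      finally show ?thesis unfolding neg by (simp only: int_pow_neg_int zc)
    qed
  qed
  \<comment> \<open>The isolator of the group generated by \<open>z\<close>, that is, the rational
    line through \<open>z\<close>. It is central because roots are unique.\<close>
  define Z where "Z = {w \<in> carrier G. \<exists>m::nat. m \<ge> 1 \<and> (\<exists>j::int. w [^] m = z [^] j)}"
  have Zcomm: "w \<otimes> x = x \<otimes> w" if w: "w \<in> Z" and x: "x \<in> carrier G" for w x
  proof -
    obtain m :: nat and j :: int where "w \<in> carrier G" "m \<ge> 1" "w [^] m = z [^] j" using w by (auto simp: Z_def)
    then show ?thesis using commute_of_pow_commute[of w x m] x zpow(2)[OF x] by simp
  qed
  have ZI: "w \<in> Z" if "w [^] (m::nat) = z [^] (j::int)" "w \<in> carrier G" "m \<ge> 1" for w m j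
    unfolding Z_def using that by auto
  have Zz: "z \<in> Z" by (rule ZI[of _ 1 1]) simp_all
  have "K = {\<one>} \<or> Z = {\<one>}"
  proof (rule directly_indecomposable_internal[OF ind K.subgroup_axioms])
    show sZ: "subgroup Z G"
    proof (rule subgroupI)
      show "Z \<subseteq> carrier G" by (auto simp: Z_def)
      show "Z \<noteq> {}" using Zz by blast
    next
      fix w assume w: "w \<in> Z"
      then obtain m :: nat and j :: int where m: "w \<in> carrier G" "m \<ge> 1" "w [^] m = z [^] j" by (auto simp: Z_def)
      then have "inv w [^] m = z [^] (- j)" by (simp add: int_pow_neg nat_pow_inv)
      then show "inv w \<in> Z" by (rule ZI) (use m in auto)
    next
      fix w w' assume w: "w \<in> Z" and w': "w' \<in> Z"
      then obtain m m' :: nat and j j' :: int where m: "w \<in> carrier G" "m \<ge> 1" "w [^] m = z [^] j"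
        and m': "w' \<in> carrier G" "m' \<ge> 1" "w' [^] m' = z [^] j'" by (auto simp: Z_def)
      have "(w \<otimes> w') [^] (m * m') = w [^] (m * m') \<otimes> w' [^] (m' * m)"
        using pow_mult_distrib[OF Zcomm[OF w m'(1)]] m m' by (simp add: mult.commute)
      also have "\<dots> = (w [^] m) [^] m' \<otimes> (w' [^] m') [^] m" using m(1) m'(1) by (simp only: nat_pow_pow)
      also have "\<dots> = z [^] (j * int m' + j' * int m)"
        unfolding m(3) m'(3) by (simp add: int_pow_mult flip: int_pow_int int_pow_pow)
      finally show "w \<otimes> w' \<in> Z" by (rule ZI) (use m m' in auto)
    qed
    have "w = \<one>" if w: "w \<in> K" "w \<in> Z" for w
    proof -
      obtain m :: nat and j :: int where m: "w \<in> carrier G" "m \<ge> 1" "w [^] m = z [^] j" using w by (auto simp: Z_def)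
      have wm: "w [^] m \<in> K" by (induction m) (use w in auto)
      have "z [^] (nat \<bar>j\<bar>) \<in> K"
      proof (cases "j \<ge> 0")
        case True
        then show ?thesis using wm m by (simp flip: int_pow_int)
      next
        case False
        then show ?thesis using K.m_inv_closed[OF wm] m by (simp add: int_pow_neg flip: int_pow_int)
      qed
      then have "\<not> nat \<bar>j\<bar> \<ge> 1" using zK by blast
      then have "j = 0" by linarith
      then show ?thesis using m pow_eq_one by simp
    qed
    then show "K \<inter> Z = {\<one>}" using subgroup.one_closed[OF sZ] K.one_closed by blast
  next
    fix x y assume "x \<in> K" "y \<in> Z"
    then show "x \<otimes> y = y \<otimes> x" using Zcomm by simp
  next
    fix x assume x: "x \<in> carrier G"
    show "\<exists>k\<in>K. \<exists>l\<in>Z. x = k \<otimes> l"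
    proof (cases "x \<in> K")
      case True
      moreover have "\<one> \<in> Z" by (rule ZI[of _ 1 0]) simp_all
      moreover have "x = x \<otimes> \<one>" using x by simp
      ultimately show ?thesis by blast
    next
      case False
      \<comment> \<open>By maximality of \<open>K\<close>, adjoining \<open>x\<close> and isolating
        must capture a power of \<open>z\<close>. This expresses a power of \<open>x\<close> through
        \<open>K\<close> and \<open>z\<close>.\<close>
      let ?J = "generate G (insert x K)"
      have J: "subgroup ?J G" by (rule generate_is_subgroup) (use x in auto)
      have iJ: "isolated G (isolator ?J)" by (rule isolator_isolated[OF nil J])
      have "insert x K \<subseteq> ?J" by (auto intro: generate.incl)
      then have sub: "insert x K \<subseteq> isolator ?J" using subset_isolator[OF subgroup.subset[OF J]] by blast
      then have "K \<subset> isolator ?J" using False by blast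
      then have "\<not> P (isolator ?J)" using max by blast
      then obtain m :: nat where m: "m \<ge> 1" "z [^] m \<in> isolator ?J"
        using iJ sub kerK unfolding P_def by blast
      then obtain l :: nat where l: "l \<ge> 1" "(z [^] m) [^] l \<in> ?J" by (auto simp: isolator_def)
      then have "z [^] (m * l) \<in> ?J" by (simp add: nat_pow_pow)
      then obtain j :: int where j: "z [^] (m * l) \<otimes> x [^] j \<in> K"
        using generate_cyclic_extension[OF nK x] by blast
      define k where "k = z [^] (m * l) \<otimes> x [^] j"
      have kK: "k \<in> K" using j by (simp add: k_def)
      have xj: "x [^] j = z [^] (- int (m * l)) \<otimes> k"
        using x by (simp add: k_def int_pow_neg inv_cancel_left flip: int_pow_int)
      have "m * l \<ge> 1" using m l by simp
      \<comment> \<open>With \<open>j = 0\<close> a power of \<open>z\<close> would lie in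
        \<open>K\<close>.\<close>
      then have j0: "j \<noteq> 0" using zK j by fastforce
      define e where "e = nat \<bar>j\<bar>"
      have e: "e \<ge> 1" using j0 by (simp add: e_def)
      obtain i :: int and k' where k': "k' \<in> K" and xe: "x [^] e = k' \<otimes> z [^] i"
      proof (cases "j \<ge> 0")
        case True
        then have "x [^] e = x [^] j" by (simp add: e_def flip: int_pow_int)
        also have "\<dots> = k \<otimes> z [^] (- int (m * l))" unfolding xj using zpow(2) kK by simp
        finally show thesis using that kK by blast
      next
        case False
        then have "x [^] e = inv (x [^] j)" using x by (simp add: e_def int_pow_neg flip: int_pow_int)
        also have "\<dots> = inv k \<otimes> z [^] (int (m * l))" unfolding xj using kK by (simp add: inv_mult_group int_pow_neg)
        finally show thesis using that kK by blast
      qed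
      \<comment> \<open>Both factors of \<open>x [^] e\<close> have \<open>e\<close>-th roots, the
        first in \<open>K\<close> by isolation and the second in \<open>Z\<close>. These roots
        commute, so their product has the same \<open>e\<close>-th power as
        \<open>x\<close>.\<close>
      obtain r where r: "r \<in> carrier G" "r [^] e = k'" using root_exists[OF _ e] k' by (metis K.mem_carrier)
      have rK: "r \<in> K" using isolatedD[OF iK _ r(1) e] r k' by simp
      obtain w where w: "w \<in> carrier G" "w [^] e = z [^] i" using root_exists[OF _ e, of "z [^] i"] by auto
      have wZ: "w \<in> Z" by (rule ZI[OF w(2,1) e])
      have "(r \<otimes> w) [^] e = x [^] e"
        using pow_mult_distrib[OF Zcomm[OF wZ r(1), symmetric] r(1) w(1)] r w xe by simp
      then have "x = r \<otimes> w" using root_unique[of "r \<otimes> w" x e] x r w e by simp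
      then show ?thesis using rK wZ by blast
    qed
  qed
  then show False
  proof
    assume "Z = {\<one>}"
    then have "z = \<one>" using Zz by blast
    then show False using fz by simp
  next
    assume K1: "K = {\<one>}"
    have "comm_group G"
    proof (rule group_comm_groupI)
      fix x y assume xy: "x \<in> carrier G" "y \<in> carrier G"
      then have "comtr x y = \<one>" using comtrK K1 by blast
      then show "x \<otimes> y = y \<otimes> x" using comtr_eq_one_iff xy by simp
    qed
    then show False using nonab by blast
  qed
qed

end

section \<open>Malcev completions of products and homomorphisms\<close>

lemma (in group) nilpotent_groupI:
  "lower_central G c \<subseteq> {\<one>} \<Longrightarrow> nilpotent_group G"
  using subgroup.one_closed[OF normal_imp_subgroup[OF lower_central_normal[of c]]] group_axioms
  unfolding nilpotent_group_def by blast

lemma nilpotent_group_bound: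
  "nilpotent_group G \<Longrightarrow> \<exists>c. \<forall>n\<ge>c. lower_central G n \<subseteq> {\<one>\<^bsub>G\<^esub>}"
  using group.lower_central_antimono unfolding nilpotent_group_def by metis

lemma nilpotent_DirProd:
  assumes G: "nilpotent_group G" and H: "nilpotent_group H"
  shows "nilpotent_group (G \<times>\<times> H)"
proof -
  have gG: "group G" and gH: "group H" using assms by (auto simp: nilpotent_group_def)
  interpret D: group "G \<times>\<times> H" by (rule DirProd_group[OF gG gH])
  obtain c where c: "\<forall>n\<ge>c. lower_central G n \<subseteq> {\<one>\<^bsub>G\<^esub>}"
    using nilpotent_group_bound[OF G] ..
  obtain d where d: "\<forall>n\<ge>d. lower_central H n \<subseteq> {\<one>\<^bsub>H\<^esub>}"
    using nilpotent_group_bound[OF H] ..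
  have f: "group_hom (G \<times>\<times> H) G fst"
    by (intro group_hom.intro group_hom_axioms.intro D.group_axioms gG) (auto simp: hom_def)
  have s: "group_hom (G \<times>\<times> H) H snd"
    by (intro group_hom.intro group_hom_axioms.intro D.group_axioms gH) (auto simp: hom_def)
  have "lower_central (G \<times>\<times> H) (c + d) \<subseteq> {\<one>\<^bsub>G \<times>\<times> H\<^esub>}"
  proof
    fix x assume "x \<in> lower_central (G \<times>\<times> H) (c + d)"
    then have "fst x \<in> lower_central G (c + d)" "snd x \<in> lower_central H (c + d)"
      using group_hom.lower_central_hom[OF f] group_hom.lower_central_hom[OF s] by auto
    then show "x \<in> {\<one>\<^bsub>G \<times>\<times> H\<^esub>}" using spec[OF c, of "c + d"] spec[OF d, of "c + d"] by (cases x) auto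
  qed
  then show ?thesis by (rule D.nilpotent_groupI)
qed

lemma pow_DirProd:
  "(x, y) [^]\<^bsub>G \<times>\<times> H\<^esub> (n::nat) = (x [^]\<^bsub>G\<^esub> n, y [^]\<^bsub>H\<^esub> n)"
  by (induction n) auto

lemma pow_product_group:
  "f \<in> extensional I \<Longrightarrow> f [^]\<^bsub>product_group I G\<^esub> (n::nat) = (\<lambda>i\<in>I. f i [^]\<^bsub>G i\<^esub> n)"
  by (induction n) (auto simp: fun_eq_iff)

lemma hom_projection:
  "i \<in> I \<Longrightarrow> (\<lambda>f. f i) \<in> hom (product_group I G) (G i)"
  by (auto simp: hom_def)

lemma nilpotent_product_group:
  assumes I: "finite I" and G: "\<And>i. i \<in> I \<Longrightarrow> nilpotent_group (G i)"
  shows "nilpotent_group (product_group I G)"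
proof -
  have g: "group (G i)" if "i \<in> I" for i using G[OF that] by (simp add: nilpotent_group_def)
  interpret P: group "product_group I G" using g by simp
  obtain c where c: "\<And>i n. i \<in> I \<Longrightarrow> n \<ge> c i \<Longrightarrow> lower_central (G i) n \<subseteq> {\<one>\<^bsub>G i\<^esub>}"
    using nilpotent_group_bound[OF G] by metis
  let ?n = "sum c I"
  have "lower_central (product_group I G) ?n \<subseteq> {\<one>\<^bsub>product_group I G\<^esub>}"
  proof
    fix f assume f: "f \<in> lower_central (product_group I G) ?n"
    have "f i = \<one>\<^bsub>G i\<^esub>" if i: "i \<in> I" for i
    proof -
      have "group_hom (product_group I G) (G i) (\<lambda>f. f i)"
        by (intro group_hom.intro group_hom_axioms.intro P.group_axioms g[OF i] hom_projection[OF i])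
      from group_hom.lower_central_hom[OF this f] show ?thesis
        using c[OF i, of ?n] member_le_sum[of i I c] I i by auto
    qed
    moreover have "f \<in> carrier (product_group I G)" using P.lower_central_subset f by blast
    ultimately show "f \<in> {\<one>\<^bsub>product_group I G\<^esub>}" by (auto simp: fun_eq_iff PiE_iff extensional_def)
  qed
  then show ?thesis by (rule P.nilpotent_groupI)
qed

text \<open>Roots are formed coordinatewise. To bring all coordinates into the groups
  \<open>N i\<close> one needs a common exponent, and since \<open>I\<close> is finite the product
  of the individual exponents will do.\<close>

lemma malcev_completion_product_group:
  assumes I: "finite I" and gN: "\<And>i. i \<in> I \<Longrightarrow> group (N i)"
    and M: "\<And>i. i \<in> I \<Longrightarrow> malcev_completion (N i) (M i) (\<iota> i)"
  shows "malcev_completion (product_group I N) (product_group I M) (\<lambda>f. \<lambda>i\<in>I. \<iota> i (f i))"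
proof -
  have nil: "nilpotent_group (M i)" and \<iota>: "\<iota> i \<in> mon (N i) (M i)"
    and pow: "\<And>x. x \<in> carrier (M i) \<Longrightarrow> \<exists>m::nat. m \<ge> 1 \<and> x [^]\<^bsub>M i\<^esub> m \<in> \<iota> i ` carrier (N i)"
    if "i \<in> I" for i using M[OF that] by (auto simp: malcev_completion_def)
  have gM: "group (M i)" if "i \<in> I" for i using nil[OF that] by (simp add: nilpotent_group_def)
  have rM: "rational_group (M i)" if "i \<in> I" for i using malcev_rational_group[OF M[OF that]] .
  have h\<iota>: "group_hom (N i) (M i) (\<iota> i)" if "i \<in> I" for i
    using \<iota>[OF that] gN[OF that] gM[OF that] by (auto simp: mon_def intro!: group_hom.intro group_hom_axioms.intro)
  note cl = group_hom.hom_closed[OF h\<iota>]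
  show ?thesis unfolding malcev_completion_def
  proof (intro conjI ballI allI impI)
    show "nilpotent_group (product_group I M)" by (rule nilpotent_product_group[OF I nil])
    show "torsion_free (product_group I M)" unfolding torsion_free_def
    proof (intro ballI allI impI; elim conjE)
      fix f and m :: nat
      assume f: "f \<in> carrier (product_group I M)" and m: "1 \<le> m"
        and eq: "f [^]\<^bsub>product_group I M\<^esub> m = \<one>\<^bsub>product_group I M\<^esub>"
      have ext: "f \<in> extensional I" using f by (simp add: PiE_iff)
      have "f i = \<one>\<^bsub>M i\<^esub>" if i: "i \<in> I" for i
      proof -
        have "f i [^]\<^bsub>M i\<^esub> m = \<one>\<^bsub>M i\<^esub>"
          using fun_cong[OF eq, of i] i by (simp add: pow_product_group[OF ext])
        then show ?thesis using rational_group.pow_eq_one[OF rM[OF i] _ m] f i by (auto simp: PiE_iff)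
      qed
      then show "f = \<one>\<^bsub>product_group I M\<^esub>" using ext by (auto simp: fun_eq_iff extensional_def)
    qed
    show "(\<lambda>f. \<lambda>i\<in>I. \<iota> i (f i)) \<in> mon (product_group I N) (product_group I M)"
      unfolding mon_def
    proof (intro CollectI conjI homI)
      fix f assume "f \<in> carrier (product_group I N)"
      then show "(\<lambda>i\<in>I. \<iota> i (f i)) \<in> carrier (product_group I M)" using cl by (auto simp: PiE_iff)
    next
      fix f g assume "f \<in> carrier (product_group I N)" "g \<in> carrier (product_group I N)"
      then show "(\<lambda>i\<in>I. \<iota> i ((f \<otimes>\<^bsub>product_group I N\<^esub> g) i)) =
        (\<lambda>i\<in>I. \<iota> i (f i)) \<otimes>\<^bsub>product_group I M\<^esub> (\<lambda>i\<in>I. \<iota> i (g i))"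
        using group_hom.hom_mult[OF h\<iota>] by (auto simp: fun_eq_iff PiE_iff)
    next
      show "inj_on (\<lambda>f. \<lambda>i\<in>I. \<iota> i (f i)) (carrier (product_group I N))"
      proof (rule inj_onI)
        fix f g assume f: "f \<in> carrier (product_group I N)" and g: "g \<in> carrier (product_group I N)"
          and eq: "(\<lambda>i\<in>I. \<iota> i (f i)) = (\<lambda>i\<in>I. \<iota> i (g i))"
        have "f i = g i" if i: "i \<in> I" for i
        proof -
          have "inj_on (\<iota> i) (carrier (N i))" using \<iota>[OF i] by (simp add: mon_def)
          then show ?thesis using fun_cong[OF eq, of i] i f g by (auto simp: PiE_iff dest: inj_onD)
        qed
        then show "f = g" using f g by (auto simp: PiE_iff intro: extensionalityI)
      qed
    qed
  next
    fix f and m :: nat assume f: "f \<in> carrier (product_group I N)" and m: "1 \<le> m"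
    have "\<exists>x. x \<in> carrier (M i) \<and> x [^]\<^bsub>M i\<^esub> m = \<iota> i (f i)" if i: "i \<in> I" for i
      using rational_group.root_exists[OF rM[OF i] cl[OF i] m, of "f i"] f i by (auto simp: PiE_iff)
    then obtain r where r: "\<And>i. i \<in> I \<Longrightarrow> r i \<in> carrier (M i) \<and> r i [^]\<^bsub>M i\<^esub> m = \<iota> i (f i)" by metis
    show "\<exists>!x. x \<in> carrier (product_group I M) \<and> x [^]\<^bsub>product_group I M\<^esub> m = (\<lambda>i\<in>I. \<iota> i (f i))"
    proof (rule ex1I[of _ "restrict r I"])
      show "restrict r I \<in> carrier (product_group I M) \<and>
        restrict r I [^]\<^bsub>product_group I M\<^esub> m = (\<lambda>i\<in>I. \<iota> i (f i))"
        using r by (auto simp: pow_product_group fun_eq_iff)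
    next
      fix g assume g: "g \<in> carrier (product_group I M) \<and> g [^]\<^bsub>product_group I M\<^esub> m = (\<lambda>i\<in>I. \<iota> i (f i))"
      then have ext: "g \<in> extensional I" and gc: "\<And>i. i \<in> I \<Longrightarrow> g i \<in> carrier (M i)" by (auto simp: PiE_iff)
      have "g i = r i" if i: "i \<in> I" for i
      proof -
        have "(\<lambda>i\<in>I. g i [^]\<^bsub>M i\<^esub> m) = (\<lambda>i\<in>I. \<iota> i (f i))" using g pow_product_group[OF ext] by metis
        from fun_cong[OF this, of i] show ?thesis
          using rational_group.root_unique[OF rM[OF i] gc[OF i] _ m] r[OF i] i by auto
      qed
      then show "g = restrict r I" using ext by (auto intro: extensionalityI)
    qed
  next
    fix f assume f: "f \<in> carrier (product_group I M)"
    have "\<exists>m n. (m::nat) \<ge> 1 \<and> n \<in> carrier (N i) \<and> f i [^]\<^bsub>M i\<^esub> m = \<iota> i n" if i: "i \<in> I" for i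
      using pow[OF i, of "f i"] f i by (auto simp: PiE_iff)
    then obtain m :: "'a \<Rightarrow> nat" and n where mn: "\<And>i. i \<in> I \<Longrightarrow> m i \<ge> 1 \<and> n i \<in> carrier (N i) \<and> f i [^]\<^bsub>M i\<^esub> m i = \<iota> i (n i)"
      by metis
    let ?m = "prod m I"
    \<comment> \<open>Coordinate \<open>i\<close> is in the image of \<open>N i\<close> after the
      exponent \<open>m i\<close>; the remaining factor of the common exponent is applied inside
      \<open>N i\<close>.\<close>
    define g where "g = (\<lambda>i\<in>I. n i [^]\<^bsub>N i\<^esub> prod m (I - {i}))"
    have "f i [^]\<^bsub>M i\<^esub> ?m = \<iota> i (g i)" if i: "i \<in> I" for i
    proof -
      interpret Mi: group "M i" by (rule gM[OF i])
      have "f i [^]\<^bsub>M i\<^esub> ?m = (f i [^]\<^bsub>M i\<^esub> m i) [^]\<^bsub>M i\<^esub> prod m (I - {i})"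
        using f i prod.remove[OF I i, of m] by (auto simp: Mi.nat_pow_pow PiE_iff)
      then show ?thesis using mn[OF i] i by (simp add: g_def group_hom.hom_nat_pow[OF h\<iota>[OF i]])
    qed
    then have "f [^]\<^bsub>product_group I M\<^esub> ?m = (\<lambda>i\<in>I. \<iota> i (g i))"
      using f by (auto simp: pow_product_group PiE_iff fun_eq_iff)
    moreover have "g i \<in> carrier (N i)" if i: "i \<in> I" for i
    proof -
      interpret Ni: group "N i" by (rule gN[OF i])
      show ?thesis using mn[OF i] i by (simp add: g_def)
    qed
    then have "g \<in> carrier (product_group I N)" by (simp add: g_def PiE_iff)
    moreover have "?m \<ge> 1" using mn by (simp add: Suc_le_eq prod_pos)
    ultimately show "\<exists>m::nat. m \<ge> 1 \<and> f [^]\<^bsub>product_group I M\<^esub> m \<in> (\<lambda>f. \<lambda>i\<in>I. \<iota> i (f i)) ` carrier (product_group I N)"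
      by blast
  qed
qed

section \<open>Extending homomorphisms to completions\<close>

text \<open>Every element of \<open>M\<close> has a power coming from \<open>N\<close>, and its
  image in \<open>A\<close> is determined by that power.\<close>

lemma malcev_hom_eq:
  assumes M: "malcev_completion N M \<iota>" and A: "rational_group A"
    and f: "f \<in> hom M A" and g: "g \<in> hom M A"
    and eq: "\<And>n. n \<in> carrier N \<Longrightarrow> f (\<iota> n) = g (\<iota> n)"
    and x: "x \<in> carrier M"
  shows "f x = g x"
proof -
  interpret M: rational_group M by (rule malcev_rational_group[OF M])
  interpret A: rational_group A by fact
  interpret f: group_hom M A f using f by unfold_locales
  interpret g: group_hom M A g using g by unfold_locales
  obtain m n where m: "(m::nat) \<ge> 1" "n \<in> carrier N" "x [^]\<^bsub>M\<^esub> m = \<iota> n"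
    using M x by (auto simp: malcev_completion_def)
  have "f x [^]\<^bsub>A\<^esub> m = g x [^]\<^bsub>A\<^esub> m"
    using eq[OF m(2)] m(3) x by (simp flip: f.hom_nat_pow g.hom_nat_pow)
  then show ?thesis using A.root_unique[OF _ _ m(1)] x by simp
qed

text \<open>The extension of \<open>f\<close> is the isolator of its graph.\<close>

lemma malcev_extension:
  assumes N: "group N" and N': "group N'"
    and M: "malcev_completion N M \<iota>" and M': "malcev_completion N' M' \<iota>'"
    and f: "f \<in> hom N N'"
  obtains F where "F \<in> hom M M'" "\<And>n. n \<in> carrier N \<Longrightarrow> F (\<iota> n) = \<iota>' (f n)"
proof -
  interpret N: group N by fact
  interpret N': group N' by fact
  interpret M: rational_group M by (rule malcev_rational_group[OF M])
  interpret M': rational_group M' by (rule malcev_rational_group[OF M'])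
  interpret f: group_hom N N' f using f by unfold_locales
  interpret \<iota>: group_hom N M \<iota> using M by unfold_locales (auto simp: malcev_completion_def mon_def)
  interpret \<iota>': group_hom N' M' \<iota>' using M' by unfold_locales (auto simp: malcev_completion_def mon_def)
  interpret D: group "M \<times>\<times> M'" by (rule DirProd_group[OF M.group_axioms M'.group_axioms])
  define \<Gamma> where "\<Gamma> = (\<lambda>n. (\<iota> n, \<iota>' (f n))) ` carrier N"
  have "(\<lambda>n. (\<iota> n, \<iota>' (f n))) \<in> hom N (M \<times>\<times> M')" by (auto simp: hom_def)
  then have "group_hom N (M \<times>\<times> M') (\<lambda>n. (\<iota> n, \<iota>' (f n)))" by unfold_locales
  then have \<Gamma>: "subgroup \<Gamma> (M \<times>\<times> M')" unfolding \<Gamma>_def by (rule group_hom.img_is_subgroup)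
  \<comment> \<open>Roots of graph elements form a subgroup because the product of the two
    completions is nilpotent. That \<open>R\<close> is again a graph is the content of
    \<open>ex1\<close>.\<close>
  define R where "R = D.isolator \<Gamma>"
  have "nilpotent_group (M \<times>\<times> M')"
    using M M' by (intro nilpotent_DirProd) (auto simp: malcev_completion_def)
  then have R: "subgroup R (M \<times>\<times> M')"
    unfolding R_def by (intro isolated_imp_subgroup D.isolator_isolated \<Gamma>)
  interpret R: subgroup R "M \<times>\<times> M'" by fact
  have RD: "x \<in> carrier M" "y \<in> carrier M'" if "(x, y) \<in> R" for x y using R.subset that by auto
  have Rmult: "(x \<otimes>\<^bsub>M\<^esub> x', y \<otimes>\<^bsub>M'\<^esub> y') \<in> R" if "(x, y) \<in> R" "(x', y') \<in> R" for x x' y y'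
    using R.m_closed[OF that] by simp
  have R\<iota>: "(\<iota> n, \<iota>' (f n)) \<in> R" if "n \<in> carrier N" for n
    unfolding R_def using D.subset_isolator[OF subgroup.subset[OF \<Gamma>]] that by (auto simp: \<Gamma>_def)
  have ex1: "\<exists>!y. (x, y) \<in> R" if x: "x \<in> carrier M" for x
  proof (rule ex_ex1I)
    obtain m n where m: "(m::nat) \<ge> 1" "n \<in> carrier N" "x [^]\<^bsub>M\<^esub> m = \<iota> n"
      using M x by (auto simp: malcev_completion_def)
    obtain y where y: "y \<in> carrier M'" "y [^]\<^bsub>M'\<^esub> m = \<iota>' (f n)"
      using M'.root_exists[OF _ m(1), of "\<iota>' (f n)"] m by auto
    have "(x, y) [^]\<^bsub>M \<times>\<times> M'\<^esub> m \<in> \<Gamma>" using m y by (auto simp: pow_DirProd \<Gamma>_def)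
    then have "(x, y) \<in> R" unfolding R_def by (rule D.isolatorI) (use x y m in auto)
    then show "\<exists>y. (x, y) \<in> R" by blast
  next
    \<comment> \<open>The quotient of the two pairs has first coordinate 1, and some power of it
      lies on the graph over an \<open>n\<close> with trivial image. Injectivity of \<iota> gives
      \<open>n\<close> trivial, and \<open>M'\<close> has no torsion.\<close>
    fix y y' assume xy: "(x, y) \<in> R" and xy': "(x, y') \<in> R"
    have "(inv\<^bsub>M\<^esub> x, inv\<^bsub>M'\<^esub> y') \<in> R"
      using R.m_inv_closed[OF xy'] inv_DirProd[OF M.group_axioms M'.group_axioms RD[OF xy']] by simp
    from Rmult[OF xy this] have "(\<one>\<^bsub>M\<^esub>, y \<otimes>\<^bsub>M'\<^esub> inv\<^bsub>M'\<^esub> y') \<in> R" using x by simp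
    then obtain m :: nat where m: "m \<ge> 1" "(\<one>\<^bsub>M\<^esub>, y \<otimes>\<^bsub>M'\<^esub> inv\<^bsub>M'\<^esub> y') [^]\<^bsub>M \<times>\<times> M'\<^esub> m \<in> \<Gamma>"
      unfolding R_def D.isolator_def by blast
    then obtain n where n: "n \<in> carrier N" "\<iota> n = \<one>\<^bsub>M\<^esub>" "(y \<otimes>\<^bsub>M'\<^esub> inv\<^bsub>M'\<^esub> y') [^]\<^bsub>M'\<^esub> m = \<iota>' (f n)"
      by (auto simp: pow_DirProd \<Gamma>_def)
    have "inj_on \<iota> (carrier N)" using M by (auto simp: malcev_completion_def mon_def)
    from inj_onD[OF this, of n "\<one>\<^bsub>N\<^esub>"] have "n = \<one>\<^bsub>N\<^esub>" using n(1,2) by simp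
    then have "y \<otimes>\<^bsub>M'\<^esub> inv\<^bsub>M'\<^esub> y' = \<one>\<^bsub>M'\<^esub>"
      using M'.pow_eq_one[OF _ m(1)] n(3) RD(2)[OF xy] RD(2)[OF xy'] by simp
    then have "y \<otimes>\<^bsub>M'\<^esub> inv\<^bsub>M'\<^esub> y' \<otimes>\<^bsub>M'\<^esub> y' = y'" using RD[OF xy'] by simp
    then show "y = y'" using RD[OF xy] RD[OF xy'] by (simp add: M'.m_assoc)
  qed
  define F where "F = (\<lambda>x. THE y. (x, y) \<in> R)"
  have FR: "(x, F x) \<in> R" if "x \<in> carrier M" for x
    unfolding F_def by (rule theI'[OF ex1[OF that]])
  have FI: "F x = y" if "(x, y) \<in> R" for x y
    unfolding F_def by (rule the1_equality[OF ex1[OF RD(1)[OF that]] that])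
  show thesis
  proof
    show "F \<in> hom M M'"
      by (rule homI) (rule RD(2)[OF FR] FI[OF Rmult[OF FR FR]], assumption+)+
    show "F (\<iota> n) = \<iota>' (f n)" if "n \<in> carrier N" for n by (rule FI[OF R\<iota>[OF that]])
  qed
qed

text \<open>The extensions of \<open>f\<close> and of its inverse are mutually inverse, since their
  composites agree with the identity on elements coming from \<open>N\<close> or
  \<open>N'\<close>.\<close>

lemma malcev_extension_iso:
  assumes N: "group N" and N': "group N'"
    and M: "malcev_completion N M \<iota>" and M': "malcev_completion N' M' \<iota>'"
    and f: "f \<in> iso N N'"
  obtains F where "F \<in> iso M M'" "\<And>n. n \<in> carrier N \<Longrightarrow> F (\<iota> n) = \<iota>' (f n)"
proof -
  interpret N: group N by fact
  have rM: "rational_group M" and rM': "rational_group M'" using M M' malcev_rational_group by blast+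
  define g where "g = inv_into (carrier N) f"
  have g: "g \<in> iso N' N" unfolding g_def by (rule N.iso_set_sym[OF f])
  have bij: "bij_betw f (carrier N) (carrier N')" using f by (simp add: iso_def)
  have gf: "g (f x) = x" if "x \<in> carrier N" for x
    unfolding g_def using bij_betw_inv_into_left[OF bij that] .
  have fg: "f (g y) = y" if "y \<in> carrier N'" for y
    unfolding g_def using bij_betw_inv_into_right[OF bij that] .
  have fc: "f x \<in> carrier N'" if "x \<in> carrier N" for x using f that by (auto simp: iso_def hom_def)
  have gc: "g x \<in> carrier N" if "x \<in> carrier N'" for x using g that by (auto simp: iso_def hom_def)
  obtain F where F: "F \<in> hom M M'" "\<And>n. n \<in> carrier N \<Longrightarrow> F (\<iota> n) = \<iota>' (f n)"
    using malcev_extension[OF N N' M M'] f by (auto simp: iso_def)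
  obtain H where H: "H \<in> hom M' M" "\<And>n. n \<in> carrier N' \<Longrightarrow> H (\<iota>' n) = \<iota> (g n)"
    using malcev_extension[OF N' N M' M] g by (auto simp: iso_def)
  have "(H \<circ> F) x = id x" if "x \<in> carrier M" for x
    by (rule malcev_hom_eq[OF M rM hom_compose[OF F(1) H(1)] iso_imp_homomorphism[OF id_iso] _ that])
      (simp add: F(2) H(2) gf fc)
  moreover have "(F \<circ> H) x = id x" if "x \<in> carrier M'" for x
    by (rule malcev_hom_eq[OF M' rM' hom_compose[OF H(1) F(1)] iso_imp_homomorphism[OF id_iso] _ that])
      (simp add: F(2) H(2) fg gc)
  ultimately have "bij_betw F (carrier M) (carrier M')"
    by (intro bij_betwI[where g = H]) (use F(1) H(1) in \<open>auto simp: hom_def\<close>)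
  then show thesis using that F by (auto simp: iso_def)
qed

section \<open>Automorphisms of direct products\<close>

lemma (in group) subgroup_centre: "subgroup (centre G) G"
proof (rule subgroupI)
  show "centre G \<noteq> {}" by (auto simp: centre_def intro!: exI[of _ \<one>])
next
  fix a assume a: "a \<in> centre G"
  then have ac: "a \<in> carrier G" "\<And>x. x \<in> carrier G \<Longrightarrow> a \<otimes> x = x \<otimes> a" by (auto simp: centre_def)
  have "inv a \<otimes> x = x \<otimes> inv a" if x: "x \<in> carrier G" for x
  proof -
    have "inv a \<otimes> x = inv a \<otimes> (x \<otimes> a) \<otimes> inv a" using x ac(1) by (simp add: m_assoc)
    also have "\<dots> = x \<otimes> inv a" unfolding ac(2)[OF x, symmetric] using x ac(1) by (simp add: inv_cancel_left)
    finally show ?thesis .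
  qed
  then show "inv a \<in> centre G" using ac(1) by (simp add: centre_def)
next
  fix a b assume "a \<in> centre G" "b \<in> centre G"
  then have ac: "a \<in> carrier G" "\<And>x. x \<in> carrier G \<Longrightarrow> a \<otimes> x = x \<otimes> a"
    and bc: "b \<in> carrier G" "\<And>x. x \<in> carrier G \<Longrightarrow> b \<otimes> x = x \<otimes> b" by (auto simp: centre_def)
  have "a \<otimes> b \<otimes> x = x \<otimes> (a \<otimes> b)" if x: "x \<in> carrier G" for x
  proof -
    have "a \<otimes> b \<otimes> x = a \<otimes> x \<otimes> b" using ac(1) bc x by (simp add: m_assoc)
    then show ?thesis using ac(2)[OF x] ac(1) bc(1) x by (simp add: m_assoc)
  qed
  then show "a \<otimes> b \<in> centre G" using ac(1) bc(1) by (simp add: centre_def)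
qed (auto simp: centre_def)

text \<open>In the deepest term of the lower central series that \<open>K\<close> meets
  nontrivially, choose \<open>z\<close> in \<open>K\<close>. Its commutators lie in \<open>K\<close>
  and in the next term, hence are trivial.\<close>

lemma (in group) normal_meets_centre:
  assumes nil: "nilpotent_group G" and K: "K \<lhd> G" and x: "x \<in> K" "x \<noteq> \<one>"
  obtains z where "z \<in> K" "z \<in> centre G" "z \<noteq> \<one>"
proof -
  interpret K: normal K G by fact
  define n where "n = (LEAST n. K \<inter> lower_central G n \<subseteq> {\<one>})"
  obtain c where "lower_central G c = {\<one>}" using nil by (auto simp: nilpotent_group_def)
  then have "K \<inter> lower_central G c \<subseteq> {\<one>}" by blast
  then have n: "K \<inter> lower_central G n \<subseteq> {\<one>}" unfolding n_def by (rule LeastI)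
  have "n \<noteq> 0" using n x K.subset by auto
  then obtain m where m: "n = Suc m" by (cases n) auto
  then have "\<not> K \<inter> lower_central G m \<subseteq> {\<one>}"
    using not_less_Least[of m "\<lambda>n. K \<inter> lower_central G n \<subseteq> {\<one>}"] by (simp add: n_def)
  then obtain z where z: "z \<in> K" "z \<in> lower_central G m" "z \<noteq> \<one>" by blast
  have zc: "z \<in> carrier G" using z by simp
  have "z \<otimes> y = y \<otimes> z" if y: "y \<in> carrier G" for y
  proof -
    have "y \<otimes> inv z \<otimes> inv y \<in> K" by (rule K.inv_op_closed2) (use y z in auto)
    then have "z \<otimes> (y \<otimes> inv z \<otimes> inv y) \<in> K" using z by simp
    then have "comtr z y \<in> K" using y zc by (simp add: comtr_def m_assoc)
    moreover have "comtr z y \<in> lower_central G n" unfolding m by (rule comtr_lower_central[OF z(2) y])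
    ultimately have "comtr z y = \<one>" using n by blast
    then show ?thesis using comtr_eq_one_iff[OF zc y] by simp
  qed
  then show thesis using that z zc by (simp add: centre_def)
qed

section \<open>Coordinates in a finite product\<close>

locale finite_group_family =
  fixes I :: "'i set" and G :: "'i \<Rightarrow> ('a, 'm) monoid_scheme"
  assumes fin: "finite I" and groups: "i \<in> I \<Longrightarrow> group (G i)"
begin

abbreviation P where "P \<equiv> product_group I G"
abbreviation e where "e \<equiv> canonical_inclusion I G"

text \<open>Plays the role of a partial sum over \<open>J\<close>. Since \<open>P\<close> is not
  commutative, \<open>restr_insert\<close> adds one coordinate at a time in place of a product over
  a set.\<close>

definition restr :: "'i set \<Rightarrow> ('i \<Rightarrow> 'a) \<Rightarrow> 'i \<Rightarrow> 'a" where
  "restr J w = (\<lambda>l\<in>I. if l \<in> J then w l else \<one>\<^bsub>G l\<^esub>)"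

sublocale P: group P using groups by simp

lemma one_in: "i \<in> I \<Longrightarrow> \<one>\<^bsub>G i\<^esub> \<in> carrier (G i)"
  and mult_one: "i \<in> I \<Longrightarrow> x \<in> carrier (G i) \<Longrightarrow> x \<otimes>\<^bsub>G i\<^esub> \<one>\<^bsub>G i\<^esub> = x"
  and one_mult: "i \<in> I \<Longrightarrow> x \<in> carrier (G i) \<Longrightarrow> \<one>\<^bsub>G i\<^esub> \<otimes>\<^bsub>G i\<^esub> x = x"
  using groups by (simp_all add: group.is_monoid monoid.one_closed)

lemma carrier_P_nth: "w \<in> carrier P \<Longrightarrow> i \<in> I \<Longrightarrow> w i \<in> carrier (G i)"
  by (auto simp: PiE_iff)

lemma P_eqI: "w \<in> carrier P \<Longrightarrow> v \<in> carrier P \<Longrightarrow> (\<And>i. i \<in> I \<Longrightarrow> w i = v i) \<Longrightarrow> w = v"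
  by (auto simp: PiE_iff intro: extensionalityI)

lemma e_hom: "j \<in> I \<Longrightarrow> e j \<in> hom (G j) P"
  by (rule homI) (auto simp: canonical_inclusion_def fun_eq_iff one_in mult_one)

lemma e_closed [simp]: "j \<in> I \<Longrightarrow> x \<in> carrier (G j) \<Longrightarrow> e j x \<in> carrier P"
  by (rule hom_in_carrier[OF e_hom])

lemma e_nth: "i \<in> I \<Longrightarrow> e j x i = (if i = j then x else \<one>\<^bsub>G i\<^esub>)"
  by (simp add: canonical_inclusion_def)

lemma restr_hom: "restr J \<in> hom P P"
  by (rule homI) (auto simp: restr_def fun_eq_iff one_in mult_one PiE_iff)

lemma restr_closed [simp]: "w \<in> carrier P \<Longrightarrow> restr J w \<in> carrier P"
  by (rule hom_in_carrier[OF restr_hom])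

lemma restr_empty: "restr {} w = \<one>\<^bsub>P\<^esub>"
  by (simp add: restr_def)

lemma restr_all: "w \<in> carrier P \<Longrightarrow> restr I w = w"
  by (auto simp: restr_def fun_eq_iff PiE_iff extensional_def)

lemma restr_insert:
  "w \<in> carrier P \<Longrightarrow> j \<in> I \<Longrightarrow> j \<notin> J \<Longrightarrow> restr (insert j J) w = restr J w \<otimes>\<^bsub>P\<^esub> e j (w j)"
  by (auto simp: restr_def canonical_inclusion_def fun_eq_iff one_in mult_one one_mult PiE_iff)

lemma restr_commute:
  "w \<in> carrier P \<Longrightarrow> j \<in> I \<Longrightarrow> j \<notin> J \<Longrightarrow> x \<in> carrier (G j) \<Longrightarrow>
   restr J w \<otimes>\<^bsub>P\<^esub> e j x = e j x \<otimes>\<^bsub>P\<^esub> restr J w"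
  by (auto simp: restr_def canonical_inclusion_def fun_eq_iff one_in mult_one one_mult PiE_iff)

lemma restr_singleton: "restr {j} (e j x) = e j x"
  by (auto simp: restr_def canonical_inclusion_def)

end

section \<open>Matrix entries of an automorphism\<close>

locale product_automorphism = finite_group_family I G
  for I :: "'i set" and G :: "'i \<Rightarrow> ('a, 'm) monoid_scheme" +
  fixes \<phi> :: "('i \<Rightarrow> 'a) \<Rightarrow> 'i \<Rightarrow> 'a"
  assumes \<phi>: "\<phi> \<in> iso (product_group I G) (product_group I G)"
begin

abbreviation entry where "entry \<equiv> matrix_entry I G \<phi>"

definition \<psi> where "\<psi> = inv_into (carrier P) \<phi>"

lemma \<phi>_hom: "\<phi> \<in> hom P P" and \<phi>_bij: "bij_betw \<phi> (carrier P) (carrier P)"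
  using \<phi> by (auto simp: iso_def)

lemma \<psi>_hom: "\<psi> \<in> hom P P"
  using P.iso_set_sym[OF \<phi>] by (simp add: \<psi>_def iso_def)

lemma \<phi>\<psi>: "w \<in> carrier P \<Longrightarrow> \<phi> (\<psi> w) = w"
  unfolding \<psi>_def by (rule bij_betw_inv_into_right[OF \<phi>_bij])

lemma \<phi>_closed [simp]: "w \<in> carrier P \<Longrightarrow> \<phi> w \<in> carrier P"
  and \<psi>_closed [simp]: "w \<in> carrier P \<Longrightarrow> \<psi> w \<in> carrier P"
  by (rule hom_in_carrier[OF \<phi>_hom], assumption) (rule hom_in_carrier[OF \<psi>_hom], assumption)

lemma \<phi>_inj: "w \<in> carrier P \<Longrightarrow> v \<in> carrier P \<Longrightarrow> \<phi> w = \<phi> v \<Longrightarrow> w = v"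
  using \<phi>_bij by (auto simp: bij_betw_def dest: inj_onD)

lemma \<phi>_nth_hom: "i \<in> I \<Longrightarrow> (\<lambda>w. \<phi> w i) \<in> hom P (G i)"
  using hom_compose[OF \<phi>_hom hom_projection[of i I G]] by (simp add: comp_def)

lemma \<phi>_nth_mult: "i \<in> I \<Longrightarrow> w \<in> carrier P \<Longrightarrow> v \<in> carrier P \<Longrightarrow>
   \<phi> (w \<otimes>\<^bsub>P\<^esub> v) i = \<phi> w i \<otimes>\<^bsub>G i\<^esub> \<phi> v i"
  by (rule hom_mult[OF \<phi>_nth_hom])

lemma entry_eq: "entry i j x = \<phi> (e j x) i"
  by (simp add: matrix_entry_def canonical_projection_def)

lemma entry_hom: "i \<in> I \<Longrightarrow> j \<in> I \<Longrightarrow> entry i j \<in> hom (G j) (G i)"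
  using hom_compose[OF e_hom \<phi>_nth_hom, of j i]
  by (simp add: matrix_entry_def canonical_projection_def comp_def)

lemma entry_closed: "i \<in> I \<Longrightarrow> j \<in> I \<Longrightarrow> x \<in> carrier (G j) \<Longrightarrow> entry i j x \<in> carrier (G i)"
  by (rule hom_in_carrier[OF entry_hom])

text \<open>Elements of \<open>P\<close> with disjoint supports commute, and so do the coordinates
  of their images.\<close>

lemma \<phi>_restr_commute:
  assumes "i \<in> I" "w \<in> carrier P" "j \<in> I" "j \<notin> J" "x \<in> carrier (G j)"
  shows "\<phi> (restr J w) i \<otimes>\<^bsub>G i\<^esub> entry i j x = entry i j x \<otimes>\<^bsub>G i\<^esub> \<phi> (restr J w) i"
  unfolding entry_eq using \<phi>_nth_mult[OF assms(1), of "restr J w" "e j x"]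
    \<phi>_nth_mult[OF assms(1), of "e j x" "restr J w"] restr_commute[OF assms(2-5)] assms
  by (simp del: mult_product_group carrier_product_group)

lemma entry_commute:
  assumes "i \<in> I" "j \<in> I" "l \<in> I" "j \<noteq> l" "x \<in> carrier (G j)" "y \<in> carrier (G l)"
  shows "entry i l y \<otimes>\<^bsub>G i\<^esub> entry i j x = entry i j x \<otimes>\<^bsub>G i\<^esub> entry i l y"
  using \<phi>_restr_commute[OF assms(1) e_closed[OF assms(3,6)] assms(2) _ assms(5), of "{l}"] assms(4)
  by (simp add: restr_singleton entry_eq)

text \<open>The coordinate is a product of the values \<open>entry i l (w l)\<close>. The lemma is
  applied to the trivial subgroup and to the centre.\<close>

lemma \<phi>_restr_in_subgroup:
  assumes i: "i \<in> I" and H: "subgroup H (G i)" and w: "w \<in> carrier P" and J: "J \<subseteq> I"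
    and "\<And>l. l \<in> J \<Longrightarrow> entry i l (w l) \<in> H"
  shows "\<phi> (restr J w) i \<in> H"
proof -
  have "finite J" using J fin by (rule finite_subset)
  then show ?thesis using J assms(5)
  proof (induction J)
    case empty
    have "group_hom P (G i) (\<lambda>w. \<phi> w i)"
      by (intro group_hom.intro group_hom_axioms.intro P.group_axioms groups i \<phi>_nth_hom)
    then have one: "\<phi> \<one>\<^bsub>P\<^esub> i = \<one>\<^bsub>G i\<^esub>" by (rule group_hom.hom_one)
    show ?case unfolding restr_empty one by (rule subgroup.one_closed[OF H])
  next
    case (insert j J)
    have j: "j \<in> I" using insert by simp
    have "\<phi> (restr (insert j J) w) i = \<phi> (restr J w) i \<otimes>\<^bsub>G i\<^esub> entry i j (w j)"
      unfolding restr_insert[OF w j insert.hyps(2)] entry_eq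
      by (rule \<phi>_nth_mult[OF i restr_closed[OF w] e_closed[OF j carrier_P_nth[OF w j]]])
    then show ?case using insert subgroup.m_closed[OF H] by auto
  qed
qed

lemma \<phi>_nth_split:
  assumes i: "i \<in> I" and j: "j \<in> I" and w: "w \<in> carrier P"
  shows "\<phi> w i = \<phi> (restr (I - {j}) w) i \<otimes>\<^bsub>G i\<^esub> entry i j (w j)"
proof -
  have "w = restr (I - {j}) w \<otimes>\<^bsub>P\<^esub> e j (w j)"
    using restr_insert[OF w j, of "I - {j}"] restr_all[OF w] insert_Diff[OF j] by simp
  then have "\<phi> w i = \<phi> (restr (I - {j}) w \<otimes>\<^bsub>P\<^esub> e j (w j)) i" by simp
  also have "\<dots> = \<phi> (restr (I - {j}) w) i \<otimes>\<^bsub>G i\<^esub> entry i j (w j)" unfolding entry_eq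
    by (rule \<phi>_nth_mult[OF i restr_closed[OF w] e_closed[OF j carrier_P_nth[OF w j]]])
  finally show ?thesis .
qed

text \<open>The Krull--Schmidt exchange argument: the identity of \<open>G i\<close> is the sum over \<open>j\<close> of the
  endomorphisms \<open>\<phi>\<^sub>i\<^sub>j \<circ> \<psi>\<^sub>j\<^sub>i\<close>, and one of the summands has to be an automorphism.\<close>

lemma entry_surjective:
  assumes i: "i \<in> I" and nontriv: "carrier (G i) \<noteq> {\<one>\<^bsub>G i\<^esub>}"
    and summand: "\<And>u v. \<lbrakk>u \<in> hom (G i) (G i); v \<in> hom (G i) (G i);
      \<And>x. x \<in> carrier (G i) \<Longrightarrow> u x \<otimes>\<^bsub>G i\<^esub> v x = x;
      \<And>x y. x \<in> carrier (G i) \<Longrightarrow> y \<in> carrier (G i) \<Longrightarrow> u x \<otimes>\<^bsub>G i\<^esub> v y = v y \<otimes>\<^bsub>G i\<^esub> u x\<rbrakk>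
      \<Longrightarrow> u \<in> iso (G i) (G i) \<or> v \<in> iso (G i) (G i)"
  shows "\<exists>j\<in>I. entry i j ` carrier (G j) = carrier (G i)"
proof -
  interpret Gi: group "G i" by (rule groups[OF i])
  \<comment> \<open>Partial sums of the decomposition of the identity: constant for empty
    \<open>J\<close>, the identity for \<open>J = I\<close>.\<close>
  define s where "s = (\<lambda>J x. \<phi> (restr J (\<psi> (e i x))) i)"
  have pe: "\<psi> (e i x) \<in> carrier P" if "x \<in> carrier (G i)" for x by (rule \<psi>_closed[OF e_closed[OF i that]])
  have s_hom: "s J \<in> hom (G i) (G i)" for J
    using hom_compose[OF hom_compose[OF hom_compose[OF e_hom[OF i] \<psi>_hom] restr_hom] \<phi>_nth_hom[OF i], of J]
    by (simp add: s_def comp_def)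
  \<comment> \<open>Indices are removed one by one as long as the partial sum stays bijective. The
    process must stop before \<open>J\<close> is empty, because \<open>G i\<close> is
    nontrivial.\<close>
  have claim: "\<exists>j\<in>J. entry i j ` carrier (G j) = carrier (G i)"
    if "finite J" "J \<subseteq> I" "s J \<in> iso (G i) (G i)" for J
    using that
  proof (induction J)
    case empty
    have one: "s {} x = s {} \<one>\<^bsub>G i\<^esub>" for x by (simp only: s_def restr_empty)
    have "inj_on (s {}) (carrier (G i))" using empty by (simp add: iso_def bij_betw_def)
    then have "x = \<one>\<^bsub>G i\<^esub>" if "x \<in> carrier (G i)" for x
      by (rule inj_onD) (use that one in auto)
    then have "carrier (G i) = {\<one>\<^bsub>G i\<^esub>}" by blast
    then show ?case using nontriv by simp
  next
    case (insert j J)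
    have j: "j \<in> I" using insert by simp
    define t where "t = (\<lambda>x. entry i j (\<psi> (e i x) j))"
    have t_hom: "t \<in> hom (G i) (G i)"
      using hom_compose[OF hom_compose[OF hom_compose[OF e_hom[OF i] \<psi>_hom] hom_projection[OF j]] entry_hom[OF i j]]
      by (simp add: t_def comp_def)
    have split: "s (insert j J) x = s J x \<otimes>\<^bsub>G i\<^esub> t x" if x: "x \<in> carrier (G i)" for x
      unfolding s_def t_def restr_insert[OF pe[OF x] j insert.hyps(2)] entry_eq
      by (rule \<phi>_nth_mult[OF i restr_closed[OF pe[OF x]] e_closed[OF j carrier_P_nth[OF pe[OF x] j]]])
    have comm: "s J x \<otimes>\<^bsub>G i\<^esub> t y = t y \<otimes>\<^bsub>G i\<^esub> s J x"
      if "x \<in> carrier (G i)" "y \<in> carrier (G i)" for x y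
      unfolding s_def t_def
      by (rule \<phi>_restr_commute[OF i pe[OF that(1)] j insert.hyps(2) carrier_P_nth[OF pe[OF that(2)] j]])
    let ?\<alpha> = "s (insert j J)"
    \<comment> \<open>\<open>summand\<close> asks for two endomorphisms adding up to the identity;
      composing with the inverse of the current partial sum restores this.\<close>
    define \<beta> where "\<beta> = inv_into (carrier (G i)) ?\<alpha>"
    have \<alpha>: "bij_betw ?\<alpha> (carrier (G i)) (carrier (G i))" using insert.prems(2) by (simp add: iso_def)
    have \<beta>_hom: "\<beta> \<in> hom (G i) (G i)"
      using Gi.iso_set_sym[OF insert.prems(2)] by (simp add: \<beta>_def iso_def)
    have \<alpha>\<beta>: "?\<alpha> (\<beta> x) = x" if "x \<in> carrier (G i)" for x
      unfolding \<beta>_def by (rule bij_betw_inv_into_right[OF \<alpha> that])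
    have \<beta>\<alpha>: "\<beta> (?\<alpha> x) = x" if "x \<in> carrier (G i)" for x
      unfolding \<beta>_def by (rule bij_betw_inv_into_left[OF \<alpha> that])
    have cancel: "bij_betw h (carrier (G i)) (carrier (G i))"
      if "\<beta> \<circ> h \<in> iso (G i) (G i)" "h \<in> hom (G i) (G i)" for h
    proof -
      have "bij_betw (?\<alpha> \<circ> (\<beta> \<circ> h)) (carrier (G i)) (carrier (G i))"
        by (rule bij_betw_trans[OF _ \<alpha>]) (use that in \<open>simp add: iso_def\<close>)
      moreover have "(?\<alpha> \<circ> (\<beta> \<circ> h)) x = h x" if "x \<in> carrier (G i)" for x
        using \<alpha>\<beta>[OF hom_in_carrier[OF \<open>h \<in> hom (G i) (G i)\<close> that]] by simp
      ultimately show ?thesis by (subst bij_betw_cong[of _ h "?\<alpha> \<circ> (\<beta> \<circ> h)"]) auto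
    qed
    note sc = hom_in_carrier[OF s_hom] and tc = hom_in_carrier[OF t_hom]
    have "\<beta> \<circ> s J \<in> iso (G i) (G i) \<or> \<beta> \<circ> t \<in> iso (G i) (G i)"
    proof (rule summand)
      show "\<beta> \<circ> s J \<in> hom (G i) (G i)" "\<beta> \<circ> t \<in> hom (G i) (G i)"
        using hom_compose s_hom t_hom \<beta>_hom by blast+
    next
      fix x assume x: "x \<in> carrier (G i)"
      have "\<beta> (s J x) \<otimes>\<^bsub>G i\<^esub> \<beta> (t x) = \<beta> (s J x \<otimes>\<^bsub>G i\<^esub> t x)"
        using hom_mult[OF \<beta>_hom sc[OF x] tc[OF x]] by simp
      also have "\<dots> = x" unfolding split[OF x, symmetric] by (rule \<beta>\<alpha>[OF x])
      finally show "(\<beta> \<circ> s J) x \<otimes>\<^bsub>G i\<^esub> (\<beta> \<circ> t) x = x" by simp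
    next
      fix x y assume xy: "x \<in> carrier (G i)" "y \<in> carrier (G i)"
      show "(\<beta> \<circ> s J) x \<otimes>\<^bsub>G i\<^esub> (\<beta> \<circ> t) y = (\<beta> \<circ> t) y \<otimes>\<^bsub>G i\<^esub> (\<beta> \<circ> s J) x"
        using hom_mult[OF \<beta>_hom sc[OF xy(1), of J] tc[OF xy(2)]]
          hom_mult[OF \<beta>_hom tc[OF xy(2)] sc[OF xy(1), of J]] comm[OF xy] by simp
    qed
    then show ?case
    proof
      assume "\<beta> \<circ> s J \<in> iso (G i) (G i)"
      then have "bij_betw (s J) (carrier (G i)) (carrier (G i))" by (rule cancel[OF _ s_hom])
      then have "s J \<in> iso (G i) (G i)" using s_hom by (simp add: iso_def)
      then show ?thesis using insert by blast
    next
      assume "\<beta> \<circ> t \<in> iso (G i) (G i)"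
      then have "bij_betw t (carrier (G i)) (carrier (G i))" by (rule cancel[OF _ t_hom])
      then have "t ` carrier (G i) = carrier (G i)" by (simp add: bij_betw_def)
      \<comment> \<open>\<open>t\<close> ends with \<open>entry i j\<close>, so its bijectivity
        gives surjectivity of the entry, but not injectivity.\<close>
      moreover have "t ` carrier (G i) \<subseteq> entry i j ` carrier (G j)"
        using carrier_P_nth[OF pe j] by (auto simp: t_def)
      moreover have "entry i j ` carrier (G j) \<subseteq> carrier (G i)" using entry_closed[OF i j] by blast
      ultimately show ?thesis by blast
    qed
  qed
  have "s I x = x" if x: "x \<in> carrier (G i)" for x
    using restr_all[OF pe[OF x]] \<phi>\<psi>[OF e_closed[OF i x]] i by (simp add: s_def e_nth)
  then have "bij_betw (s I) (carrier (G i)) (carrier (G i))"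
    using bij_betw_cong[of "carrier (G i)" "s I" id] by simp
  then have "s I \<in> iso (G i) (G i)" using s_hom by (simp add: iso_def)
  then show ?thesis using claim[OF fin order_refl] by blast
qed

text \<open>Values of different entries in a row commute, and the values of the surjective entry are
  all of \<open>G i\<close>.\<close>

lemma entry_central:
  assumes i: "i \<in> I" and j: "j \<in> I" and surj: "entry i j ` carrier (G j) = carrier (G i)"
    and l: "l \<in> I" "l \<noteq> j"
  shows "entry i l ` carrier (G l) \<subseteq> centre (G i)"
proof
  fix x assume "x \<in> entry i l ` carrier (G l)"
  then obtain x' where x': "x' \<in> carrier (G l)" "x = entry i l x'" by blast
  have "x \<otimes>\<^bsub>G i\<^esub> y = y \<otimes>\<^bsub>G i\<^esub> x" if "y \<in> carrier (G i)" for y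
  proof -
    obtain y' where "y' \<in> carrier (G j)" "y = entry i j y'" using \<open>y \<in> carrier (G i)\<close> surj by blast
    then show ?thesis using entry_commute[OF i j l(1) _ _ x'(1)] l(2) x' by simp
  qed
  then show "x \<in> centre (G i)" using entry_closed[OF i l(1) x'(1)] x'(2) by (simp add: centre_def)
qed

text \<open>The part of the argument that needs no roots: the completions will enter only through
  \<open>central\<close> and \<open>kill\<close>, so the lemma applies to the groups of the theorem
  themselves.\<close>

lemma permutation_of_central_entries:
  assumes nil: "\<And>i. i \<in> I \<Longrightarrow> nilpotent_group (G i)"
    and nonab: "\<And>i. i \<in> I \<Longrightarrow> \<not> comm_group (G i)"
    and \<sigma>: "\<And>i. i \<in> I \<Longrightarrow> \<sigma> i \<in> I"
    and central: "\<And>i l. i \<in> I \<Longrightarrow> l \<in> I \<Longrightarrow> l \<noteq> \<sigma> i \<Longrightarrow> entry i l ` carrier (G l) \<subseteq> centre (G i)"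
    and kill: "\<And>i l z. i \<in> I \<Longrightarrow> l \<in> I \<Longrightarrow> l \<noteq> \<sigma> i \<Longrightarrow> z \<in> centre (G l) \<Longrightarrow> entry i l z = \<one>\<^bsub>G i\<^esub>"
  shows "bij_betw \<sigma> I I"
    and "i \<in> I \<Longrightarrow> j \<in> I \<Longrightarrow> entry i j \<in> iso (G j) (G i) \<longleftrightarrow> j = \<sigma> i"
proof -
  have "I \<subseteq> \<sigma> ` I"
  proof (rule ccontr)
    assume "\<not> I \<subseteq> \<sigma> ` I"
    then obtain j where j: "j \<in> I" "j \<notin> \<sigma> ` I" by blast
    interpret Gj: group "G j" by (rule groups[OF j(1)])
    have "comm_group (G j)"
    proof (rule Gj.group_comm_groupI)
      fix x y assume xy: "x \<in> carrier (G j)" "y \<in> carrier (G j)"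
      have exy: "e j x \<otimes>\<^bsub>P\<^esub> e j y \<in> carrier P" "e j y \<otimes>\<^bsub>P\<^esub> e j x \<in> carrier P"
        using P.m_closed e_closed[OF j(1)] xy by blast+
      have "\<phi> (e j x \<otimes>\<^bsub>P\<^esub> e j y) = \<phi> (e j y \<otimes>\<^bsub>P\<^esub> e j x)"
      proof (rule P_eqI)
        fix i assume i: "i \<in> I"
        have "entry i j x \<in> centre (G i)" using central[OF i j(1)] j(2) i xy(1) by blast
        then have "entry i j x \<otimes>\<^bsub>G i\<^esub> entry i j y = entry i j y \<otimes>\<^bsub>G i\<^esub> entry i j x"
          using entry_closed[OF i j(1) xy(2)] by (simp add: centre_def)
        then show "\<phi> (e j x \<otimes>\<^bsub>P\<^esub> e j y) i = \<phi> (e j y \<otimes>\<^bsub>P\<^esub> e j x) i"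
          using \<phi>_nth_mult[OF i e_closed[OF j(1) xy(1)] e_closed[OF j(1) xy(2)]]
            \<phi>_nth_mult[OF i e_closed[OF j(1) xy(2)] e_closed[OF j(1) xy(1)]] by (simp only: entry_eq)
      qed (rule \<phi>_closed[OF exy(1)], rule \<phi>_closed[OF exy(2)])
      then have "e j x \<otimes>\<^bsub>P\<^esub> e j y = e j y \<otimes>\<^bsub>P\<^esub> e j x" by (rule \<phi>_inj[OF exy])
      from fun_cong[OF this, of j] show "x \<otimes>\<^bsub>G j\<^esub> y = y \<otimes>\<^bsub>G j\<^esub> x" using j by (simp add: e_nth)
    qed
    then show False using nonab[OF j(1)] by blast
  qed
  then have surj: "\<sigma> ` I = I" using \<sigma> by blast
  then have inj: "inj_on \<sigma> I" using fin by (intro eq_card_imp_inj_on) auto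
  show "bij_betw \<sigma> I I" using surj inj by (simp add: bij_betw_def)

  have iso: "entry i (\<sigma> i) \<in> iso (G (\<sigma> i)) (G i)" if i: "i \<in> I" for i
  proof -
    let ?j = "\<sigma> i"
    note j = \<sigma>[OF i]
    interpret Gi: group "G i" by (rule groups[OF i])
    interpret Gj: group "G ?j" by (rule groups[OF j])
    interpret f: group_hom "G ?j" "G i" "entry i ?j" using entry_hom[OF i j] by unfold_locales
    have Zsurj: "z \<in> entry i ?j ` carrier (G ?j)" if z: "z \<in> centre (G i)" for z
    proof -
      have zc: "z \<in> carrier (G i)" using z by (simp add: centre_def)
      \<comment> \<open>\<open>e i z\<close> is central in \<open>P\<close>, hence so is its
        preimage \<open>w\<close>, which therefore has central coordinates. By \<open>kill\<close>
        only the entry at \<open>?j\<close> contributes to \<open>\<phi> w i\<close>.\<close>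
      define w where "w = \<psi> (e i z)"
      have w: "w \<in> carrier P" "\<phi> w = e i z" 
        unfolding w_def by (rule \<psi>_closed[OF e_closed[OF i zc]], rule \<phi>\<psi>[OF e_closed[OF i zc]])
      have ecomm: "e i z \<otimes>\<^bsub>P\<^esub> v = v \<otimes>\<^bsub>P\<^esub> e i z" if v: "v \<in> carrier P" for v
        using z v one_mult mult_one
        by (auto simp: fun_eq_iff e_nth PiE_iff centre_def)
      have wcomm: "w \<otimes>\<^bsub>P\<^esub> v = v \<otimes>\<^bsub>P\<^esub> w" if v: "v \<in> carrier P" for v
      proof (rule \<phi>_inj)
        show "\<phi> (w \<otimes>\<^bsub>P\<^esub> v) = \<phi> (v \<otimes>\<^bsub>P\<^esub> w)"
          using hom_mult[OF \<phi>_hom w(1) v] hom_mult[OF \<phi>_hom v w(1)] ecomm[OF \<phi>_closed[OF v]] w(2) by metis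
      qed (rule P.m_closed[OF w(1) v], rule P.m_closed[OF v w(1)])
      have wZ: "w l \<in> centre (G l)" if l: "l \<in> I" for l
      proof -
        have "w l \<otimes>\<^bsub>G l\<^esub> y = y \<otimes>\<^bsub>G l\<^esub> w l" if "y \<in> carrier (G l)" for y
          using fun_cong[OF wcomm[OF e_closed[OF l that]], of l] l by (simp add: e_nth)
        then show ?thesis using carrier_P_nth[OF w(1) l] by (simp add: centre_def)
      qed
      have "\<phi> (restr (I - {?j}) w) i \<in> {\<one>\<^bsub>G i\<^esub>}"
        by (rule \<phi>_restr_in_subgroup[OF i Gi.triv_subgroup w(1)]) (use kill[OF i _ _ wZ] in auto)
      then have "\<phi> w i = entry i ?j (w ?j)"
        using \<phi>_nth_split[OF i j w(1)] entry_closed[OF i j carrier_P_nth[OF w(1) j]] by simp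
      then have "z = entry i ?j (w ?j)" using w(2) i by (simp add: e_nth)
      then show ?thesis using carrier_P_nth[OF w(1) j] by blast
    qed
    \<comment> \<open>All entries except the one at \<open>?j\<close> contribute a central factor,
      and \<open>Zsurj\<close> places that factor in the image.\<close>
    have surj: "x \<in> entry i ?j ` carrier (G ?j)" if x: "x \<in> carrier (G i)" for x
    proof -
      define w where "w = \<psi> (e i x)"
      have w: "w \<in> carrier P" "\<phi> w = e i x" 
        unfolding w_def by (rule \<psi>_closed[OF e_closed[OF i x]], rule \<phi>\<psi>[OF e_closed[OF i x]])
      have "\<phi> (restr (I - {?j}) w) i \<in> centre (G i)"
      proof (rule \<phi>_restr_in_subgroup[OF i Gi.subgroup_centre w(1)])
        fix l assume "l \<in> I - {?j}"
        then show "entry i l (w l) \<in> centre (G i)"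
          using central[OF i, of l] carrier_P_nth[OF w(1), of l] by blast
      qed blast
      then have "\<phi> (restr (I - {?j}) w) i \<in> entry i ?j ` carrier (G ?j)" by (rule Zsurj)
      moreover have "entry i ?j (w ?j) \<in> entry i ?j ` carrier (G ?j)" using carrier_P_nth[OF w(1) j] by blast
      ultimately have "\<phi> w i \<in> entry i ?j ` carrier (G ?j)"
        unfolding \<phi>_nth_split[OF i j w(1)] by (rule subgroup.m_closed[OF f.img_is_subgroup])
      then show ?thesis using w(2) i by (simp add: e_nth)
    qed
    have "kernel (G ?j) (G i) (entry i ?j) = {\<one>\<^bsub>G ?j\<^esub>}"
    proof (rule ccontr)
      assume "kernel (G ?j) (G i) (entry i ?j) \<noteq> {\<one>\<^bsub>G ?j\<^esub>}"
      then obtain x where "x \<in> kernel (G ?j) (G i) (entry i ?j)" "x \<noteq> \<one>\<^bsub>G ?j\<^esub>"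
        using subgroup.one_closed[OF f.subgroup_kernel] by blast
      then obtain z where z: "z \<in> kernel (G ?j) (G i) (entry i ?j)" "z \<in> centre (G ?j)" "z \<noteq> \<one>\<^bsub>G ?j\<^esub>"
        using Gj.normal_meets_centre[OF nil[OF j] f.normal_kernel] by blast
      have zc: "z \<in> carrier (G ?j)" using z(2) by (simp add: centre_def)
      have "\<phi> (e ?j z) = \<phi> \<one>\<^bsub>P\<^esub>"
      proof (rule P_eqI[OF \<phi>_closed[OF e_closed[OF j zc]] \<phi>_closed[OF P.one_closed]])
        fix i' assume i': "i' \<in> I"
        \<comment> \<open>A central kernel element dies in the whole column: in row \<open>i\<close>
          by choice, in every other row by \<open>kill\<close>, as \<sigma> is injective. Then
          \<phi> would not be injective.\<close>
        have "entry i' ?j z = \<one>\<^bsub>G i'\<^esub>"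
        proof (cases "i' = i")
          case True
          then show ?thesis using z(1) by (simp add: kernel_def)
        next
          case False
          then have "?j \<noteq> \<sigma> i'" using inj i i' by (auto dest: inj_onD)
          then show ?thesis using kill[OF i' j _ z(2)] by blast
        qed
        moreover have "group_hom P (G i') (\<lambda>w. \<phi> w i')"
          by (intro group_hom.intro group_hom_axioms.intro P.group_axioms groups i' \<phi>_nth_hom)
        ultimately show "\<phi> (e ?j z) i' = \<phi> \<one>\<^bsub>P\<^esub> i'" using group_hom.hom_one by (fastforce simp: entry_eq)
      qed
      then have "e ?j z = \<one>\<^bsub>P\<^esub>" by (rule \<phi>_inj[OF e_closed[OF j zc] P.one_closed])
      from fun_cong[OF this, of ?j] have "z = \<one>\<^bsub>G ?j\<^esub>" using j by (simp add: e_nth)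
      then show False using z(3) by blast
    qed
    then have "inj_on (entry i ?j) (carrier (G ?j))" by (simp add: f.inj_iff_trivial_ker)
    then have "bij_betw (entry i ?j) (carrier (G ?j)) (carrier (G i))"
      unfolding bij_betw_def using surj f.hom_closed by blast
    then show ?thesis using entry_hom[OF i j] by (simp add: iso_def)
  qed
  show "entry i j \<in> iso (G j) (G i) \<longleftrightarrow> j = \<sigma> i" if i: "i \<in> I" and j: "j \<in> I"
  proof
    assume en: "entry i j \<in> iso (G j) (G i)"
    show "j = \<sigma> i"
    proof (rule ccontr)
      \<comment> \<open>A bijective entry with central image would make \<open>G i\<close>
        abelian.\<close>
      assume "j \<noteq> \<sigma> i"
      from central[OF i j this] en have "carrier (G i) \<subseteq> centre (G i)" by (simp add: iso_def bij_betw_def)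
      then have "comm_group (G i)" by (intro group.group_comm_groupI groups i) (auto simp: centre_def)
      then show False using nonab[OF i] by blast
    qed
  qed (use iso i in simp)
qed

end

section \<open>Passing between the groups and their completions\<close>

theorem theorem3p1:
  fixes k :: nat and N :: "nat \<Rightarrow> 'a monoid" and \<phi> :: "(nat \<Rightarrow> 'a) \<Rightarrow> (nat \<Rightarrow> 'a)"
  assumes "k \<ge> 1"
    and "\<And>i. i \<in> {1..k} \<Longrightarrow> nilpotent_group (N i)"
    and "\<And>i. i \<in> {1..k} \<Longrightarrow> finitely_generated (N i)"
    and "\<And>i. i \<in> {1..k} \<Longrightarrow> torsion_free (N i)"
    and "\<And>i. i \<in> {1..k} \<Longrightarrow> \<not> comm_group (N i)"
    and "\<And>i. i \<in> {1..k} \<Longrightarrow> rationally_indecomposable (N i)"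
    and "\<phi> \<in> iso (product_group {1..k} N) (product_group {1..k} N)"
  shows "\<exists>\<sigma>.
     (\<forall>i \<in> {1..k}. \<sigma> i \<in> {1..k} \<and> matrix_entry {1..k} N \<phi> i (\<sigma> i) \<in> iso (N (\<sigma> i)) (N i) \<and>
        (\<forall>s \<in> {1..k}. matrix_entry {1..k} N \<phi> i s \<in> iso (N s) (N i) \<longrightarrow> s = \<sigma> i)) \<and>
     (\<forall>j \<in> {1..k}. \<exists>!i. i \<in> {1..k} \<and> matrix_entry {1..k} N \<phi> i j \<in> iso (N j) (N i)) \<and>
     (\<forall>i \<in> {1..k}. \<forall>j \<in> {1..k}. j \<noteq> \<sigma> i \<longrightarrow>
        matrix_entry {1..k} N \<phi> i j ` carrier (N j) \<subseteq> centre (N i))"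
proof -
  let ?I = "{1..k}"
  note nilN = assms(2) and fgN = assms(3) and nonabN = assms(5)
  have gN: "group (N i)" if "i \<in> ?I" for i using nilN[OF that] by (simp add: nilpotent_group_def)
  interpret N: product_automorphism ?I N \<phi>
    by (intro product_automorphism.intro finite_group_family.intro product_automorphism_axioms.intro)
      (rule finite_atLeastAtMost gN assms(7), assumption?)+
  have "\<exists>M \<iota>. malcev_completion (N i) (M :: nat monoid) \<iota> \<and> directly_indecomposable M" if "i \<in> ?I" for i
    using assms(6)[OF that] by (simp add: rationally_indecomposable_def)
  then obtain M :: "nat \<Rightarrow> nat monoid" and \<iota>
    where M: "\<And>i. i \<in> ?I \<Longrightarrow> malcev_completion (N i) (M i) (\<iota> i)"
      and ind: "\<And>i. i \<in> ?I \<Longrightarrow> directly_indecomposable (M i)" by metis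
  note rM = malcev_rational_group[OF M]
  have nilM: "nilpotent_group (M i)" and \<iota>: "\<iota> i \<in> mon (N i) (M i)"
    and powM: "\<And>x. x \<in> carrier (M i) \<Longrightarrow> \<exists>m::nat. m \<ge> 1 \<and> x [^]\<^bsub>M i\<^esub> m \<in> \<iota> i ` carrier (N i)"
    if "i \<in> ?I" for i using M[OF that] by (auto simp: malcev_completion_def)
  have gM: "group (M i)" if "i \<in> ?I" for i using nilM[OF that] by (simp add: nilpotent_group_def)
  have h\<iota>: "group_hom (N i) (M i) (\<iota> i)" if "i \<in> ?I" for i
    using \<iota>[OF that] gN[OF that] gM[OF that] by (auto simp: mon_def intro!: group_hom.intro group_hom_axioms.intro)
  note \<iota>c = group_hom.hom_closed[OF h\<iota>] and \<iota>m = group_hom.hom_mult[OF h\<iota>]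
  have \<iota>inj: "x = y" if "i \<in> ?I" "\<iota> i x = \<iota> i y" "x \<in> carrier (N i)" "y \<in> carrier (N i)" for i x y
    using \<iota>[OF that(1)] that(2-4) by (auto simp: mon_def dest: inj_onD)
  have frM: "finite_rank (M i)" if "i \<in> ?I" for i
    by (rule malcev_finite_rank[OF nilN[OF that] fgN[OF that] M[OF that]])
  define \<iota>P where "\<iota>P = (\<lambda>f. \<lambda>i\<in>?I. \<iota> i (f i))"
  have MP: "malcev_completion (product_group ?I N) (product_group ?I M) \<iota>P"
    unfolding \<iota>P_def by (rule malcev_completion_product_group) (use gN M in auto)
  obtain \<Phi> where \<Phi>: "\<Phi> \<in> iso (product_group ?I M) (product_group ?I M)"
    and \<Phi>\<iota>: "\<And>f. f \<in> carrier (product_group ?I N) \<Longrightarrow> \<Phi> (\<iota>P f) = \<iota>P (\<phi> f)"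
    using malcev_extension_iso[OF N.P.group_axioms N.P.group_axioms MP MP assms(7)] by blast
  interpret M: product_automorphism ?I M \<Phi>
    by (intro product_automorphism.intro finite_group_family.intro product_automorphism_axioms.intro)
      (rule finite_atLeastAtMost gM \<Phi>, assumption?)+
  \<comment> \<open>The entries of \<Phi> extend those of \<phi>, so statements about entries can be
    moved along the embeddings \<iota>.\<close>
  have entry: "M.entry i j (\<iota> j x) = \<iota> i (N.entry i j x)"
    if i: "i \<in> ?I" and j: "j \<in> ?I" and x: "x \<in> carrier (N j)" for i j x
  proof -
    have "M.e j (\<iota> j x) = \<iota>P (N.e j x)"
      using group_hom.hom_one[OF h\<iota>] by (auto simp: \<iota>P_def canonical_inclusion_def fun_eq_iff)
    then have "\<Phi> (M.e j (\<iota> j x)) = \<iota>P (\<phi> (N.e j x))" using \<Phi>\<iota>[OF N.e_closed[OF j x]] by simp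
    then show ?thesis unfolding M.entry_eq N.entry_eq using i by (simp add: \<iota>P_def)
  qed
  have nonabM: "\<not> comm_group (M i)" if i: "i \<in> ?I" for i
  proof
    assume "comm_group (M i)"
    then interpret Mi: comm_group "M i" .
    have "comm_group (N i)"
    proof (rule group.group_comm_groupI[OF gN[OF i]])
      fix x y assume xy: "x \<in> carrier (N i)" "y \<in> carrier (N i)"
      interpret Ni: group "N i" by (rule gN[OF i])
      have "\<iota> i (x \<otimes>\<^bsub>N i\<^esub> y) = \<iota> i (y \<otimes>\<^bsub>N i\<^esub> x)"
        using Mi.m_comm[OF \<iota>c[OF i xy(1)] \<iota>c[OF i xy(2)]] \<iota>m[OF i] xy by simp
      then show "x \<otimes>\<^bsub>N i\<^esub> y = y \<otimes>\<^bsub>N i\<^esub> x" using \<iota>inj[OF i] xy by simp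
    qed
    then show False using nonabN[OF i] by blast
  qed
  have "\<exists>j\<in>?I. M.entry i j ` carrier (M j) = carrier (M i)" if i: "i \<in> ?I" for i
  proof (rule M.entry_surjective[OF i])
    interpret Mi: group "M i" by (rule gM[OF i])
    show "carrier (M i) \<noteq> {\<one>\<^bsub>M i\<^esub>}" using nonabM[OF i] Mi.group_comm_groupI by auto
    fix u v assume "u \<in> hom (M i) (M i)" "v \<in> hom (M i) (M i)"
      "\<And>x. x \<in> carrier (M i) \<Longrightarrow> u x \<otimes>\<^bsub>M i\<^esub> v x = x"
      "\<And>x y. x \<in> carrier (M i) \<Longrightarrow> y \<in> carrier (M i) \<Longrightarrow> u x \<otimes>\<^bsub>M i\<^esub> v y = v y \<otimes>\<^bsub>M i\<^esub> u x"
    then show "u \<in> iso (M i) (M i) \<or> v \<in> iso (M i) (M i)"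
      by (rule rational_group.iso_summand[OF rM[OF i] frM[OF i] ind[OF i]])
  qed
  \<comment> \<open>Here \<sigma> is only a choice of a surjective entry in each row of \<Phi>. That
    it is a permutation marking isomorphisms is derived in \<open>N\<close>.\<close>
  then obtain \<sigma> where \<sigma>: "\<And>i. i \<in> ?I \<Longrightarrow> \<sigma> i \<in> ?I"
    and \<sigma>_surj: "\<And>i. i \<in> ?I \<Longrightarrow> M.entry i (\<sigma> i) ` carrier (M (\<sigma> i)) = carrier (M i)" by metis
  have centralM: "M.entry i l x \<in> centre (M i)"
    if "i \<in> ?I" "l \<in> ?I" "l \<noteq> \<sigma> i" "x \<in> carrier (M l)" for i l x
    using M.entry_central[OF that(1) \<sigma>[OF that(1)] \<sigma>_surj[OF that(1)] that(2,3)] that(4) by blast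
  have central: "N.entry i l ` carrier (N l) \<subseteq> centre (N i)"
    if i: "i \<in> ?I" and l: "l \<in> ?I" "l \<noteq> \<sigma> i" for i l
  proof clarify
    fix x assume x: "x \<in> carrier (N l)"
    interpret Ni: group "N i" by (rule gN[OF i])
    let ?x = "N.entry i l x"
    have xc: "?x \<in> carrier (N i)" by (rule N.entry_closed[OF i l(1) x])
    have "\<iota> i ?x \<in> centre (M i)" using centralM[OF i l \<iota>c[OF l(1) x]] entry[OF i l(1) x] by simp
    then have "\<iota> i (?x \<otimes>\<^bsub>N i\<^esub> y) = \<iota> i (y \<otimes>\<^bsub>N i\<^esub> ?x)" if y: "y \<in> carrier (N i)" for y
      using \<iota>c[OF i y] \<iota>m[OF i xc y] \<iota>m[OF i y xc] by (simp add: centre_def)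
    then have "?x \<otimes>\<^bsub>N i\<^esub> y = y \<otimes>\<^bsub>N i\<^esub> ?x" if y: "y \<in> carrier (N i)" for y
      using \<iota>inj[OF i] xc y by simp
    then show "?x \<in> centre (N i)" using xc by (simp add: centre_def)
  qed
  have kill: "N.entry i l z = \<one>\<^bsub>N i\<^esub>"
    if i: "i \<in> ?I" and l: "l \<in> ?I" "l \<noteq> \<sigma> i" and z: "z \<in> centre (N l)" for i l z
  proof -
    interpret Ml: rational_group "M l" by (rule rM[OF l(1)])
    have zc: "z \<in> carrier (N l)" and zcomm: "\<And>y. y \<in> carrier (N l) \<Longrightarrow> z \<otimes>\<^bsub>N l\<^esub> y = y \<otimes>\<^bsub>N l\<^esub> z"
      using z by (auto simp: centre_def)
    \<comment> \<open>A central element of \<open>N l\<close> commutes with some power of each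
      element of \<open>M l\<close>, and therefore with the element itself.\<close>
    have "\<iota> l z \<otimes>\<^bsub>M l\<^esub> x = x \<otimes>\<^bsub>M l\<^esub> \<iota> l z" if x: "x \<in> carrier (M l)" for x
    proof -
      obtain m n where m: "(m::nat) \<ge> 1" "n \<in> carrier (N l)" "x [^]\<^bsub>M l\<^esub> m = \<iota> l n"
        using powM[OF l(1) x] by auto
      have "x [^]\<^bsub>M l\<^esub> m \<otimes>\<^bsub>M l\<^esub> \<iota> l z = \<iota> l z \<otimes>\<^bsub>M l\<^esub> x [^]\<^bsub>M l\<^esub> m"
        using zcomm[OF m(2)] \<iota>m[OF l(1) zc m(2)] \<iota>m[OF l(1) m(2) zc] m(3) by simp
      then show ?thesis using Ml.commute_of_pow_commute[OF x \<iota>c[OF l(1) zc] m(1)] by simp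
    qed
    then have "\<iota> l z \<in> centre (M l)" using \<iota>c[OF l(1) zc] by (simp add: centre_def)
    \<comment> \<open>Off \<sigma> the entry of \<Phi> has central image, in particular an abelian
      one.\<close>
    then have "M.entry i l (\<iota> l z) = \<one>\<^bsub>M i\<^esub>"
    proof (rule Ml.hom_abelian_image_kills_centre[OF nilM[OF l(1)] frM[OF l(1)] ind[OF l(1)] nonabM[OF l(1)]
          rM[OF i] M.entry_hom[OF i l(1)], rotated])
      fix x y assume x: "x \<in> carrier (M l)" and y: "y \<in> carrier (M l)"
      show "M.entry i l x \<otimes>\<^bsub>M i\<^esub> M.entry i l y = M.entry i l y \<otimes>\<^bsub>M i\<^esub> M.entry i l x"
        using centralM[OF i l x] M.entry_closed[OF i l(1) y] by (simp add: centre_def)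
    qed
    then have "\<iota> i (N.entry i l z) = \<iota> i \<one>\<^bsub>N i\<^esub>"
      using entry[OF i l(1) zc] group_hom.hom_one[OF h\<iota>[OF i]] by simp
    then show ?thesis using \<iota>inj[OF i] N.entry_closed[OF i l(1) zc] N.one_in[OF i] by blast
  qed
  have bij: "bij_betw \<sigma> ?I ?I"
    by (rule N.permutation_of_central_entries(1)[OF nilN nonabN \<sigma> central kill])
  have iff: "N.entry i j \<in> iso (N j) (N i) \<longleftrightarrow> j = \<sigma> i" if "i \<in> ?I" "j \<in> ?I" for i j
    by (rule N.permutation_of_central_entries(2)[OF nilN nonabN \<sigma> central kill that])
  show ?thesis
  proof (intro exI[of _ \<sigma>] conjI ballI impI)
    fix i assume i: "i \<in> ?I"
    show "\<sigma> i \<in> ?I" by (rule \<sigma>[OF i])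
    show "N.entry i (\<sigma> i) \<in> iso (N (\<sigma> i)) (N i)" using iff[OF i \<sigma>[OF i]] by simp
    show "s = \<sigma> i" if "s \<in> ?I" "N.entry i s \<in> iso (N s) (N i)" for s using iff[OF i that(1)] that(2) by simp
    show "N.entry i j ` carrier (N j) \<subseteq> centre (N i)" if "j \<in> ?I" "j \<noteq> \<sigma> i" for j
      by (rule central[OF i that])
  next
    fix j assume j: "j \<in> ?I"
    then have "j \<in> \<sigma> ` ?I" using bij by (simp only: bij_betw_def)
    then obtain i where i: "i \<in> ?I" "\<sigma> i = j" by blast
    show "\<exists>!i. i \<in> ?I \<and> N.entry i j \<in> iso (N j) (N i)"
    proof (rule ex1I[of _ i])
      show "i \<in> ?I \<and> N.entry i j \<in> iso (N j) (N i)" using i(1) iffD2[OF iff[OF i(1) j] i(2)[symmetric]] by (rule conjI)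
    next
      fix i' assume i': "i' \<in> ?I \<and> N.entry i' j \<in> iso (N j) (N i')"
      have "j = \<sigma> i'" by (rule iffD1[OF iff[OF conjunct1[OF i'] j] conjunct2[OF i']])
      then have "\<sigma> i' = \<sigma> i" unfolding i(2) by (rule sym)
      then show "i' = i" by (rule inj_onD[OF bij_betw_imp_inj_on[OF bij] _ conjunct1[OF i'] i(1)])
    qed
  qed
qed

end
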